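(* Let $X$ be a connected Frobenius algebra in a positive tensor category (over $\mathbb{C}$). Then every coherent sublattice of the Frobenius subalgebra poset of $X$ is finite.
   Context: Tensor categories (in the sense of Etingof–Gelaki–Nikshych–Ostrik: locally finite linear abelian rigid monoidal, bilinear tensor product, $\mathrm{End}(\mathbf 1)=\mathbb{C}$) are taken strict. A left dual of $X$ is $(X^*,\mathrm{ev}_X:X^*\otimes X\to\mathbf 1,\mathrm{coev}_X:\mathbf 1\to X\otimes X^* )$ satisfying the zigzag identities; $f^*:Y^*\to X^*$ is the dual of $f:X\to Y$. A tensor category is positive if it has a pivotal structure $\phi$ (monoidal natural isomorphism $\phi:\mathrm{id}\to(\,)^{**}$) such that $\mathrm{tr}_\phi(\mathrm{id}_Y):=\mathrm{ev}_{Y^*}\circ(\phi_Y\otimes\mathrm{id}_{Y^*})\circ\mathrm{coev}_Y\in\mathbb{C}$ is a positive real number for every nonzero object $Y$. A Frobenius algebra is $(X,m,\delta,e,\epsilon)$ with $(X,m,e)$ a unital algebra, $(X,\delta,\epsilon)$ a counital coalgebra and $(\mathrm{id}_X\otimes m)\circ(\delta\otimes \mathrm{id}_X)=\delta\circ m=(m\otimes \mathrm{id}_X)\circ(\mathrm{id}_X\otimes\delta)$. It is always regarded as selfdual, $X^*=X$, with $\mathrm{ev}_X=\epsilon\circ m$, $\mathrm{coev}_X=\delta\circ e$. $X$ is connected if $\dim\mathrm{Hom}(\mathbf 1,X)=1$. A Frobenius algebra $X'$ is a Frobenius subalgebra of $X$ if there is a unital algebra monomorphism $i:X'\to X$ with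 $i^{**}=i$, $i^*\circ i=\mathrm{id}_{X'}$; put $b_{X'}:=i\circ i^*$. Two Frobenius subalgebras are equivalent iff their idempotents $b$ coincide; classes are denoted $[X']$; the Frobenius subalgebra poset of $X$ is the set of classes with $[X_1]\le[X_2]$ iff $b_{X_1}\circ b_{X_2}=b_{X_1}=b_{X_2}\circ b_{X_1}$. Ambient selfduality: let $C=C^*$ be selfdual and $(B,i,p)$ a split subobject ($p\circ i=\mathrm{id}_B$), $b=i\circ p$. Split $b^*=i'\circ p'$, $p'\circ i'=\mathrm{id}_{B'}$; the ambient dual of $B$ is $(B',\mathrm{ev}_C\circ(i'\otimes i),(p\otimes p')\circ\mathrm{coev}_C)$ (then $i^*=p'$, $p^*=i'$). $B$ is ambiently selfdual if it coincides with its ambient dual, i.e. one may take $B'=B$, $i'=i$, $p'=p$ (so $i^*=p$, $i^{**}=p^*=i$). A pair $(A,B)$ of subobjects of $X$ is coherent if $A$, $B$, $A\cap B$ (pullback) and $A+B$ (the join in the lattice of subobjects of $X$) are all ambiently selfdual subobjects of $X$. A sublattice $L$ of the Frobenius subalgebra poset is coherent if it has a bottom element and for all $[A],[B]\in L$ the pair $(A,B)$ is coherent and $[A]\wedge[B]=[A\cap B]$. *)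

theory Defs
  imports Complex_Main "HOL-Algebra.Lattice" "Jordan_Normal_Form.VS_Connect"
begin

section \<open>Strict tensor categories over the complex numbers\<close>

text \<open>
  Objects are the elements of the type \<^typ>\<open>'o\<close>; morphisms from \<open>X\<close> to \<open>Y\<close> are the elements of
  the complex vector space \<open>Hom C X Y\<close>. Hom-sets are not required to be disjoint, so every notion
  below mentions the domains and codomains it depends on. The multiplicative fields of the record
  \<open>Hom C X Y\<close> (which HOL-Algebra modules inherit from rings) are never used.
\<close>

record ('o, 'm) tcat =
  Hom :: "'o \<Rightarrow> 'o \<Rightarrow> (complex, 'm) module"
  Comp :: "'m \<Rightarrow> 'm \<Rightarrow> 'm" (infixr \<open>\<cdot>\<index>\<close> 70)
  ident :: "'o \<Rightarrow> 'm" (\<open>\<i>\<d>\<index>\<close>)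
  tens_ob :: "'o \<Rightarrow> 'o \<Rightarrow> 'o" (infixr \<open>\<otimes>\<^sub>O\<index>\<close> 75)
  tens_arr :: "'m \<Rightarrow> 'm \<Rightarrow> 'm" (infixr \<open>\<otimes>\<^sub>A\<index>\<close> 75)
  unit_ob :: 'o (\<open>\<I>\<index>\<close>)

abbreviation Arr :: "('o, 'm) tcat \<Rightarrow> 'o \<Rightarrow> 'o \<Rightarrow> 'm set"
  where "Arr C X Y \<equiv> carrier (Hom C X Y)"

locale category =
  fixes C :: "('o, 'm) tcat" (structure)
  assumes comp_closed: "\<lbrakk>g \<in> Arr C Y Z; f \<in> Arr C X Y\<rbrakk> \<Longrightarrow> g \<cdot> f \<in> Arr C X Z"
    and id_closed: "\<i>\<d> X \<in> Arr C X X"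
    and comp_assoc:
      "\<lbrakk>h \<in> Arr C Z W; g \<in> Arr C Y Z; f \<in> Arr C X Y\<rbrakk> \<Longrightarrow> (h \<cdot> g) \<cdot> f = h \<cdot> (g \<cdot> f)"
    and id_left: "f \<in> Arr C X Y \<Longrightarrow> \<i>\<d> Y \<cdot> f = f"
    and id_right: "f \<in> Arr C X Y \<Longrightarrow> f \<cdot> \<i>\<d> X = f"

locale linear_category = category +
  assumes hom_vectorspace: "vectorspace class_ring (Hom C X Y)"
    and comp_add_left: "\<lbrakk>g \<in> Arr C Y Z; g' \<in> Arr C Y Z; f \<in> Arr C X Y\<rbrakk> \<Longrightarrow>
      (g \<oplus>\<^bsub>Hom C Y Z\<^esub> g') \<cdot> f = (g \<cdot> f) \<oplus>\<^bsub>Hom C X Z\<^esub> (g' \<cdot> f)"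
    and comp_add_right: "\<lbrakk>g \<in> Arr C Y Z; f \<in> Arr C X Y; f' \<in> Arr C X Y\<rbrakk> \<Longrightarrow>
      g \<cdot> (f \<oplus>\<^bsub>Hom C X Y\<^esub> f') = (g \<cdot> f) \<oplus>\<^bsub>Hom C X Z\<^esub> (g \<cdot> f')"
    and comp_smult_left: "\<lbrakk>g \<in> Arr C Y Z; f \<in> Arr C X Y\<rbrakk> \<Longrightarrow>
      (c \<odot>\<^bsub>Hom C Y Z\<^esub> g) \<cdot> f = c \<odot>\<^bsub>Hom C X Z\<^esub> (g \<cdot> f)"
    and comp_smult_right: "\<lbrakk>g \<in> Arr C Y Z; f \<in> Arr C X Y\<rbrakk> \<Longrightarrow>
      g \<cdot> (c \<odot>\<^bsub>Hom C X Y\<^esub> f) = c \<odot>\<^bsub>Hom C X Z\<^esub> (g \<cdot> f)"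


subsection \<open>Categorical notions\<close>

context
  fixes C :: "('o, 'm) tcat" (structure)
begin

definition monic :: "'o \<Rightarrow> 'o \<Rightarrow> 'm \<Rightarrow> bool"
  where "monic X Y f \<longleftrightarrow> f \<in> Arr C X Y \<and>
    (\<forall>W. \<forall>g\<in>Arr C W X. \<forall>h\<in>Arr C W X. f \<cdot> g = f \<cdot> h \<longrightarrow> g = h)"

definition epic :: "'o \<Rightarrow> 'o \<Rightarrow> 'm \<Rightarrow> bool"
  where "epic X Y f \<longleftrightarrow> f \<in> Arr C X Y \<and>
    (\<forall>W. \<forall>g\<in>Arr C Y W. \<forall>h\<in>Arr C Y W. g \<cdot> f = h \<cdot> f \<longrightarrow> g = h)"

definition isomorphism :: "'o \<Rightarrow> 'o \<Rightarrow> 'm \<Rightarrow> bool"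
  where "isomorphism X Y f \<longleftrightarrow> f \<in> Arr C X Y \<and>
    (\<exists>g\<in>Arr C Y X. g \<cdot> f = \<i>\<d> X \<and> f \<cdot> g = \<i>\<d> Y)"

definition zero_ob :: "'o \<Rightarrow> bool"
  where "zero_ob Z \<longleftrightarrow> (\<forall>Y. \<exists>!f. f \<in> Arr C Z Y) \<and> (\<forall>Y. \<exists>!f. f \<in> Arr C Y Z)"

definition biproduct :: "'o \<Rightarrow> 'o \<Rightarrow> 'o \<Rightarrow> bool"
  where "biproduct X Y S \<longleftrightarrow>
    (\<exists>i\<in>Arr C X S. \<exists>j\<in>Arr C Y S. \<exists>p\<in>Arr C S X. \<exists>q\<in>Arr C S Y.
      p \<cdot> i = \<i>\<d> X \<and> q \<cdot> j = \<i>\<d> Y \<and> (i \<cdot> p) \<oplus>\<^bsub>Hom C S S\<^esub> (j \<cdot> q) = \<i>\<d> S)"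

definition is_kernel :: "'o \<Rightarrow> 'o \<Rightarrow> 'm \<Rightarrow> 'o \<Rightarrow> 'm \<Rightarrow> bool"
  where "is_kernel X Y f K k \<longleftrightarrow> f \<in> Arr C X Y \<and> k \<in> Arr C K X \<and> f \<cdot> k = \<zero>\<^bsub>Hom C K Y\<^esub> \<and>
    (\<forall>W. \<forall>g\<in>Arr C W X. f \<cdot> g = \<zero>\<^bsub>Hom C W Y\<^esub> \<longrightarrow> (\<exists>!h. h \<in> Arr C W K \<and> k \<cdot> h = g))"

definition is_cokernel :: "'o \<Rightarrow> 'o \<Rightarrow> 'm \<Rightarrow> 'o \<Rightarrow> 'm \<Rightarrow> bool"
  where "is_cokernel X Y f Q q \<longleftrightarrow> f \<in> Arr C X Y \<and> q \<in> Arr C Y Q \<and> q \<cdot> f = \<zero>\<^bsub>Hom C X Q\<^esub> \<and>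
    (\<forall>W. \<forall>g\<in>Arr C Y W. g \<cdot> f = \<zero>\<^bsub>Hom C X W\<^esub> \<longrightarrow> (\<exists>!h. h \<in> Arr C Q W \<and> h \<cdot> q = g))"

definition simple_ob :: "'o \<Rightarrow> bool"
  where "simple_ob S \<longleftrightarrow> \<not> zero_ob S \<and>
    (\<forall>Y i. monic Y S i \<longrightarrow> zero_ob Y \<or> isomorphism Y S i)"

text \<open>A composition series, built from the bottom.\<close>

inductive finite_length :: "'o \<Rightarrow> bool"
  where
    zero: "zero_ob Z \<Longrightarrow> finite_length Z"
  | step: "\<lbrakk>finite_length Y; monic Y X i; is_cokernel Y X i S q; simple_ob S\<rbrakk> \<Longrightarrow> finite_length X"

definition is_pullback :: "'o \<Rightarrow> 'o \<Rightarrow> 'o \<Rightarrow> 'm \<Rightarrow> 'm \<Rightarrow> 'o \<Rightarrow> 'm \<Rightarrow> 'm \<Rightarrow> bool"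
  where "is_pullback X A B i j P p q \<longleftrightarrow>
    i \<in> Arr C A X \<and> j \<in> Arr C B X \<and> p \<in> Arr C P A \<and> q \<in> Arr C P B \<and> i \<cdot> p = j \<cdot> q \<and>
    (\<forall>W. \<forall>f\<in>Arr C W A. \<forall>g\<in>Arr C W B. i \<cdot> f = j \<cdot> g \<longrightarrow>
      (\<exists>!h. h \<in> Arr C W P \<and> p \<cdot> h = f \<and> q \<cdot> h = g))"

end

locale abelian_linear_category = linear_category +
  assumes ex_zero: "\<exists>Z. zero_ob C Z"
    and ex_biproduct: "\<exists>S. biproduct C X Y S"
    and ex_kernel: "f \<in> Arr C X Y \<Longrightarrow> \<exists>K k. is_kernel C X Y f K k"
    and ex_cokernel: "f \<in> Arr C X Y \<Longrightarrow> \<exists>Q q. is_cokernel C X Y f Q q"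
    and monic_is_kernel: "monic C X Y f \<Longrightarrow> \<exists>Z g. is_kernel C Y Z g X f"
    and epic_is_cokernel: "epic C X Y f \<Longrightarrow> \<exists>Z g. is_cokernel C Z X g Y f"

locale strict_monoidal_category = category +
  assumes tens_ob_assoc: "(X \<otimes>\<^sub>O Y) \<otimes>\<^sub>O Z = X \<otimes>\<^sub>O (Y \<otimes>\<^sub>O Z)"
    and tens_ob_unit_left: "\<I> \<otimes>\<^sub>O X = X"
    and tens_ob_unit_right: "X \<otimes>\<^sub>O \<I> = X"
    and tens_closed:
      "\<lbrakk>f \<in> Arr C X Y; g \<in> Arr C Z W\<rbrakk> \<Longrightarrow> f \<otimes>\<^sub>A g \<in> Arr C (X \<otimes>\<^sub>O Z) (Y \<otimes>\<^sub>O W)"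
    and tens_id: "\<i>\<d> X \<otimes>\<^sub>A \<i>\<d> Y = \<i>\<d> (X \<otimes>\<^sub>O Y)"
    and tens_comp:
      "\<lbrakk>f \<in> Arr C X Y; f' \<in> Arr C Y Z; g \<in> Arr C X' Y'; g' \<in> Arr C Y' Z'\<rbrakk> \<Longrightarrow>
        (f' \<cdot> f) \<otimes>\<^sub>A (g' \<cdot> g) = (f' \<otimes>\<^sub>A g') \<cdot> (f \<otimes>\<^sub>A g)"
    and tens_assoc: "\<lbrakk>f \<in> Arr C X Y; g \<in> Arr C X' Y'; h \<in> Arr C X'' Y''\<rbrakk> \<Longrightarrow>
        (f \<otimes>\<^sub>A g) \<otimes>\<^sub>A h = f \<otimes>\<^sub>A (g \<otimes>\<^sub>A h)"
    and tens_unit_left: "f \<in> Arr C X Y \<Longrightarrow> \<i>\<d> \<I> \<otimes>\<^sub>A f = f"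
    and tens_unit_right: "f \<in> Arr C X Y \<Longrightarrow> f \<otimes>\<^sub>A \<i>\<d> \<I> = f"


subsection \<open>Duals\<close>

record ('o, 'm) dual =
  dual_ob :: 'o
  ev :: 'm
  coev :: 'm

context
  fixes C :: "('o, 'm) tcat" (structure)
begin

definition left_dual :: "'o \<Rightarrow> ('o, 'm) dual \<Rightarrow> bool"
  where "left_dual X D \<longleftrightarrow>
    ev D \<in> Arr C (dual_ob D \<otimes>\<^sub>O X) \<I> \<and> coev D \<in> Arr C \<I> (X \<otimes>\<^sub>O dual_ob D) \<and>
    (\<i>\<d> X \<otimes>\<^sub>A ev D) \<cdot> (coev D \<otimes>\<^sub>A \<i>\<d> X) = \<i>\<d> X \<and>
    (ev D \<otimes>\<^sub>A \<i>\<d> (dual_ob D)) \<cdot> (\<i>\<d> (dual_ob D) \<otimes>\<^sub>A coev D) = \<i>\<d> (dual_ob D)"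

text \<open>
  For \<open>f : X \<rightarrow> Y\<close>, a left dual \<open>D\<close> of \<open>X\<close> and a left dual \<open>E\<close> of \<open>Y\<close>, this is
  \<open>f\<^sup>* : Y\<^sup>* \<rightarrow> X\<^sup>*\<close>. For \<open>X = Y\<close> and \<open>f = id\<close> it is the canonical isomorphism from the left
  dual \<open>E\<close> of \<open>X\<close> to the left dual \<open>D\<close>.
\<close>

definition dual_arr :: "('o, 'm) dual \<Rightarrow> ('o, 'm) dual \<Rightarrow> 'm \<Rightarrow> 'm"
  where "dual_arr D E f =
    (ev E \<otimes>\<^sub>A \<i>\<d> (dual_ob D)) \<cdot> (\<i>\<d> (dual_ob E) \<otimes>\<^sub>A f \<otimes>\<^sub>A \<i>\<d> (dual_ob D)) \<cdot>
    (\<i>\<d> (dual_ob E) \<otimes>\<^sub>A coev D)"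

definition unit_dual :: "('o, 'm) dual"
  where "unit_dual = \<lparr>dual_ob = \<I>, ev = \<i>\<d> \<I>, coev = \<i>\<d> \<I>\<rparr>"

text \<open>The left dual \<open>Y\<^sup>* \<otimes> X\<^sup>*\<close> of \<open>X \<otimes> Y\<close>.\<close>

definition tens_dual :: "'o \<Rightarrow> 'o \<Rightarrow> ('o, 'm) dual \<Rightarrow> ('o, 'm) dual \<Rightarrow> ('o, 'm) dual"
  where "tens_dual X Y D E =
    \<lparr>dual_ob = dual_ob E \<otimes>\<^sub>O dual_ob D,
     ev = ev E \<cdot> (\<i>\<d> (dual_ob E) \<otimes>\<^sub>A ev D \<otimes>\<^sub>A \<i>\<d> Y),
     coev = (\<i>\<d> X \<otimes>\<^sub>A coev E \<otimes>\<^sub>A \<i>\<d> (dual_ob D)) \<cdot> coev D\<rparr>"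

end

text \<open>
  In \<open>rigid_right\<close>, \<open>Y\<close> is a right dual of \<open>X\<close>: its evaluation \<open>X \<otimes> Y \<rightarrow> 1\<close> and coevaluation
  \<open>1 \<rightarrow> Y \<otimes> X\<close> are those exhibiting \<open>X\<close> as a left dual of \<open>Y\<close>.
\<close>

locale tensor_category = abelian_linear_category + strict_monoidal_category +
  assumes hom_fin_dim: "vectorspace.fin_dim class_ring (Hom C X Y)"
    and ob_finite_length: "finite_length C X"
    and tens_add_left: "\<lbrakk>f \<in> Arr C X Y; f' \<in> Arr C X Y; g \<in> Arr C Z W\<rbrakk> \<Longrightarrow>
      (f \<oplus>\<^bsub>Hom C X Y\<^esub> f') \<otimes>\<^sub>A g = (f \<otimes>\<^sub>A g) \<oplus>\<^bsub>Hom C (X \<otimes>\<^sub>O Z) (Y \<otimes>\<^sub>O W)\<^esub> (f' \<otimes>\<^sub>A g)"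
    and tens_add_right: "\<lbrakk>f \<in> Arr C X Y; g \<in> Arr C Z W; g' \<in> Arr C Z W\<rbrakk> \<Longrightarrow>
      f \<otimes>\<^sub>A (g \<oplus>\<^bsub>Hom C Z W\<^esub> g') = (f \<otimes>\<^sub>A g) \<oplus>\<^bsub>Hom C (X \<otimes>\<^sub>O Z) (Y \<otimes>\<^sub>O W)\<^esub> (f \<otimes>\<^sub>A g')"
    and tens_smult_left: "\<lbrakk>f \<in> Arr C X Y; g \<in> Arr C Z W\<rbrakk> \<Longrightarrow>
      (c \<odot>\<^bsub>Hom C X Y\<^esub> f) \<otimes>\<^sub>A g = c \<odot>\<^bsub>Hom C (X \<otimes>\<^sub>O Z) (Y \<otimes>\<^sub>O W)\<^esub> (f \<otimes>\<^sub>A g)"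
    and tens_smult_right: "\<lbrakk>f \<in> Arr C X Y; g \<in> Arr C Z W\<rbrakk> \<Longrightarrow>
      f \<otimes>\<^sub>A (c \<odot>\<^bsub>Hom C Z W\<^esub> g) = c \<odot>\<^bsub>Hom C (X \<otimes>\<^sub>O Z) (Y \<otimes>\<^sub>O W)\<^esub> (f \<otimes>\<^sub>A g)"
    and rigid_left: "\<exists>D. left_dual C X D"
    and rigid_right: "\<exists>Y D. left_dual C Y D \<and> dual_ob D = X"
    and end_unit: "bij_betw (\<lambda>c. c \<odot>\<^bsub>Hom C \<I> \<I>\<^esub> \<i>\<d> \<I>) UNIV (Arr C \<I> \<I>)"


subsection \<open>Pivotal structures and positivity\<close>

context
  fixes C :: "('o, 'm) tcat" (structure)
begin

text \<open>Below, \<open>D\<close> chooses a left dual of every object.\<close>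

definition bidual_ob :: "('o \<Rightarrow> ('o, 'm) dual) \<Rightarrow> 'o \<Rightarrow> 'o"
  where "bidual_ob D X = dual_ob (D (dual_ob (D X)))"

definition bidual_arr :: "('o \<Rightarrow> ('o, 'm) dual) \<Rightarrow> 'o \<Rightarrow> 'o \<Rightarrow> 'm \<Rightarrow> 'm"
  where "bidual_arr D X Y f =
    dual_arr C (D (dual_ob (D Y))) (D (dual_ob (D X))) (dual_arr C (D X) (D Y) f)"

text \<open>
  The monoidal structure \<open>X\<^sup>*\<^sup>* \<otimes> Y\<^sup>*\<^sup>* \<rightarrow> (X \<otimes> Y)\<^sup>*\<^sup>*\<close> of the double dual functor: the dual of
  the canonical isomorphism \<open>(X \<otimes> Y)\<^sup>* \<rightarrow> Y\<^sup>* \<otimes> X\<^sup>*\<close>, where \<open>Y\<^sup>* \<otimes> X\<^sup>*\<close> is given the left dual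
  \<open>X\<^sup>*\<^sup>* \<otimes> Y\<^sup>*\<^sup>*\<close>. Likewise for the unit isomorphism \<open>1 \<rightarrow> 1\<^sup>*\<^sup>*\<close>.
\<close>

definition bidual_tens :: "('o \<Rightarrow> ('o, 'm) dual) \<Rightarrow> 'o \<Rightarrow> 'o \<Rightarrow> 'm"
  where "bidual_tens D X Y =
    dual_arr C (D (dual_ob (D (X \<otimes>\<^sub>O Y))))
      (tens_dual C (dual_ob (D Y)) (dual_ob (D X)) (D (dual_ob (D Y))) (D (dual_ob (D X))))
      (dual_arr C (tens_dual C X Y (D X) (D Y)) (D (X \<otimes>\<^sub>O Y)) (\<i>\<d> (X \<otimes>\<^sub>O Y)))"

definition bidual_unit :: "('o \<Rightarrow> ('o, 'm) dual) \<Rightarrow> 'm"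
  where "bidual_unit D =
    dual_arr C (D (dual_ob (D \<I>))) (unit_dual C) (dual_arr C (unit_dual C) (D \<I>) (\<i>\<d> \<I>))"

definition pivotal_structure :: "('o \<Rightarrow> ('o, 'm) dual) \<Rightarrow> ('o \<Rightarrow> 'm) \<Rightarrow> bool"
  where "pivotal_structure D \<phi> \<longleftrightarrow>
    (\<forall>X. isomorphism C X (bidual_ob D X) (\<phi> X)) \<and>
    (\<forall>X Y. \<forall>f\<in>Arr C X Y. bidual_arr D X Y f \<cdot> \<phi> X = \<phi> Y \<cdot> f) \<and>
    (\<forall>X Y. \<phi> (X \<otimes>\<^sub>O Y) = bidual_tens D X Y \<cdot> (\<phi> X \<otimes>\<^sub>A \<phi> Y)) \<and>
    \<phi> \<I> = bidual_unit D"

definition pivotal_dim :: "('o \<Rightarrow> ('o, 'm) dual) \<Rightarrow> ('o \<Rightarrow> 'm) \<Rightarrow> 'o \<Rightarrow> 'm"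
  where "pivotal_dim D \<phi> Y =
    ev (D (dual_ob (D Y))) \<cdot> (\<phi> Y \<otimes>\<^sub>A \<i>\<d> (dual_ob (D Y))) \<cdot> coev (D Y)"

text \<open>
  Any two choices of left duals are related by canonical isomorphisms, along which pivotal
  structures and their traces transport; hence it does not matter that the choice \<open>D\<close> is
  existentially quantified.
\<close>

definition positive :: bool
  where "positive \<longleftrightarrow> (\<exists>D \<phi>. (\<forall>X. left_dual C X (D X)) \<and> pivotal_structure D \<phi> \<and>
    (\<forall>Y. \<not> zero_ob C Y \<longrightarrow>
      (\<exists>r::real. r > 0 \<and> pivotal_dim D \<phi> Y = complex_of_real r \<odot>\<^bsub>Hom C \<I> \<I>\<^esub> \<i>\<d> \<I>)))"

end


section \<open>Frobenius algebras and Frobenius subalgebras\<close>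

record ('o, 'm) frob =
  frob_ob :: 'o
  mul :: 'm
  comul :: 'm
  unt :: 'm
  counit :: 'm

context
  fixes C :: "('o, 'm) tcat" (structure)
begin

definition unital_algebra :: "'o \<Rightarrow> 'm \<Rightarrow> 'm \<Rightarrow> bool"
  where "unital_algebra X m e \<longleftrightarrow> m \<in> Arr C (X \<otimes>\<^sub>O X) X \<and> e \<in> Arr C \<I> X \<and>
    m \<cdot> (m \<otimes>\<^sub>A \<i>\<d> X) = m \<cdot> (\<i>\<d> X \<otimes>\<^sub>A m) \<and>
    m \<cdot> (e \<otimes>\<^sub>A \<i>\<d> X) = \<i>\<d> X \<and> m \<cdot> (\<i>\<d> X \<otimes>\<^sub>A e) = \<i>\<d> X"

definition counital_coalgebra :: "'o \<Rightarrow> 'm \<Rightarrow> 'm \<Rightarrow> bool"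
  where "counital_coalgebra X d n \<longleftrightarrow> d \<in> Arr C X (X \<otimes>\<^sub>O X) \<and> n \<in> Arr C X \<I> \<and>
    (d \<otimes>\<^sub>A \<i>\<d> X) \<cdot> d = (\<i>\<d> X \<otimes>\<^sub>A d) \<cdot> d \<and>
    (n \<otimes>\<^sub>A \<i>\<d> X) \<cdot> d = \<i>\<d> X \<and> (\<i>\<d> X \<otimes>\<^sub>A n) \<cdot> d = \<i>\<d> X"

definition frobenius_algebra :: "('o, 'm) frob \<Rightarrow> bool"
  where "frobenius_algebra X \<longleftrightarrow>
    unital_algebra (frob_ob X) (mul X) (unt X) \<and>
    counital_coalgebra (frob_ob X) (comul X) (counit X) \<and>
    (\<i>\<d> (frob_ob X) \<otimes>\<^sub>A mul X) \<cdot> (comul X \<otimes>\<^sub>A \<i>\<d> (frob_ob X)) = comul X \<cdot> mul X \<and>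
    comul X \<cdot> mul X = (mul X \<otimes>\<^sub>A \<i>\<d> (frob_ob X)) \<cdot> (\<i>\<d> (frob_ob X) \<otimes>\<^sub>A comul X)"

definition frob_dual :: "('o, 'm) frob \<Rightarrow> ('o, 'm) dual"
  where "frob_dual X =
    \<lparr>dual_ob = frob_ob X, ev = counit X \<cdot> mul X, coev = comul X \<cdot> unt X\<rparr>"

definition frob_connected :: "('o, 'm) frob \<Rightarrow> bool"
  where "frob_connected X \<longleftrightarrow> vectorspace.dim class_ring (Hom C \<I> (frob_ob X)) = 1"

definition algebra_mono :: "('o, 'm) frob \<Rightarrow> ('o, 'm) frob \<Rightarrow> 'm \<Rightarrow> bool"
  where "algebra_mono A X i \<longleftrightarrow> monic C (frob_ob A) (frob_ob X) i \<and>
    i \<cdot> mul A = mul X \<cdot> (i \<otimes>\<^sub>A i) \<and> i \<cdot> unt A = unt X"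

text \<open>\<open>f\<^sup>* : Y \<rightarrow> X\<close> for \<open>f : X \<rightarrow> Y\<close> between Frobenius algebras, regarded as selfdual.\<close>

definition frob_star :: "('o, 'm) frob \<Rightarrow> ('o, 'm) frob \<Rightarrow> 'm \<Rightarrow> 'm"
  where "frob_star X Y f = dual_arr C (frob_dual X) (frob_dual Y) f"

definition frob_sub :: "('o, 'm) frob \<Rightarrow> ('o, 'm) frob \<times> 'm \<Rightarrow> bool"
  where "frob_sub X = (\<lambda>(A, i). frobenius_algebra A \<and> algebra_mono A X i \<and>
    frob_star X A (frob_star A X i) = i \<and> frob_star A X i \<cdot> i = \<i>\<d> (frob_ob A))"

definition frob_idem :: "('o, 'm) frob \<Rightarrow> ('o, 'm) frob \<times> 'm \<Rightarrow> 'm"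
  where "frob_idem X = (\<lambda>(A, i). i \<cdot> frob_star A X i)"

definition frob_sub_equiv :: "('o, 'm) frob \<Rightarrow> (('o, 'm) frob \<times> 'm) rel"
  where "frob_sub_equiv X =
    {(S, T). frob_sub X S \<and> frob_sub X T \<and> frob_idem X S = frob_idem X T}"

definition frob_sub_poset :: "('o, 'm) frob \<Rightarrow> (('o, 'm) frob \<times> 'm) set gorder"
  where "frob_sub_poset X =
    \<lparr>carrier = {S. frob_sub X S} // frob_sub_equiv X, eq = (=),
     le = (\<lambda>a b. \<exists>S\<in>a. \<exists>T\<in>b. frob_idem X S \<cdot> frob_idem X T = frob_idem X S \<and>
       frob_idem X T \<cdot> frob_idem X S = frob_idem X S)\<rparr>"


subsection \<open>Ambient selfduality\<close>

definition splitting :: "'o \<Rightarrow> 'm \<Rightarrow> 'o \<Rightarrow> 'm \<Rightarrow> 'm \<Rightarrow> bool"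
  where "splitting X b B i p \<longleftrightarrow>
    i \<in> Arr C B X \<and> p \<in> Arr C X B \<and> i \<cdot> p = b \<and> p \<cdot> i = \<i>\<d> B"

text \<open>
  Let \<open>D\<close> exhibit \<open>X\<close> as selfdual and let \<open>(B, i, p)\<close> be a split subobject of \<open>X\<close>. Any splitting
  \<open>(B', i', p')\<close> of \<open>(i \<cdot> p)\<^sup>*\<close> makes \<open>B'\<close> an ambient dual of \<open>B\<close>, with the evaluation and
  coevaluation given by \<open>ambient_dual\<close>.
\<close>

definition ambient_splitting ::
    "('o, 'm) dual \<Rightarrow> 'o \<Rightarrow> 'o \<times> 'm \<times> 'm \<Rightarrow> 'o \<times> 'm \<times> 'm \<Rightarrow> bool"
  where "ambient_splitting D X = (\<lambda>(B, i, p) (B', i', p').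
    splitting X (i \<cdot> p) B i p \<and> splitting X (dual_arr C D D (i \<cdot> p)) B' i' p')"

definition ambient_dual :: "('o, 'm) dual \<Rightarrow> 'o \<times> 'm \<times> 'm \<Rightarrow> 'o \<times> 'm \<times> 'm \<Rightarrow> ('o, 'm) dual"
  where "ambient_dual D = (\<lambda>(B, i, p) (B', i', p').
    \<lparr>dual_ob = B', ev = ev D \<cdot> (i' \<otimes>\<^sub>A i), coev = (p \<otimes>\<^sub>A p') \<cdot> coev D\<rparr>)"

text \<open>
  The subobject \<open>i : B \<rightarrow> X\<close> is ambiently selfdual if, for some retraction \<open>p\<close> of \<open>i\<close>, one may take
  \<open>(B', i', p') = (B, i, p)\<close>. Such a \<open>p\<close> is unique, and it is \<open>i\<^sup>*\<close> for the selfduality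
  \<open>ambient_dual D (B, i, p) (B, i, p)\<close> of \<open>B\<close>.
\<close>

definition ambiently_selfdual :: "('o, 'm) dual \<Rightarrow> 'o \<Rightarrow> 'o \<Rightarrow> 'm \<Rightarrow> bool"
  where "ambiently_selfdual D X B i \<longleftrightarrow> (\<exists>p. ambient_splitting D X (B, i, p) (B, i, p))"


subsection \<open>Coherent sublattices\<close>

definition subob_le :: "'o \<Rightarrow> 'm \<Rightarrow> 'o \<Rightarrow> 'm \<Rightarrow> bool"
  where "subob_le A i B j \<longleftrightarrow> (\<exists>f\<in>Arr C A B. j \<cdot> f = i)"

definition subob_inter :: "'o \<Rightarrow> 'o \<Rightarrow> 'm \<Rightarrow> 'o \<Rightarrow> 'm \<Rightarrow> 'o \<Rightarrow> 'm \<Rightarrow> bool"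
  where "subob_inter X A i B j P k \<longleftrightarrow> (\<exists>p q. is_pullback C X A B i j P p q \<and> k = i \<cdot> p)"

definition subob_join :: "'o \<Rightarrow> 'o \<Rightarrow> 'm \<Rightarrow> 'o \<Rightarrow> 'm \<Rightarrow> 'o \<Rightarrow> 'm \<Rightarrow> bool"
  where "subob_join X A i B j S s \<longleftrightarrow>
    monic C S X s \<and> subob_le A i S s \<and> subob_le B j S s \<and>
    (\<forall>T t. monic C T X t \<and> subob_le A i T t \<and> subob_le B j T t \<longrightarrow> subob_le S s T t)"

definition coherent_pair :: "('o, 'm) dual \<Rightarrow> 'o \<Rightarrow> 'o \<Rightarrow> 'm \<Rightarrow> 'o \<Rightarrow> 'm \<Rightarrow> bool"
  where "coherent_pair D X A i B j \<longleftrightarrow>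
    monic C A X i \<and> monic C B X j \<and>
    ambiently_selfdual D X A i \<and> ambiently_selfdual D X B j \<and>
    (\<exists>P k. subob_inter X A i B j P k \<and> ambiently_selfdual D X P k) \<and>
    (\<exists>S s. subob_join X A i B j S s \<and> ambiently_selfdual D X S s)"

text \<open>
  The Frobenius subalgebra poset need not be a lattice, so a sublattice is a subset that is a
  lattice in the induced order.

  The equation \<open>[A] \<and> [B] = [A \<inter> B]\<close> says that the subobject \<open>A \<inter> B\<close> underlies a Frobenius
  subalgebra \<open>(P, k)\<close> whose class is the meet of \<open>[A]\<close> and \<open>[B]\<close>.
\<close>

definition coherent_sublattice ::
    "('o, 'm) frob \<Rightarrow> (('o, 'm) frob \<times> 'm) set set \<Rightarrow> bool"
  where "coherent_sublattice X L \<longleftrightarrow>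
    (let Q = (frob_sub_poset X)\<lparr>carrier := L\<rparr> in
      L \<subseteq> carrier (frob_sub_poset X) \<and> lattice Q \<and> (\<exists>z. least Q z L) \<and>
      (\<forall>a\<in>L. \<forall>b\<in>L. \<forall>(A, i)\<in>a. \<forall>(B, j)\<in>b.
        coherent_pair (frob_dual X) (frob_ob X) (frob_ob A) i (frob_ob B) j \<and>
        (\<exists>P k. frob_sub X (P, k) \<and>
          subob_inter (frob_ob X) (frob_ob A) i (frob_ob B) j (frob_ob P) k \<and>
          a \<sqinter>\<^bsub>Q\<^esub> b = frob_sub_equiv X `` {(P, k)})))"

end

end

theory Submission
  imports Defs
begin

text \<open>
  Positivity makes \<open>End X\<close> a finite-dimensional algebra with a trace \<open>\<tau>\<close> that vanishes on nilpotent
  elements and does not vanish on nonzero idempotents: cyclicity turns the trace of a nilpotent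
  endomorphism into that of an endomorphism of its image which is nilpotent of smaller order
  (\<open>trace_nilpotent\<close>), and a nonzero idempotent splits, so that its trace is the dimension of a
  nonzero object (\<open>trace_idempotent\<close>). An argument of Krull-Schmidt type shows that such a trace takes
  only finitely many values on idempotents (\<open>finite_idempotent_traces\<close>).

  The idempotent \<open>b\<^sub>A\<close> of a Frobenius subalgebra \<open>A\<close> of \<open>X\<close> is a conditional expectation: it is unital,
  selfadjoint and \<open>A\<close>-bilinear (\<open>frob_sub_expectation\<close>). For two subalgebras \<open>A\<close> and \<open>B\<close> the convolution
  \<open>q = m (b\<^sub>A \<otimes> b\<^sub>B) \<delta>\<close> has its values in the span \<open>AB\<close> of products, and bilinearity makes it act on \<open>AB\<close> by
  \<open>m (b\<^sub>A \<otimes> b\<^sub>B) \<delta> e\<close>, which is a scalar \<open>\<kappa>\<close> times \<open>e\<close> because \<open>X\<close> is connected. Thus \<open>q q = \<kappa> q\<close>. On the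
  other hand the pivotal structure is monoidal, so the pairing that it induces on \<open>X\<close> is compatible with
  the multiplication (\<open>pivotal_pairing_mult\<close>), and from this one computes
  \<open>(\<epsilon> e) \<tau> q = \<tau> b\<^sub>A \<tau> b\<^sub>B\<close> (\<open>convolution_trace\<close>). This is not zero, so \<open>q\<close> is not nilpotent and \<open>\<kappa>\<close> is not
  zero. Hence \<open>g = q / \<kappa>\<close> is an idempotent with range \<open>AB\<close>, and the bilinear form
  \<open>\<beta> a b = \<epsilon> m (a \<otimes> b) \<delta> e\<close> on \<open>End X\<close> satisfies
  \<open>\<beta> b\<^sub>A b\<^sub>B = \<tau> b\<^sub>A \<tau> b\<^sub>B / \<tau> g\<close>. For a group algebra and its subgroups \<open>H\<close> and \<open>K\<close> this is the formula
  \<open>card (H \<inter> K) = card H card K / card (H K)\<close>.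

  Two consequences finish the proof (\<open>finite_idempotents_of_product_form\<close>). The form takes finitely many
  values on the idempotents of Frobenius subalgebras. And \<open>\<beta> b\<^sub>A b\<^sub>B = \<tau> b\<^sub>B = \<beta> b\<^sub>B b\<^sub>B\<close> forces \<open>AB\<close> to be as
  large as \<open>A\<close>, hence \<open>B\<close> to lie in \<open>A\<close>; so \<open>b\<^sub>A\<close> and \<open>b\<^sub>B\<close> coincide as soon as \<open>\<beta> b\<^sub>A\<close> and \<open>\<beta> b\<^sub>B\<close> agree on
  these idempotents. In a finite-dimensional space only finitely many vectors are separated by a bilinear
  form with finitely many values. So the Frobenius subalgebra poset is finite, and with it all of
  its sublattices.
\<close>

section \<open>Finite-dimensional complex algebras\<close>

locale finite_dim_algebra = ring R + vs: vectorspace class_ring R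
  for R :: "(complex, 'm) module" (structure) +
  assumes smult_mult_left: "\<lbrakk>x \<in> carrier R; y \<in> carrier R\<rbrakk> \<Longrightarrow> (c \<odot> x) \<otimes> y = c \<odot> (x \<otimes> y)"
    and smult_mult_right: "\<lbrakk>x \<in> carrier R; y \<in> carrier R\<rbrakk> \<Longrightarrow> x \<otimes> (c \<odot> y) = c \<odot> (x \<otimes> y)"
    and fin_dim: "vs.fin_dim"
begin

lemma smult_carrier [simp, intro]: "x \<in> carrier R \<Longrightarrow> c \<odot> x \<in> carrier R"
  using vs.smult_closed[of c x] by simp

lemma smult_assoc: "x \<in> carrier R \<Longrightarrow> (c * d) \<odot> x = c \<odot> (d \<odot> x)"
  using vs.smult_assoc1[of c d x] by simp

lemma smult_unit: "x \<in> carrier R \<Longrightarrow> 1 \<odot> x = x"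
  using vs.smult_one[of x] by simp

lemma smult_zero [simp]: "c \<odot> \<zero> = \<zero>"
  using vs.smult_r_null[of c] by simp

lemma zero_smult [simp]: "x \<in> carrier R \<Longrightarrow> 0 \<odot> x = \<zero>"
  using vs.smult_l_null[of x] by simp

lemma smult_eq_zero:
  assumes "x \<in> carrier R" "c \<odot> x = \<zero>" "c \<noteq> 0" shows "x = \<zero>"
  using assms smult_assoc[of x "inverse c" c] smult_unit[of x] by simp

lemma lincomb_eq: "vs.lincomb a A = (\<Oplus>v\<in>A. a v \<odot> v)"
  by (simp add: vs.lincomb_def)

lemma lin_dep_finite:
  assumes "A \<subseteq> carrier R" "finite A" "vs.dim < card A"
  obtains a v where "(\<Oplus>v\<in>A. a v \<odot> v) = \<zero>" "v \<in> A" "a v \<noteq> (0::complex)"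
proof -
  have "vs.lin_dep A"
    using vs.li_le_dim(2)[OF fin_dim assms(1)] assms(3) by fastforce
  from vs.finite_lin_dep[OF assms(2) this assms(1)] obtain a v where
    "vs.lincomb a A = \<zero>" "v \<in> A" "a v \<noteq> 0" by auto
  then show thesis using that lincomb_eq by metis
qed

section \<open>Corners at primitive idempotents\<close>

lemma power_relation:
  assumes x: "x \<in> carrier R"
  obtains c :: "nat \<Rightarrow> complex" and N k
  where "(\<Oplus>k\<in>{..N}. c k \<odot> x [^] k) = \<zero>" "k \<le> N" "c k \<noteq> 0"
proof (cases "inj_on (\<lambda>k. x [^] k) {..vs.dim}")
  case True
  let ?A = "(\<lambda>k. x [^] k) ` {..vs.dim}"
  have "vs.dim < card ?A" using True by (simp add: card_image)
  moreover have "?A \<subseteq> carrier R" "finite ?A" using x by auto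
  ultimately obtain a v where a: "(\<Oplus>v\<in>?A. a v \<odot> v) = \<zero>" "v \<in> ?A" "a v \<noteq> (0::complex)"
    using lin_dep_finite[of ?A] by blast
  have "(\<Oplus>v\<in>?A. a v \<odot> v) = (\<Oplus>k\<in>{..vs.dim}. a (x [^] k) \<odot> x [^] k)"
    using True x by (intro finsum_reindex) auto
  then show ?thesis using a that[of "\<lambda>k. a (x [^] k)" "vs.dim"] by auto
next
  case False
  then obtain i j :: nat where ij: "i \<noteq> j" "x [^] i = x [^] j" unfolding inj_on_def by blast
  define c :: "nat \<Rightarrow> complex" where "c k = (if k = i then 1 else if k = j then - 1 else 0)" for k
  let ?N = "max i j"
  have "(\<Oplus>k\<in>{..?N}. c k \<odot> x [^] k) = (\<Oplus>k\<in>{i, j}. c k \<odot> x [^] k)"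
    using x by (intro add.finprod_mono_neutral_cong_right) (auto simp: c_def)
  also have "\<dots> = 1 \<odot> x [^] i \<oplus> (- 1) \<odot> x [^] i"
    using x ij by (simp add: c_def)
  also have "\<dots> = \<zero>"
    using vs.smult_l_distr[of 1 "-1" "x [^] i"] x by (simp add: x)
  finally show ?thesis using that[of c ?N i] by (simp add: c_def)
qed

lemma finsum_powers_factor:
  assumes x: "x \<in> carrier R"
  obtains s where "s \<in> carrier R" "s \<otimes> x = x \<otimes> s"
    "(\<Oplus>k\<in>{..N}. c k \<odot> x [^] (m + k)) = x [^] (m::nat) \<otimes> s"
proof -
  have "\<exists>s. s \<in> carrier R \<and> s \<otimes> x = x \<otimes> s \<and> (\<Oplus>k\<in>{..N}. c k \<odot> x [^] (m + k)) = x [^] m \<otimes> s"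
  proof (induction N)
    case 0
    show ?case
      using x by (intro exI[of _ "c 0 \<odot> \<one>"]) (simp add: smult_mult_left smult_mult_right)
  next
    case (Suc N)
    then obtain s where s: "s \<in> carrier R" "s \<otimes> x = x \<otimes> s"
      "(\<Oplus>k\<in>{..N}. c k \<odot> x [^] (m + k)) = x [^] m \<otimes> s" by blast
    let ?t = "c (Suc N) \<odot> x [^] Suc N \<oplus> s"
    have pow: "x [^] (m + Suc N) = x [^] m \<otimes> x [^] Suc N"
      using x by (simp only: nat_pow_mult)
    have "(\<Oplus>k\<in>{..Suc N}. c k \<odot> x [^] (m + k)) = c (Suc N) \<odot> x [^] (m + Suc N) \<oplus> x [^] m \<otimes> s"
      using x s by (subst finsum_Suc) (simp_all del: nat_pow_Suc)
    also have "\<dots> = x [^] m \<otimes> ?t"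
      unfolding pow using x s by (simp add: r_distr smult_mult_right del: nat_pow_Suc)
    finally show ?case
      using x s(1,2) nat_pow_Suc2[OF x, of "Suc N"]
      by (intro exI[of _ ?t]) (simp add: l_distr r_distr smult_mult_left smult_mult_right)
  qed
  then show thesis using that by blast
qed

text \<open>
  A linear relation between the powers of \<open>x\<close>, divided by its lowest nonzero coefficient, expresses a
  power of \<open>x\<close> through the next one.
\<close>

lemma power_stabilises:
  assumes x: "x \<in> carrier R"
  obtains n :: nat and y where "y \<in> carrier R" "y \<otimes> x = x \<otimes> y" "x [^] n = x [^] Suc n \<otimes> y"
proof -
  have *: "\<exists>n y. y \<in> carrier R \<and> y \<otimes> x = x \<otimes> y \<and> x [^] n = x [^] Suc n \<otimes> y"
    if "(\<Oplus>k\<in>{..N}. c k \<odot> x [^] (m + k)) = \<zero>" "\<exists>k\<le>N. c k \<noteq> 0" for N m :: nat and c :: "nat \<Rightarrow> complex"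
    using that
  proof (induction N arbitrary: m c)
    case 0
    then have "x [^] m = \<zero>" using x smult_eq_zero[of "x [^] m" "c 0"] by auto
    then show ?case using x by (intro exI[of _ m] exI[of _ \<one>]) simp
  next
    case (Suc N)
    have split: "(\<Oplus>k\<in>{..Suc N}. c k \<odot> x [^] (m + k)) =
        (\<Oplus>k\<in>{..N}. c (Suc k) \<odot> x [^] (Suc m + k)) \<oplus> c 0 \<odot> x [^] m"
      using x by (subst finsum_Suc2) (simp_all del: nat_pow_Suc)
    show ?case
    proof (cases "c 0 = 0")
      case True
      have "(\<Oplus>k\<in>{..N}. c (Suc k) \<odot> x [^] (Suc m + k)) = \<zero>"
        using Suc.prems(1) split True x by (simp del: nat_pow_Suc)
      moreover have "\<exists>k\<le>N. c (Suc k) \<noteq> 0"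
        using Suc.prems(2) True by (metis Suc_le_mono not0_implies_Suc)
      ultimately show ?thesis by (rule Suc.IH)
    next
      case False
      obtain s where s: "s \<in> carrier R" "s \<otimes> x = x \<otimes> s"
        "(\<Oplus>k\<in>{..N}. c (Suc k) \<odot> x [^] (Suc m + k)) = x [^] Suc m \<otimes> s"
        using finsum_powers_factor[OF x, where c = "\<lambda>k. c (Suc k)"] by blast
      have "x [^] Suc m \<otimes> s \<oplus> c 0 \<odot> x [^] m = \<zero>"
        using Suc.prems(1) split s(3) by simp
      then have "c 0 \<odot> x [^] m = \<ominus> (x [^] Suc m \<otimes> s)"
        using x s(1) by (metis add.inv_closed minus_minus minus_unique nat_pow_closed m_closed smult_carrier minus_equality a_comm)
      then have "inverse (c 0) \<odot> (c 0 \<odot> x [^] m) = x [^] Suc m \<otimes> (inverse (c 0) \<odot> (\<ominus> s))"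
        using x s(1) by (simp add: smult_mult_right r_minus del: nat_pow_Suc)
      then have eq: "x [^] m = x [^] Suc m \<otimes> (inverse (c 0) \<odot> (\<ominus> s))"
        using False x smult_assoc[of "x [^] m" "inverse (c 0)" "c 0"] smult_unit by simp
      moreover have "inverse (c 0) \<odot> (\<ominus> s) \<otimes> x = x \<otimes> (inverse (c 0) \<odot> (\<ominus> s))"
        using x s(1,2) by (simp add: smult_mult_left smult_mult_right l_minus r_minus)
      moreover have "inverse (c 0) \<odot> (\<ominus> s) \<in> carrier R" using s(1) by simp
      ultimately show ?thesis using eq
        by (intro exI[of _ m] exI[of _ "inverse (c 0) \<odot> (\<ominus> s)"] conjI)
    qed
  qed
  obtain c :: "nat \<Rightarrow> complex" and N k where "(\<Oplus>k\<in>{..N}. c k \<odot> x [^] k) = \<zero>" "k \<le> N" "c k \<noteq> 0"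
    using power_relation[OF x] by blast
  then have "(\<Oplus>k\<in>{..N}. c k \<odot> x [^] (0 + k)) = \<zero>" "\<exists>k\<le>N. c k \<noteq> 0" by auto
  from *[OF this] show thesis using that by blast
qed

definition primitive :: "'m \<Rightarrow> bool"
  where "primitive e \<longleftrightarrow> e \<in> carrier R \<and> e \<otimes> e = e \<and> e \<noteq> \<zero> \<and>
    (\<forall>g\<in>carrier R. g \<otimes> g = g \<and> e \<otimes> g = g \<and> g \<otimes> e = g \<longrightarrow> g = \<zero> \<or> g = e)"

text \<open>
  The corner \<open>e R e\<close> is local. If \<open>x\<close> commutes with \<open>y\<close> and \<open>x [^] n = x [^] (n + 1) \<otimes> y\<close>, then
  \<open>x [^] k \<otimes> y [^] k\<close> is an idempotent for \<open>k \<ge> n\<close>; it lies below \<open>e\<close> and is not zero, since \<open>x\<close> is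
  not nilpotent, so it is \<open>e\<close>.
\<close>

lemma corner_inverse:
  assumes e: "primitive e" and x: "x \<in> carrier R" "e \<otimes> x = x" "x \<otimes> e = x"
    and nonnil: "\<And>n::nat. x [^] n \<noteq> \<zero>"
  obtains z where "z \<in> carrier R" "e \<otimes> z = z" "z \<otimes> e = z" "x \<otimes> z = e"
proof -
  have ec: "e \<in> carrier R" "e \<otimes> e = e" using e by (auto simp: primitive_def)
  obtain n :: nat and y where y: "y \<in> carrier R" "y \<otimes> x = x \<otimes> y" "x [^] n = x [^] Suc n \<otimes> y"
    using power_stabilises[OF x(1)] by blast
  have comm: "y [^] k \<otimes> x [^] l = x [^] l \<otimes> y [^] k" for k l :: nat
  proof -
    have 1: "y \<otimes> x [^] l = x [^] l \<otimes> y" for l :: nat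
    proof (induction l)
      case (Suc l)
      have "y \<otimes> x [^] Suc l = (y \<otimes> x [^] l) \<otimes> x" using y(1) x(1) by (simp add: m_assoc)
      also have "\<dots> = x [^] l \<otimes> (y \<otimes> x)" using y(1) x(1) by (simp add: Suc m_assoc)
      also have "\<dots> = x [^] Suc l \<otimes> y" using y x(1) by (simp add: m_assoc)
      finally show ?case .
    qed (use y in simp)
    show ?thesis
    proof (induction k)
      case (Suc k)
      have "y [^] Suc k \<otimes> x [^] l = y [^] k \<otimes> (x [^] l \<otimes> y)"
        using y(1) x(1) by (simp add: m_assoc 1)
      also have "\<dots> = x [^] l \<otimes> y [^] Suc k"
        using y(1) x(1) by (simp add: Suc m_assoc[symmetric])
      finally show ?case .
    qed (use x in simp)
  qed
  \<comment> \<open>With an exponent of at least 1 the powers lie in the corner, even if \<open>n = 0\<close>.\<close>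
  let ?n = "Suc n"
  have step: "x [^] n = x [^] (n + k) \<otimes> y [^] k" for k :: nat
  proof (induction k)
    case (Suc k)
    have 1: "x [^] (n + k) = x [^] k \<otimes> x [^] n"
      using x(1) by (simp add: nat_pow_mult add.commute)
    have 2: "x [^] k \<otimes> x [^] n = x [^] k \<otimes> (x [^] Suc n \<otimes> y)" by (rule arg_cong[OF y(3)])
    have "x [^] n = x [^] (n + k) \<otimes> y [^] k" by (rule Suc)
    also have "\<dots> = x [^] k \<otimes> (x [^] Suc n \<otimes> y) \<otimes> y [^] k" by (simp only: 1 2)
    also have "\<dots> = (x [^] k \<otimes> x [^] Suc n) \<otimes> (y \<otimes> y [^] k)"
      using x(1) y(1) by (simp add: m_assoc)
    also have "\<dots> = x [^] (n + Suc k) \<otimes> y [^] Suc k"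
      by (simp only: nat_pow_mult[OF x(1)] nat_pow_Suc2[OF y(1), symmetric] add.commute[of k] add_Suc_right add_Suc)
    finally show ?case .
  qed (use x in simp)
  define g where "g = x [^] ?n \<otimes> y [^] ?n"
  have gc: "g \<in> carrier R" using x y by (simp add: g_def)
  have "x [^] ?n = x \<otimes> x [^] n" by (rule nat_pow_Suc2[OF x(1)])
  also have "\<dots> = x \<otimes> (x [^] (n + ?n) \<otimes> y [^] ?n)" by (rule arg_cong[OF step])
  also have "\<dots> = x [^] (?n + ?n) \<otimes> y [^] ?n"
    using x(1) y(1) nat_pow_Suc2[OF x(1), of "n + Suc n"] by (simp add: m_assoc[symmetric])
  finally have pow: "x [^] ?n = x [^] (?n + ?n) \<otimes> y [^] ?n" .
  have gx: "g \<otimes> x [^] ?n = x [^] ?n"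
  proof -
    have "g \<otimes> x [^] ?n = x [^] ?n \<otimes> (y [^] ?n \<otimes> x [^] ?n)"
      using x(1) y(1) by (simp add: g_def m_assoc del: nat_pow_Suc)
    also have "\<dots> = x [^] ?n \<otimes> x [^] ?n \<otimes> y [^] ?n"
      unfolding comm using x(1) y(1) by (simp add: m_assoc del: nat_pow_Suc)
    also have "\<dots> = x [^] ?n" by (simp only: nat_pow_mult[OF x(1)] pow[symmetric])
    finally show ?thesis .
  qed
  have gg: "g \<otimes> g = g"
    using gx x(1) y(1) gc by (metis g_def m_assoc nat_pow_closed)
  have g0: "g \<noteq> \<zero>" using gx nonnil[of ?n] x(1) by auto
  have ex: "e \<otimes> x [^] ?n = x [^] ?n"
    using x ec nat_pow_Suc2[OF x(1), of n] by (simp add: m_assoc[symmetric] del: nat_pow_Suc)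
  have xe: "x [^] ?n \<otimes> e = x [^] ?n"
    using x ec by (simp add: m_assoc)
  have eg: "e \<otimes> g = g"
    using ec(1) x(1) y(1) ex by (simp add: g_def m_assoc[symmetric] del: nat_pow_Suc)
  have ge: "g \<otimes> e = g"
    unfolding g_def comm[symmetric] using ec(1) x(1) y(1) xe by (simp add: m_assoc del: nat_pow_Suc)
  have "g = e" using e gc gg eg ge g0 by (auto simp: primitive_def)
  let ?z = "e \<otimes> (x [^] n \<otimes> y [^] ?n) \<otimes> e"
  have "x \<otimes> ?z = (x \<otimes> e) \<otimes> (x [^] n \<otimes> y [^] ?n) \<otimes> e"
    using x(1) y(1) ec(1) by (simp add: m_assoc)
  also have "\<dots> = g \<otimes> e"
    using x y(1) ec(1) nat_pow_Suc2[OF x(1), of n] by (simp add: g_def m_assoc[symmetric] del: nat_pow_Suc)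
  finally have "x \<otimes> ?z = e" using ge \<open>g = e\<close> by simp
  moreover have "?z \<in> carrier R" using x y ec by simp
  moreover have "e \<otimes> ?z = ?z"
    using x(1) y(1) ec by (simp add: m_assoc[symmetric] del: nat_pow_Suc)
  moreover have "?z \<otimes> e = ?z"
    using x(1) y(1) ec by (simp add: m_assoc del: nat_pow_Suc)
  ultimately show thesis using that by blast
qed

section \<open>Orthogonal systems of idempotents\<close>

definition orthogonal_idempotents :: "'m set \<Rightarrow> bool"
  where "orthogonal_idempotents P \<longleftrightarrow> finite P \<and> P \<subseteq> carrier R \<and>
    (\<forall>x\<in>P. x \<otimes> x = x \<and> x \<noteq> \<zero>) \<and> (\<forall>x\<in>P. \<forall>y\<in>P. x \<noteq> y \<longrightarrow> x \<otimes> y = \<zero>)"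

lemma finsum_orthogonal:
  assumes P: "orthogonal_idempotents P" and x: "x \<in> P"
  shows "x \<otimes> (\<Oplus>y\<in>P. c y \<odot> y) = c x \<odot> x" "(\<Oplus>y\<in>P. c y \<odot> y) \<otimes> x = c x \<odot> x"
proof -
  have fin: "finite P" and PR: "P \<subseteq> carrier R" and xx: "x \<otimes> x = x" and xR: "x \<in> carrier R"
    using P x by (auto simp: orthogonal_idempotents_def)
  have orth: "x \<otimes> y = \<zero>" "y \<otimes> x = \<zero>" if "y \<in> P" "y \<noteq> x" for y
    using P x that by (auto simp: orthogonal_idempotents_def)
  have "x \<otimes> (\<Oplus>y\<in>P. c y \<odot> y) = (\<Oplus>y\<in>P. x \<otimes> (c y \<odot> y))"
    using fin PR xR by (intro finsum_rdistr) auto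
  also have "\<dots> = (\<Oplus>y\<in>{x}. c y \<odot> y)"
    using fin PR xR xx orth x subsetD[OF PR]
    by (intro add.finprod_mono_neutral_cong_right) (auto simp: smult_mult_right)
  finally show "x \<otimes> (\<Oplus>y\<in>P. c y \<odot> y) = c x \<odot> x" using xR by simp
  have "(\<Oplus>y\<in>P. c y \<odot> y) \<otimes> x = (\<Oplus>y\<in>P. (c y \<odot> y) \<otimes> x)"
    using fin PR xR by (intro finsum_ldistr) auto
  also have "\<dots> = (\<Oplus>y\<in>{x}. c y \<odot> y)"
    using fin PR xR xx orth x subsetD[OF PR]
    by (intro add.finprod_mono_neutral_cong_right) (auto simp: smult_mult_left)
  finally show "(\<Oplus>y\<in>P. c y \<odot> y) \<otimes> x = c x \<odot> x" using xR by simp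
qed

lemma sum_orthogonal:
  assumes P: "orthogonal_idempotents P"
  shows "x \<in> P \<Longrightarrow> x \<otimes> (\<Oplus>y\<in>P. y) = x" "x \<in> P \<Longrightarrow> (\<Oplus>y\<in>P. y) \<otimes> x = x"
    "(\<Oplus>y\<in>P. y) \<otimes> (\<Oplus>y\<in>P. y) = (\<Oplus>y\<in>P. y)"
proof -
  have fin: "finite P" and PR: "P \<subseteq> carrier R"
    using P by (auto simp: orthogonal_idempotents_def)
  have one: "(\<Oplus>y\<in>P. 1 \<odot> y) = (\<Oplus>y\<in>P. y)"
    using PR by (intro finsum_cong') (auto simp: smult_unit)
  show *: "x \<otimes> (\<Oplus>y\<in>P. y) = x" "(\<Oplus>y\<in>P. y) \<otimes> x = x" if "x \<in> P" for x
    using finsum_orthogonal[OF P that, of "\<lambda>_. 1"] PR that by (auto simp: one smult_unit)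
  have "(\<Oplus>y\<in>P. y) \<otimes> (\<Oplus>y\<in>P. y) = (\<Oplus>x\<in>P. x \<otimes> (\<Oplus>y\<in>P. y))"
    using fin PR by (intro finsum_ldistr) (auto intro!: finsum_closed)
  also have "\<dots> = (\<Oplus>x\<in>P. x)"
    using PR * by (intro finsum_cong') auto
  finally show "(\<Oplus>y\<in>P. y) \<otimes> (\<Oplus>y\<in>P. y) = (\<Oplus>y\<in>P. y)" .
qed

text \<open>
  Orthogonal idempotents are linearly independent: multiply a relation by one of them.
\<close>

lemma card_orthogonal_idempotents:
  assumes P: "orthogonal_idempotents P"
  shows "card P \<le> vs.dim"
proof (rule ccontr)
  have fin: "finite P" and PR: "P \<subseteq> carrier R"
    using P by (auto simp: orthogonal_idempotents_def)
  assume "\<not> card P \<le> vs.dim"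
  then have c: "vs.dim < card P" by simp
  obtain a :: "'m \<Rightarrow> complex" and v where a: "(\<Oplus>v\<in>P. a v \<odot> v) = \<zero>" "v \<in> P" "a v \<noteq> 0"
    using lin_dep_finite[OF PR fin c] by blast
  then have "a v \<odot> v = \<zero>" using finsum_orthogonal(1)[OF P a(2), of a] PR by auto
  then show False
    using a(2,3) P PR smult_eq_zero by (auto simp: orthogonal_idempotents_def)
qed

text \<open>
  Maximality of the cardinality, rather than with respect to inclusion, also forbids replacing one
  idempotent by two.
\<close>

lemma maximal_orthogonal_idempotents:
  assumes "\<Phi> {}"
  obtains P where "orthogonal_idempotents P" "\<Phi> P"
    "\<And>Q. orthogonal_idempotents Q \<Longrightarrow> \<Phi> Q \<Longrightarrow> card Q \<le> card P"
proof -
  let ?\<Psi> = "\<lambda>P. orthogonal_idempotents P \<and> \<Phi> P"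
  have "?\<Psi> {}" using assms by (simp add: orthogonal_idempotents_def)
  then obtain P where "?\<Psi> P" "\<forall>Q. ?\<Psi> Q \<longrightarrow> card Q \<le> card P"
    using ex_has_greatest_nat[of ?\<Psi> "{}" card "Suc vs.dim"] card_orthogonal_idempotents
    by (meson le_imp_less_Suc less_imp_le)
  then show thesis using that by blast
qed

text \<open>
  A largest orthogonal system \<open>P\<close> admits no refinement: the complement of its sum would be a further
  member, and an idempotent \<open>g\<close> strictly below a member \<open>e\<close> would allow to replace \<open>e\<close> by \<open>g\<close> and \<open>e - g\<close>.
\<close>

lemma primitive_decomposition:
  obtains P where "finite P" "\<And>e. e \<in> P \<Longrightarrow> primitive e" "(\<Oplus>e\<in>P. e) = \<one>"
proof -
  obtain P where P: "orthogonal_idempotents P"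
    and max: "\<And>Q. orthogonal_idempotents Q \<Longrightarrow> card Q \<le> card P"
    using maximal_orthogonal_idempotents[of "\<lambda>_. True"] by auto
  have fin: "finite P" and PR: "P \<subseteq> carrier R"
    and idem: "\<And>x. x \<in> P \<Longrightarrow> x \<otimes> x = x" and nz: "\<And>x. x \<in> P \<Longrightarrow> x \<noteq> \<zero>"
    and orth: "\<And>x y. x \<in> P \<Longrightarrow> y \<in> P \<Longrightarrow> x \<noteq> y \<Longrightarrow> x \<otimes> y = \<zero>"
    using P by (auto simp: orthogonal_idempotents_def)
  let ?s = "\<Oplus>e\<in>P. e"
  have sR: "?s \<in> carrier R" using PR by (auto intro!: finsum_closed)
  note s = sum_orthogonal[OF P]
  let ?r = "\<one> \<ominus> ?s"
  have rR: "?r \<in> carrier R" using sR by simp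
  have "?r = \<zero>"
  proof (rule ccontr)
    assume r0: "?r \<noteq> \<zero>"
    have rr: "?r \<otimes> ?r = ?r"
      using sR s(3) by (simp add: a_minus_def l_distr r_distr l_minus r_minus a_assoc r_neg)
    have re: "?r \<otimes> e = \<zero>" "e \<otimes> ?r = \<zero>" if "e \<in> P" for e
      using that PR sR s(1,2)[OF that]
      by (auto simp: a_minus_def l_distr r_distr l_minus r_minus r_neg)
    have "?r \<notin> P" using re rr r0 by metis
    moreover have "orthogonal_idempotents (insert ?r P)"
      using P rR rr r0 re by (auto simp: orthogonal_idempotents_def)
    ultimately show False using max[of "insert ?r P"] fin by simp
  qed
  then have "?s = \<one>" using sR by simp
  moreover have "primitive e" if e: "e \<in> P" for e
  proof -
    have eR: "e \<in> carrier R" using e PR by auto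
    have "g = \<zero> \<or> g = e" if g: "g \<in> carrier R" "g \<otimes> g = g" "e \<otimes> g = g" "g \<otimes> e = g" for g
    proof (rule ccontr)
      assume ne: "\<not> (g = \<zero> \<or> g = e)"
      let ?h = "e \<ominus> g"
      have hR: "?h \<in> carrier R" using eR g by simp
      have h0: "?h \<noteq> \<zero>" using ne eR g by auto
      have hh: "?h \<otimes> ?h = ?h" "?h \<otimes> g = \<zero>" "g \<otimes> ?h = \<zero>" "e \<otimes> ?h = ?h" "?h \<otimes> e = ?h"
        using eR g idem[OF e]
        by (simp_all add: a_minus_def l_distr r_distr l_minus r_minus a_assoc r_neg)
      have lo: "g \<otimes> x = \<zero>" "x \<otimes> g = \<zero>" "?h \<otimes> x = \<zero>" "x \<otimes> ?h = \<zero>" if x: "x \<in> P - {e}" for x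
      proof -
        have xR: "x \<in> carrier R" "e \<otimes> x = \<zero>" "x \<otimes> e = \<zero>" using x PR orth e by auto
        show "g \<otimes> x = \<zero>" using m_assoc[of g e x] g xR eR by simp
        show "x \<otimes> g = \<zero>" using m_assoc[of x e g] g xR eR by simp
        show "?h \<otimes> x = \<zero>" using m_assoc[of ?h e x] hh hR xR eR by simp
        show "x \<otimes> ?h = \<zero>" using m_assoc[of x e ?h] hh hR xR eR by simp
      qed
      let ?Q = "insert g (insert ?h (P - {e}))"
      have gh: "g \<noteq> ?h" using hh(2) g(2) ne by auto
      have nin: "g \<notin> P - {e}" "?h \<notin> P - {e}"
        using lo(1,3) g(2) hh(1) ne h0 by metis+
      have "orthogonal_idempotents ?Q"
        using P g hR h0 hh lo ne by (auto simp: orthogonal_idempotents_def)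
      moreover have "card ?Q = Suc (card P)"
        using gh nin fin e card_Suc_Diff1[OF fin e] by simp
      ultimately show False using max[of ?Q] by simp
    qed
    then show ?thesis using eR idem[OF e] nz[OF e] by (auto simp: primitive_def)
  qed
  ultimately show thesis using that fin by blast
qed

end

section \<open>Traces on finite-dimensional algebras\<close>

text \<open>
  The last two axioms exclude functionals that merely vanish on commutators: on a local algebra such a
  functional need not vanish on the radical.
\<close>

locale traced_algebra = finite_dim_algebra R for R :: "(complex, 'm) module" (structure) +
  fixes \<tau> :: "'m \<Rightarrow> complex"
  assumes trace_add: "\<lbrakk>x \<in> carrier R; y \<in> carrier R\<rbrakk> \<Longrightarrow> \<tau> (x \<oplus> y) = \<tau> x + \<tau> y"
    and trace_comm: "\<lbrakk>x \<in> carrier R; y \<in> carrier R\<rbrakk> \<Longrightarrow> \<tau> (x \<otimes> y) = \<tau> (y \<otimes> x)"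
    and trace_nilpotent: "\<lbrakk>x \<in> carrier R; x [^] (n::nat) = \<zero>\<rbrakk> \<Longrightarrow> \<tau> x = 0"
    and trace_idempotent: "\<lbrakk>x \<in> carrier R; x \<otimes> x = x; x \<noteq> \<zero>\<rbrakk> \<Longrightarrow> \<tau> x \<noteq> 0"
begin

lemma trace_zero: "\<tau> \<zero> = 0"
  using trace_add[of \<zero> \<zero>] by simp

lemma trace_finsum:
  assumes "finite A" "f \<in> A \<rightarrow> carrier R"
  shows "\<tau> (\<Oplus>x\<in>A. f x) = (\<Sum>x\<in>A. \<tau> (f x))"
  using assms by (induction A rule: finite_induct) (simp_all add: trace_zero trace_add)

lemma trace_minus:
  assumes "x \<in> carrier R" "y \<in> carrier R"
  shows "\<tau> (x \<ominus> y) = \<tau> x - \<tau> y"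
proof -
  have "x = (x \<ominus> y) \<oplus> y" using assms by (simp add: a_minus_def a_assoc l_neg)
  then show ?thesis using trace_add[of "x \<ominus> y" y] assms by (metis add_diff_cancel_right' minus_closed)
qed

text \<open>
  The element \<open>e f e\<close> of the corner has the same trace as \<open>f e\<close>, so it is not nilpotent and has an inverse
  \<open>z\<close> in the corner. Then \<open>f z f\<close> is an idempotent below \<open>f\<close> that is equivalent to \<open>e\<close>.
\<close>

lemma equivalent_subidempotent:
  assumes e: "primitive e" and f: "f \<in> carrier R" "f \<otimes> f = f" and nz: "\<tau> (f \<otimes> e) \<noteq> 0"
  obtains h where "h \<in> carrier R" "h \<otimes> h = h" "f \<otimes> h = h" "h \<otimes> f = h" "\<tau> h = \<tau> e"
proof -
  have ec: "e \<in> carrier R" "e \<otimes> e = e" using e by (auto simp: primitive_def)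
  let ?x = "e \<otimes> f \<otimes> e"
  have x: "?x \<in> carrier R" "e \<otimes> ?x = ?x" "?x \<otimes> e = ?x"
    using ec f by (simp_all add: m_assoc) (simp_all add: m_assoc[symmetric])
  have "\<tau> ?x = \<tau> (f \<otimes> e)"
    using trace_comm[of "e" "f \<otimes> e"] ec f by (simp add: m_assoc)
  then have nn: "?x [^] n \<noteq> \<zero>" for n :: nat
    using trace_nilpotent[OF x(1), of n] nz by auto
  obtain z where z: "z \<in> carrier R" "e \<otimes> z = z" "z \<otimes> e = z" "?x \<otimes> z = e"
    using corner_inverse[OF e x nn] by blast
  have zfz: "z \<otimes> f \<otimes> z = z"
  proof -
    have "z \<otimes> f \<otimes> z = (z \<otimes> e) \<otimes> f \<otimes> (e \<otimes> z)" using z by simp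
    also have "\<dots> = z \<otimes> (?x \<otimes> z)" using z(1) ec f by (simp add: m_assoc)
    finally show ?thesis using z by simp
  qed
  let ?h = "f \<otimes> z \<otimes> f"
  have "?h \<otimes> ?h = f \<otimes> (z \<otimes> (f \<otimes> f) \<otimes> z) \<otimes> f"
    using z(1) f(1) by (simp add: m_assoc)
  then have hh: "?h \<otimes> ?h = ?h" using zfz f by simp
  have fh: "f \<otimes> ?h = ?h" "?h \<otimes> f = ?h"
    using z(1) f by (simp_all add: m_assoc) (simp_all add: m_assoc[symmetric])
  have "\<tau> ?h = \<tau> (z \<otimes> (f \<otimes> f))"
    using trace_comm[of f "z \<otimes> f"] z(1) f(1) by (simp add: m_assoc)
  also have "\<dots> = \<tau> (e \<otimes> (z \<otimes> (e \<otimes> f)))"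
    using z ec f by (simp add: m_assoc[symmetric])
  also have "\<dots> = \<tau> (z \<otimes> (e \<otimes> f) \<otimes> e)"
    using z ec f by (intro trace_comm) auto
  also have "\<dots> = \<tau> (z \<otimes> ?x)" using z ec f by (simp add: m_assoc)
  also have "\<dots> = \<tau> e" using trace_comm[of z ?x] z x by simp
  finally show thesis using that[of ?h] z f hh fh by simp
qed

text \<open>
  Decompose the unit into primitive idempotents. A nonzero idempotent \<open>r\<close> has nonzero trace, so
  \<open>\<tau> (r e) \<noteq> 0\<close> for some \<open>e\<close> of the decomposition, and a copy of \<open>e\<close> splits off from \<open>r\<close>. Hence every
  idempotent is a sum of orthogonal idempotents whose traces belong to the decomposition, and the
  dimension bounds the number of summands.
\<close>

theorem finite_idempotent_traces:
  "finite (\<tau> ` {f \<in> carrier R. f \<otimes> f = f})"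
proof -
  obtain P where P: "finite P" "\<And>e. e \<in> P \<Longrightarrow> primitive e" "(\<Oplus>e\<in>P. e) = \<one>"
    using primitive_decomposition by blast
  have PR: "P \<subseteq> carrier R" using P(2) by (auto simp: primitive_def)
  have "\<tau> f \<in> sum_list ` {xs. set xs \<subseteq> \<tau> ` P \<and> length xs \<le> vs.dim}"
    if f: "f \<in> carrier R" "f \<otimes> f = f" for f
  proof -
    let ?\<Phi> = "\<lambda>Q. \<forall>h\<in>Q. f \<otimes> h = h \<and> h \<otimes> f = h \<and> \<tau> h \<in> \<tau> ` P"
    obtain Q where Q: "orthogonal_idempotents Q" "?\<Phi> Q"
      and max: "\<And>Q'. orthogonal_idempotents Q' \<Longrightarrow> ?\<Phi> Q' \<Longrightarrow> card Q' \<le> card Q"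
      using maximal_orthogonal_idempotents[of ?\<Phi>] by auto
    have fin: "finite Q" and QR: "Q \<subseteq> carrier R"
      using Q(1) by (auto simp: orthogonal_idempotents_def)
    let ?s = "\<Oplus>h\<in>Q. h"
    note s = sum_orthogonal[OF Q(1)]
    have sR: "?s \<in> carrier R" using QR by (auto intro!: finsum_closed)
    have "f \<otimes> ?s = (\<Oplus>h\<in>Q. f \<otimes> h)" using fin QR f by (intro finsum_rdistr) auto
    also have "\<dots> = ?s" using QR Q(2) by (intro finsum_cong') auto
    finally have fs: "f \<otimes> ?s = ?s" .
    have "?s \<otimes> f = (\<Oplus>h\<in>Q. h \<otimes> f)" using fin QR f by (intro finsum_ldistr) auto
    also have "\<dots> = ?s" using QR Q(2) by (intro finsum_cong') auto
    finally have sf: "?s \<otimes> f = ?s" .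
    let ?r = "f \<ominus> ?s"
    have r: "?r \<in> carrier R" "?r \<otimes> ?r = ?r" "f \<otimes> ?r = ?r" "?r \<otimes> f = ?r"
      using f sR fs sf s(3)
      by (simp_all add: a_minus_def l_distr r_distr l_minus r_minus a_assoc r_neg)
    have rh: "?r \<otimes> h = \<zero>" "h \<otimes> ?r = \<zero>" if "h \<in> Q" for h
      using that QR Q(2) f sR s(1,2)[OF that]
      by (auto simp: a_minus_def l_distr r_distr l_minus r_minus r_neg)
    have "?r = \<zero>"
    proof (rule ccontr)
      assume "?r \<noteq> \<zero>"
      then have "\<tau> ?r \<noteq> 0" using r trace_idempotent by blast
      moreover have "?r = (\<Oplus>e\<in>P. ?r \<otimes> e)"
        using finsum_rdistr[OF P(1) r(1), of "\<lambda>e. e"] PR P(3) r(1) by auto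
      then have "\<tau> ?r = (\<Sum>e\<in>P. \<tau> (?r \<otimes> e))"
        using trace_finsum[OF P(1), of "\<lambda>e. ?r \<otimes> e"] PR r(1) by fastforce
      ultimately obtain e where e: "e \<in> P" "\<tau> (?r \<otimes> e) \<noteq> 0"
        by (metis sum.neutral)
      obtain h where h: "h \<in> carrier R" "h \<otimes> h = h" "?r \<otimes> h = h" "h \<otimes> ?r = h" "\<tau> h = \<tau> e"
        using equivalent_subidempotent[OF P(2)[OF e(1)] r(1,2) e(2)] by blast
      have h0: "h \<noteq> \<zero>"
      proof
        assume "h = \<zero>"
        then have "\<tau> e = 0" using h(5) trace_zero by simp
        then show False using P(2)[OF e(1)] trace_idempotent by (auto simp: primitive_def)
      qed
      have hk: "h \<otimes> k = \<zero>" "k \<otimes> h = \<zero>" if "k \<in> Q" for k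
        using rh[OF that] h that QR r(1) m_assoc[of h ?r k] m_assoc[of k ?r h] by auto
      have "h \<notin> Q" using hk h(2) h0 by metis
      moreover have "orthogonal_idempotents (insert h Q)"
        using Q(1) h(1,2) h0 hk by (auto simp: orthogonal_idempotents_def)
      moreover have "f \<otimes> h = h" "h \<otimes> f = h"
        using h r f m_assoc[of f ?r h] m_assoc[of h ?r f] by auto
      ultimately show False
        using max[of "insert h Q"] Q(2) fin h(5) e(1) by auto
    qed
    then have "f = ?s" using f sR by simp
    then have *: "\<tau> f = (\<Sum>h\<in>Q. \<tau> h)"
      using trace_finsum[OF fin, of "\<lambda>h. h"] QR by auto
    obtain hs where hs: "set hs = Q" "distinct hs" using finite_distinct_list[OF fin] by blast
    have "\<tau> f = sum_list (map \<tau> hs)"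
      using * hs by (simp add: sum_list_distinct_conv_sum_set)
    moreover have "length hs \<le> vs.dim"
      using card_orthogonal_idempotents[OF Q(1)] hs distinct_card by fastforce
    moreover have "set (map \<tau> hs) \<subseteq> \<tau> ` P" using Q(2) hs(1) by auto
    ultimately show ?thesis by (metis (mono_tags, lifting) image_eqI length_map mem_Collect_eq)
  qed
  then have "\<tau> ` {f \<in> carrier R. f \<otimes> f = f} \<subseteq>
      sum_list ` {xs. set xs \<subseteq> \<tau> ` P \<and> length xs \<le> vs.dim}"
    by auto
  moreover have "finite (sum_list ` {xs. set xs \<subseteq> \<tau> ` P \<and> length xs \<le> vs.dim})"
    using P(1) by (intro finite_imageI finite_lists_length_le) auto
  ultimately show ?thesis by (rule finite_subset)
qed

end

text \<open>
  A member \<open>a\<close> of \<open>S\<close> is determined by the functional \<open>\<beta> a\<close> on the span of \<open>S\<close>, hence by its finitely many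
  possible values on a finite subset of \<open>S\<close> with the same span.
\<close>

lemma (in finite_dim_algebra) finite_of_finite_form:
  fixes \<beta> :: "'m \<Rightarrow> 'm \<Rightarrow> complex"
  assumes S: "S \<subseteq> carrier R"
    and add: "\<And>a v w. \<lbrakk>a \<in> S; v \<in> carrier R; w \<in> carrier R\<rbrakk> \<Longrightarrow> \<beta> a (v \<oplus> w) = \<beta> a v + \<beta> a w"
    and smult: "\<And>a v c. \<lbrakk>a \<in> S; v \<in> carrier R\<rbrakk> \<Longrightarrow> \<beta> a (c \<odot> v) = c * \<beta> a v"
    and fin_values: "finite ((\<lambda>(a, b). \<beta> a b) ` (S \<times> S))"
    and separated: "\<And>a b. \<lbrakk>a \<in> S; b \<in> S; \<beta> a a = \<beta> b a; \<beta> a b = \<beta> b b\<rbrakk> \<Longrightarrow> a = b"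
  shows "finite S"
proof -
  let ?\<Psi> = "\<lambda>B. B \<subseteq> S \<and> finite B \<and> vs.lin_indpt B"
  have "vs.lin_indpt {}" by (auto simp: vs.lin_dep_def)
  then have "?\<Psi> {}" by simp
  moreover have "card B < Suc vs.dim" if "?\<Psi> B" for B
    using vs.li_le_dim(2)[OF fin_dim, of B] that subset_trans[OF _ S] by auto
  ultimately obtain B where B: "?\<Psi> B" and max: "\<And>B'. ?\<Psi> B' \<Longrightarrow> card B' \<le> card B"
    using ex_has_greatest_nat[of ?\<Psi> "{}" card "Suc vs.dim"] by (meson less_imp_le)
  have BR: "B \<subseteq> carrier R" and fin: "finite B" using B S by auto
  have span: "s \<in> vs.span B" if s: "s \<in> S" for s
  proof (cases "s \<in> B")
    case True
    then show ?thesis using vs.in_own_span[OF BR] by auto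
  next
    case False
    have "\<not> ?\<Psi> (insert s B)" using max[of "insert s B"] False fin by auto
    then have "vs.lin_dep (B \<union> {s})" using B s by auto
    then show ?thesis using vs.lin_dep_iff_in_span[OF BR _ _ False] B s S by auto
  qed
  have expand: "\<exists>c. \<forall>a\<in>S. \<beta> a s = (\<Sum>v\<in>B. c v * \<beta> a v)" if s: "s \<in> S" for s
  proof -
    obtain c where c: "(\<Oplus>v\<in>B. c v \<odot> v) = s"
      using vs.finite_in_span[OF fin BR span[OF s]] by (auto simp: lincomb_eq)
    have "\<beta> a (\<Oplus>v\<in>B. c v \<odot> v) = (\<Sum>v\<in>B. c v * \<beta> a v)" if a: "a \<in> S" for a
    proof -
      have zero: "\<beta> a \<zero> = 0" using add[OF a, of \<zero> \<zero>] by simp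
      show ?thesis using fin BR
        by (induction B rule: finite_induct) (simp_all add: zero add[OF a] smult[OF a] Pi_def subset_iff)
    qed
    then show ?thesis using c by auto
  qed
  let ?f = "\<lambda>a. restrict (\<beta> a) B"
  have "inj_on ?f S"
  proof (rule inj_onI)
    fix a b assume ab: "a \<in> S" "b \<in> S" "?f a = ?f b"
    then have eq: "\<beta> a v = \<beta> b v" if "v \<in> B" for v using that by (metis restrict_apply')
    have "\<beta> a s = \<beta> b s" if "s \<in> S" for s
      using expand[OF that] ab(1,2) eq by (metis (no_types, lifting) sum.cong)
    then show "a = b" using separated ab(1,2) by blast
  qed
  moreover have "?f ` S \<subseteq> B \<rightarrow>\<^sub>E (\<lambda>(a, b). \<beta> a b) ` (S \<times> S)"
  proof (rule image_subsetI)
    fix a assume a: "a \<in> S"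
    have "\<beta> a v \<in> (\<lambda>(a, b). \<beta> a b) ` (S \<times> S)" if "v \<in> B" for v
      using that B a by (intro image_eqI[of _ _ "(a, v)"]) auto
    then show "?f a \<in> B \<rightarrow>\<^sub>E (\<lambda>(a, b). \<beta> a b) ` (S \<times> S)" by auto
  qed
  then have "finite (?f ` S)"
    using finite_PiE[OF fin, of "\<lambda>_. (\<lambda>(a, b). \<beta> a b) ` (S \<times> S)"] fin_values finite_subset by blast
  ultimately show ?thesis by (rule finite_imageD[rotated])
qed

context traced_algebra
begin

text \<open>
  The difference \<open>g - a g\<close> is an idempotent of trace zero.
\<close>

lemma equal_trace_absorb:
  assumes a: "a \<in> carrier R" "a \<otimes> a = a" and g: "g \<in> carrier R" "g \<otimes> g = g"
    and ga: "g \<otimes> a = a" and eq: "\<tau> g = \<tau> a"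
  shows "a \<otimes> g = g"
proof -
  let ?h = "g \<ominus> a \<otimes> g"
  have gag: "g \<otimes> (a \<otimes> g) = a \<otimes> g" using a g ga m_assoc[of g a g] by simp
  have agg: "(a \<otimes> g) \<otimes> g = a \<otimes> g" using a g by (simp add: m_assoc)
  have agag: "(a \<otimes> g) \<otimes> (a \<otimes> g) = a \<otimes> g" using a g gag by (simp add: m_assoc m_assoc[of a a g, symmetric])
  have "?h \<otimes> ?h = ?h"
    using a(1) g gag agg agag by (simp add: a_minus_def l_distr r_distr l_minus r_minus a_assoc r_neg)
  moreover have "\<tau> ?h = 0"
    using trace_minus[of g "a \<otimes> g"] trace_comm[of a g] a g ga eq by simp
  ultimately have "?h = \<zero>" using trace_idempotent[of ?h] a g by auto
  then show ?thesis using a g by simp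
qed

text \<open>
  The members of \<open>S\<close> model the projections onto subalgebras \<open>A\<close> and \<open>B\<close>, and \<open>g\<close> the projection onto their
  product \<open>A B\<close>, which is \<open>A\<close> if \<open>A = B\<close>. Therefore \<open>\<beta> a a = \<tau> a\<close>. If \<open>\<beta> a b = \<tau> b\<close>, then \<open>\<tau> g = \<tau> a\<close>, so
  \<open>A B\<close> is no larger than \<open>A\<close> and contains \<open>B\<close>. If the form does not separate \<open>a\<close> from \<open>b\<close>, they thus have
  the same range, and \<open>adj\<close>, which holds for selfadjoint idempotents, makes them equal.
\<close>

theorem finite_idempotents_of_product_form:
  fixes \<beta> :: "'m \<Rightarrow> 'm \<Rightarrow> complex"
  assumes S: "\<And>a. a \<in> S \<Longrightarrow> a \<in> carrier R \<and> a \<otimes> a = a \<and> a \<noteq> \<zero>"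
    and add: "\<And>a v w. \<lbrakk>a \<in> S; v \<in> carrier R; w \<in> carrier R\<rbrakk> \<Longrightarrow> \<beta> a (v \<oplus> w) = \<beta> a v + \<beta> a w"
    and smult: "\<And>a v c. \<lbrakk>a \<in> S; v \<in> carrier R\<rbrakk> \<Longrightarrow> \<beta> a (c \<odot> v) = c * \<beta> a v"
    and prod: "\<And>a b. \<lbrakk>a \<in> S; b \<in> S\<rbrakk> \<Longrightarrow> \<exists>g\<in>carrier R. g \<otimes> g = g \<and> g \<otimes> a = a \<and> g \<otimes> b = b \<and>
      (a = b \<longrightarrow> a \<otimes> g = g) \<and> \<beta> a b * \<tau> g = \<tau> a * \<tau> b"
    and adj: "\<And>a b. \<lbrakk>a \<in> S; b \<in> S; a \<otimes> b = b\<rbrakk> \<Longrightarrow> b \<otimes> a = b"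
  shows "finite S"
proof -
  have nz: "\<tau> a \<noteq> 0" if "a \<in> S" for a using S[OF that] trace_idempotent by blast
  have idem_trace: "\<tau> f \<in> \<tau> ` {f \<in> carrier R. f \<otimes> f = f}" if "f \<in> carrier R" "f \<otimes> f = f" for f
    using that by blast
  let ?T = "\<tau> ` {f \<in> carrier R. f \<otimes> f = f}"
  have val: "\<exists>g\<in>carrier R. g \<otimes> g = g \<and> g \<otimes> a = a \<and> g \<otimes> b = b \<and> (a = b \<longrightarrow> a \<otimes> g = g) \<and>
      \<tau> g \<noteq> 0 \<and> \<beta> a b = \<tau> a * \<tau> b / \<tau> g" if "a \<in> S" "b \<in> S" for a b
  proof -
    obtain g where g: "g \<in> carrier R" "g \<otimes> g = g" "g \<otimes> a = a" "g \<otimes> b = b" "a = b \<longrightarrow> a \<otimes> g = g"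
      "\<beta> a b * \<tau> g = \<tau> a * \<tau> b"
      using prod[OF \<open>a \<in> S\<close> \<open>b \<in> S\<close>] by blast
    have "\<tau> g \<noteq> 0" using g(6) nz that by auto
    moreover from this have "\<beta> a b = \<tau> a * \<tau> b / \<tau> g" using g(6) by (simp add: field_simps)
    ultimately show ?thesis using g by blast
  qed
  have diag: "\<beta> a a = \<tau> a" if a: "a \<in> S" for a
  proof -
    obtain g where g: "g \<in> carrier R" "g \<otimes> a = a" "a \<otimes> g = g" "\<beta> a a = \<tau> a * \<tau> a / \<tau> g"
      using val[OF a a] by blast
    have "\<tau> g = \<tau> a" using trace_comm[of a g] g S[OF a] by simp
    then show ?thesis using g(4) nz[OF a] by simp
  qed
  have absorb: "a \<otimes> b = b" if a: "a \<in> S" and b: "b \<in> S" and eq: "\<beta> a b = \<tau> b" for a b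
  proof -
    obtain g where g: "g \<in> carrier R" "g \<otimes> g = g" "g \<otimes> a = a" "g \<otimes> b = b" "\<tau> g \<noteq> 0"
      "\<beta> a b = \<tau> a * \<tau> b / \<tau> g"
      using val[OF a b] by blast
    have "\<tau> g = \<tau> a" using g(5,6) eq nz[OF b] by (simp add: field_simps)
    then have "a \<otimes> g = g" using equal_trace_absorb[of a g] S[OF a] g by blast
    then show ?thesis using m_assoc[of a g b] S[OF a] S[OF b] g by simp
  qed
  show ?thesis
  proof (rule finite_of_finite_form[where \<beta> = \<beta>])
    show "S \<subseteq> carrier R" using S by auto
    have "(\<lambda>(a, b). \<beta> a b) ` (S \<times> S) \<subseteq> (\<lambda>(x, y, z). x * y / z) ` (?T \<times> ?T \<times> ?T)"
    proof (rule image_subsetI)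
      fix ab assume "ab \<in> S \<times> S"
      then obtain a b where ab: "ab = (a, b)" "a \<in> S" "b \<in> S" by auto
      obtain g where g: "g \<in> carrier R" "g \<otimes> g = g" "\<beta> a b = \<tau> a * \<tau> b / \<tau> g"
        using val[OF ab(2,3)] by blast
      have "(\<tau> a, \<tau> b, \<tau> g) \<in> ?T \<times> ?T \<times> ?T"
        using idem_trace S[OF ab(2)] S[OF ab(3)] g(1,2) by blast
      then show "(\<lambda>(a, b). \<beta> a b) ab \<in> (\<lambda>(x, y, z). x * y / z) ` (?T \<times> ?T \<times> ?T)"
        using g(3) ab(1) by (intro image_eqI[of _ _ "(\<tau> a, \<tau> b, \<tau> g)"]) simp_all
    qed
    then show "finite ((\<lambda>(a, b). \<beta> a b) ` (S \<times> S))"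
      by (rule finite_subset) (intro finite_imageI finite_cartesian_product finite_idempotent_traces)
    show "a = b" if "a \<in> S" "b \<in> S" "\<beta> a a = \<beta> b a" "\<beta> a b = \<beta> b b" for a b
    proof -
      have ab: "a \<otimes> b = b" using absorb[OF that(1,2)] that(4) diag[OF that(2)] by simp
      have "b \<otimes> a = a" using absorb[OF that(2,1)] that(3) diag[OF that(1)] by simp
      then show ?thesis using adj[OF that(1,2) ab] by simp
    qed
  qed (use add smult in auto)
qed

end

section \<open>Duality in strict monoidal categories\<close>

text \<open>
  The arrows carry their domain and codomain, so that the typing conditions of the laws are equations
  between objects, which rewriting decides.
\<close>

locale strict_monoidal_arrows =
  fixes dom cod :: "'a \<Rightarrow> 'o" and arr :: "'a \<Rightarrow> bool"
    and cmp :: "'a \<Rightarrow> 'a \<Rightarrow> 'a" (infixr \<open>\<diamond>\<close> 70)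
    and tns :: "'a \<Rightarrow> 'a \<Rightarrow> 'a" (infixr \<open>\<star>\<close> 75)
    and idt :: "'o \<Rightarrow> 'a"
    and tob :: "'o \<Rightarrow> 'o \<Rightarrow> 'o" (infixr \<open>\<box>\<close> 75)
    and U :: 'o
  assumes tob_assoc [simp]: "(X \<box> Y) \<box> Z = X \<box> (Y \<box> Z)"
    and tob_unit [simp]: "U \<box> X = X" "X \<box> U = X"
    and dom_cod [simp]: "dom (g \<diamond> f) = dom f" "cod (g \<diamond> f) = cod g"
      "dom (f \<star> g) = dom f \<box> dom g" "cod (f \<star> g) = cod f \<box> cod g"
      "dom (idt X) = X" "cod (idt X) = X"
    and arr_intros [simp]: "\<lbrakk>arr g; arr f; cod f = dom g\<rbrakk> \<Longrightarrow> arr (g \<diamond> f)"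
      "\<lbrakk>arr f; arr g\<rbrakk> \<Longrightarrow> arr (f \<star> g)" "arr (idt X)"
    and cmp_assoc: "\<lbrakk>arr h; arr g; arr f; cod g = dom h; cod f = dom g\<rbrakk> \<Longrightarrow>
      (h \<diamond> g) \<diamond> f = h \<diamond> (g \<diamond> f)"
    and cmp_idt [simp]: "\<lbrakk>arr f; cod f = X\<rbrakk> \<Longrightarrow> idt X \<diamond> f = f" "\<lbrakk>arr f; dom f = X\<rbrakk> \<Longrightarrow> f \<diamond> idt X = f"
    and tns_assoc: "\<lbrakk>arr f; arr g; arr h\<rbrakk> \<Longrightarrow> (f \<star> g) \<star> h = f \<star> (g \<star> h)"
    and tns_unit [simp]: "arr f \<Longrightarrow> idt U \<star> f = f" "arr f \<Longrightarrow> f \<star> idt U = f"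
    and idt_tob: "idt (X \<box> Y) = idt X \<star> idt Y"
    and interchange: "\<lbrakk>arr f; arr f'; arr g; arr g'; cod f = dom f'; cod g = dom g'\<rbrakk> \<Longrightarrow>
      (f' \<star> g') \<diamond> (f \<star> g) = (f' \<diamond> f) \<star> (g' \<diamond> g)"
begin

definition hom :: "'a \<Rightarrow> 'o \<Rightarrow> 'o \<Rightarrow> bool"
  where "hom f X Y \<longleftrightarrow> arr f \<and> dom f = X \<and> cod f = Y"

lemma tns_idt_cmp: "\<lbrakk>arr g; arr f; cod f = dom g\<rbrakk> \<Longrightarrow> idt X \<star> (g \<diamond> f) = (idt X \<star> g) \<diamond> (idt X \<star> f)"
  and cmp_tns_idt: "\<lbrakk>arr g; arr f; cod f = dom g\<rbrakk> \<Longrightarrow> (g \<diamond> f) \<star> idt X = (g \<star> idt X) \<diamond> (f \<star> idt X)"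
  by (simp_all add: interchange)

lemma cmp_tns_idt_idt: "\<lbrakk>arr g; arr f; cod f = dom g\<rbrakk> \<Longrightarrow>
    (g \<diamond> f) \<star> (idt X \<star> idt Y) = (g \<star> (idt X \<star> idt Y)) \<diamond> (f \<star> (idt X \<star> idt Y))"
  using cmp_tns_idt[of g f "X \<box> Y"] by (simp add: idt_tob)

lemmas layers = cmp_assoc tns_assoc idt_tob tns_idt_cmp cmp_tns_idt cmp_tns_idt_idt

text \<open>
  Two arrows in parallel may be applied in either order. Together with \<open>layers\<close>, which writes an arrow as
  a composite of layers with one nontrivial factor each, this is the calculus of string diagrams.
\<close>

lemma slide:
  assumes "arr f" "arr g"
  shows "(f \<star> idt (cod g)) \<diamond> (idt (dom f) \<star> g) = f \<star> g"
    and "(idt (cod f) \<star> g) \<diamond> (f \<star> idt (dom g)) = f \<star> g"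
  using assms by (simp_all add: interchange)

definition dual_pair :: "'o \<Rightarrow> 'o \<Rightarrow> 'a \<Rightarrow> 'a \<Rightarrow> bool"
  where "dual_pair X X' e c \<longleftrightarrow> hom e (X' \<box> X) U \<and> hom c U (X \<box> X') \<and>
    (idt X \<star> e) \<diamond> (c \<star> idt X) = idt X \<and> (e \<star> idt X') \<diamond> (idt X' \<star> c) = idt X'"

text \<open>
  The transpose \<open>W \<rightarrow> X'\<close> of a pairing \<open>w : W \<otimes> X \<rightarrow> 1\<close>. The dual of \<open>f : X \<rightarrow> Y\<close> is the transpose of the
  pairing \<open>Y' \<otimes> X \<rightarrow> 1\<close> that evaluates after \<open>f\<close>.
\<close>

definition bend :: "'o \<Rightarrow> 'o \<Rightarrow> 'a \<Rightarrow> 'a \<Rightarrow> 'a"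
  where "bend W X' c w = (w \<star> idt X') \<diamond> (idt W \<star> c)"

lemma hom_bend:
  assumes "hom c U (X \<box> X')" "hom w (W \<box> X) U"
  shows "hom (bend W X' c w) W X'"
  using assms by (simp add: bend_def hom_def)

text \<open>
  Each of the two zigzag identities makes transposition a one-sided inverse of pairing with \<open>e\<close>: the first
  identity does so here, the second one in \<open>bend_ev\<close>.
\<close>

lemma ev_bend:
  assumes d: "dual_pair X X' e c" and w: "hom w (W \<box> X) U"
  shows "e \<diamond> (bend W X' c w \<star> idt X) = w"
proof -
  have h: "hom e (X' \<box> X) U" "hom c U (X \<box> X')" and z: "(idt X \<star> e) \<diamond> (c \<star> idt X) = idt X"
    using d by (simp_all add: dual_pair_def)
  have "e \<diamond> (bend W X' c w \<star> idt X) = (e \<diamond> (w \<star> idt (X' \<box> X))) \<diamond> (idt W \<star> (c \<star> idt X))"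
    using h w by (simp add: bend_def hom_def layers)
  also have "e \<diamond> (w \<star> idt (X' \<box> X)) = w \<diamond> (idt W \<star> (idt X \<star> e))"
    using slide[of w e] h w by (simp add: hom_def layers)
  also have "(w \<diamond> (idt W \<star> (idt X \<star> e))) \<diamond> (idt W \<star> (c \<star> idt X))
      = w \<diamond> (idt W \<star> ((idt X \<star> e) \<diamond> (c \<star> idt X)))"
    using h w by (simp add: hom_def layers)
  also have "\<dots> = w" unfolding z using w by (simp add: hom_def idt_tob[symmetric])
  finally show ?thesis .
qed

lemma bend_ev:
  assumes d: "dual_pair X X' e c" and u: "hom u W X'"
  shows "bend W X' c (e \<diamond> (u \<star> idt X)) = u"
proof -
  have h: "hom e (X' \<box> X) U" "hom c U (X \<box> X')" and z: "(e \<star> idt X') \<diamond> (idt X' \<star> c) = idt X'"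
    using d by (simp_all add: dual_pair_def)
  have "bend W X' c (e \<diamond> (u \<star> idt X)) = (e \<star> idt X') \<diamond> ((u \<star> idt (X \<box> X')) \<diamond> (idt W \<star> c))"
    using h u by (simp add: bend_def hom_def layers)
  also have "(u \<star> idt (X \<box> X')) \<diamond> (idt W \<star> c) = (idt X' \<star> c) \<diamond> u"
    using slide[of u c] h u by (simp add: hom_def)
  also have "(e \<star> idt X') \<diamond> ((idt X' \<star> c) \<diamond> u) = ((e \<star> idt X') \<diamond> (idt X' \<star> c)) \<diamond> u"
    using h u by (simp add: hom_def cmp_assoc)
  also have "\<dots> = u" unfolding z using u by (simp add: hom_def)
  finally show ?thesis .
qed

lemma dual_pair_cancel:
  assumes "dual_pair X X' e c" "hom u W X'" "hom v W X'"
    and "e \<diamond> (u \<star> idt X) = e \<diamond> (v \<star> idt X)"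
  shows "u = v"
  using bend_ev[OF assms(1,2)] bend_ev[OF assms(1,3)] assms(4) by metis

text \<open>
  The defining property of the dual arrow moves \<open>f\<close> across evaluations; here it moves across coevaluations.
\<close>

lemma bend_coev:
  assumes c: "hom c U (X \<box> X')" and d: "dual_pair Y Y' e' c'" and f: "hom f X Y"
  shows "(idt Y \<star> bend Y' X' c (e' \<diamond> (idt Y' \<star> f))) \<diamond> c' = (f \<star> idt X') \<diamond> c"
proof -
  have h: "hom e' (Y' \<box> Y) U" "hom c' U (Y \<box> Y')" and z: "(idt Y \<star> e') \<diamond> (c' \<star> idt Y) = idt Y"
    using d by (simp_all add: dual_pair_def)
  have "(idt Y \<star> bend Y' X' c (e' \<diamond> (idt Y' \<star> f))) \<diamond> c' =
      (idt Y \<star> (e' \<star> idt X')) \<diamond> (idt (Y \<box> Y') \<star> (f \<star> idt X')) \<diamond> (idt (Y \<box> Y') \<star> c) \<diamond> c'"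
    using h c f by (simp add: bend_def hom_def layers)
  also have "(idt (Y \<box> Y') \<star> c) \<diamond> c' = (c' \<star> idt (X \<box> X')) \<diamond> c"
    using slide[of c' c] h c by (simp add: hom_def)
  also have "(idt (Y \<box> Y') \<star> (f \<star> idt X')) \<diamond> ((c' \<star> idt (X \<box> X')) \<diamond> c)
      = ((idt (Y \<box> Y') \<star> (f \<star> idt X')) \<diamond> (c' \<star> idt (X \<box> X'))) \<diamond> c"
    using h c f by (simp add: hom_def cmp_assoc)
  also have "(idt (Y \<box> Y') \<star> (f \<star> idt X')) \<diamond> (c' \<star> idt (X \<box> X')) = (c' \<star> idt (Y \<box> X')) \<diamond> (f \<star> idt X')"
    using slide[of c' "f \<star> idt X'"] h c f by (simp add: hom_def)
  also have "(idt Y \<star> (e' \<star> idt X')) \<diamond> (((c' \<star> idt (Y \<box> X')) \<diamond> (f \<star> idt X')) \<diamond> c)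
      = (((idt Y \<star> e') \<diamond> (c' \<star> idt Y)) \<star> idt X') \<diamond> (f \<star> idt X') \<diamond> c"
    using h c f by (simp add: hom_def layers)
  also have "\<dots> = (f \<star> idt X') \<diamond> c" unfolding z using c f by (simp add: hom_def idt_tob[symmetric])
  finally show ?thesis .
qed

lemma dual_pair_cancel_right:
  assumes d: "dual_pair X X' e c" and u: "hom u W X" and v: "hom v W X"
    and eq: "e \<diamond> (idt X' \<star> u) = e \<diamond> (idt X' \<star> v)"
  shows "u = v"
proof -
  have h: "hom e (X' \<box> X) U" "hom c U (X \<box> X')" and z: "(idt X \<star> e) \<diamond> (c \<star> idt X) = idt X"
    using d by (simp_all add: dual_pair_def)
  have *: "(idt X \<star> (e \<diamond> (idt X' \<star> u))) \<diamond> (c \<star> idt W) = u" if u: "hom u W X" for u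
  proof -
    have "(idt X \<star> (e \<diamond> (idt X' \<star> u))) \<diamond> (c \<star> idt W)
        = (idt X \<star> e) \<diamond> ((idt (X \<box> X') \<star> u) \<diamond> (c \<star> idt W))"
      using h u by (simp add: hom_def layers)
    also have "(idt (X \<box> X') \<star> u) \<diamond> (c \<star> idt W) = (c \<star> idt X) \<diamond> u"
      using slide[of c u] h u by (simp add: hom_def)
    also have "(idt X \<star> e) \<diamond> ((c \<star> idt X) \<diamond> u) = ((idt X \<star> e) \<diamond> (c \<star> idt X)) \<diamond> u"
      using h u by (simp add: hom_def cmp_assoc)
    also have "\<dots> = u" unfolding z using u by (simp add: hom_def)
    finally show ?thesis .
  qed
  show ?thesis using *[OF u] *[OF v] eq by metis
qed

lemma bend_cmp:
  assumes "hom c U (X \<box> X')" "hom w (W \<box> X) U" "hom u V W"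
  shows "bend W X' c w \<diamond> u = bend V X' c (w \<diamond> (u \<star> idt X))"
proof -
  have "bend W X' c w \<diamond> u = (w \<star> idt X') \<diamond> ((idt W \<star> c) \<diamond> u)"
    using assms by (simp add: hom_def bend_def cmp_assoc)
  also have "(idt W \<star> c) \<diamond> u = (u \<star> idt (X \<box> X')) \<diamond> (idt V \<star> c)"
    using slide[of u c] assms by (simp add: hom_def)
  also have "(w \<star> idt X') \<diamond> ((u \<star> idt (X \<box> X')) \<diamond> (idt V \<star> c)) = bend V X' c (w \<diamond> (u \<star> idt X))"
    using assms by (simp add: hom_def bend_def layers)
  finally show ?thesis .
qed

section \<open>Pivotal traces\<close>

text \<open>
  Naturality carries \<open>f\<close> past \<open>\<phi>\<close> as its double dual, which the evaluation turns into the dual \<open>f'\<close>.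
\<close>

lemma natural_pairing:
  assumes X: "hom cX U (X \<box> X')" "hom e2X (X'' \<box> X') U" "hom \<phi>X X X''"
    and Y: "hom eY (Y' \<box> Y) U" "dual_pair Y' Y'' e2Y c2Y" "hom \<phi>Y Y Y''"
    and f: "hom f X Y"
    and f': "f' = bend Y' X' cX (eY \<diamond> (idt Y' \<star> f))"
    and nat: "bend X'' Y'' c2Y (e2X \<diamond> (idt X'' \<star> f')) \<diamond> \<phi>X = \<phi>Y \<diamond> f"
  shows "e2Y \<diamond> ((\<phi>Y \<diamond> f) \<star> idt Y') = e2X \<diamond> (\<phi>X \<star> f')"
proof -
  have hf': "hom f' Y' X'"
    unfolding f' using X Y f by (intro hom_bend[where X = X]) (simp_all add: hom_def)
  have h2: "hom e2Y (Y'' \<box> Y') U" "hom c2Y U (Y' \<box> Y'')" using Y(2) by (simp_all add: dual_pair_def)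
  let ?w = "e2X \<diamond> (idt X'' \<star> f')"
  have w: "hom ?w (X'' \<box> Y') U" using X hf' by (simp add: hom_def)
  have b: "hom (bend X'' Y'' c2Y ?w) X'' Y''" by (rule hom_bend[OF h2(2) w])
  have "e2Y \<diamond> ((\<phi>Y \<diamond> f) \<star> idt Y') = (e2Y \<diamond> (bend X'' Y'' c2Y ?w \<star> idt Y')) \<diamond> (\<phi>X \<star> idt Y')"
    unfolding nat[symmetric] using b X h2 by (simp add: hom_def layers)
  also have "\<dots> = ?w \<diamond> (\<phi>X \<star> idt Y')" by (simp only: ev_bend[OF Y(2) w])
  also have "\<dots> = e2X \<diamond> (\<phi>X \<star> f')"
    using X hf' by (simp add: hom_def cmp_assoc interchange)
  finally show ?thesis .
qed

text \<open>
  The arrow \<open>f\<close> travels once around the loop: through the evaluation by \<open>natural_pairing\<close>, and through the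
  coevaluation by \<open>bend_coev\<close>.
\<close>

lemma trace_cyclic:
  assumes X: "hom cX U (X \<box> X')" "hom e2X (X'' \<box> X') U" "hom \<phi>X X X''"
    and Y: "dual_pair Y Y' eY cY" "dual_pair Y' Y'' e2Y c2Y" "hom \<phi>Y Y Y''"
    and f: "hom f X Y" and g: "hom g Y X"
    and nat: "bend X'' Y'' c2Y (e2X \<diamond> (idt X'' \<star> bend Y' X' cX (eY \<diamond> (idt Y' \<star> f)))) \<diamond> \<phi>X
      = \<phi>Y \<diamond> f"
  shows "e2Y \<diamond> ((\<phi>Y \<diamond> (f \<diamond> g)) \<star> idt Y') \<diamond> cY = e2X \<diamond> ((\<phi>X \<diamond> (g \<diamond> f)) \<star> idt X') \<diamond> cX"
proof -
  have hY: "hom eY (Y' \<box> Y) U" "hom cY U (Y \<box> Y')" "hom e2Y (Y'' \<box> Y') U"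
    using Y by (simp_all add: dual_pair_def)
  define f' where "f' = bend Y' X' cX (eY \<diamond> (idt Y' \<star> f))"
  have hf': "hom f' Y' X'"
    unfolding f'_def using X hY f by (intro hom_bend[where X = X]) (simp_all add: hom_def)
  have "e2Y \<diamond> ((\<phi>Y \<diamond> (f \<diamond> g)) \<star> idt Y') \<diamond> cY
      = (e2Y \<diamond> ((\<phi>Y \<diamond> f) \<star> idt Y')) \<diamond> (g \<star> idt Y') \<diamond> cY"
    using hY Y(3) f g by (simp add: hom_def layers)
  also have "e2Y \<diamond> ((\<phi>Y \<diamond> f) \<star> idt Y') = e2X \<diamond> (\<phi>X \<star> f')"
    by (rule natural_pairing[OF X hY(1) Y(2,3) f f'_def nat[folded f'_def]])
  also have "(e2X \<diamond> (\<phi>X \<star> f')) \<diamond> (g \<star> idt Y') \<diamond> cY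
      = e2X \<diamond> ((\<phi>X \<star> f') \<diamond> (g \<star> idt Y')) \<diamond> cY"
    using hY X hf' g by (simp add: hom_def cmp_assoc)
  also have "(\<phi>X \<star> f') \<diamond> (g \<star> idt Y') = ((\<phi>X \<diamond> g) \<star> idt X') \<diamond> (idt Y \<star> f')"
    using X hf' g by (simp add: hom_def interchange)
  also have "e2X \<diamond> (((\<phi>X \<diamond> g) \<star> idt X') \<diamond> (idt Y \<star> f')) \<diamond> cY
      = e2X \<diamond> ((\<phi>X \<diamond> g) \<star> idt X') \<diamond> ((idt Y \<star> f') \<diamond> cY)"
    using hY X hf' g by (simp add: hom_def cmp_assoc)
  also have "(idt Y \<star> f') \<diamond> cY = (f \<star> idt X') \<diamond> cX"
    unfolding f'_def by (rule bend_coev[OF X(1) Y(1) f])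
  also have "e2X \<diamond> ((\<phi>X \<diamond> g) \<star> idt X') \<diamond> (f \<star> idt X') \<diamond> cX
      = e2X \<diamond> ((\<phi>X \<diamond> (g \<diamond> f)) \<star> idt X') \<diamond> cX"
    using X f g by (simp add: hom_def layers)
  finally show ?thesis .
qed

end

section \<open>Frobenius algebras\<close>

locale frobenius_arrows = strict_monoidal_arrows dom cod arr cmp tns idt tob U
  for dom cod :: "'a \<Rightarrow> 'o" and arr :: "'a \<Rightarrow> bool"
    and cmp :: "'a \<Rightarrow> 'a \<Rightarrow> 'a" (infixr \<open>\<diamond>\<close> 70)
    and tns :: "'a \<Rightarrow> 'a \<Rightarrow> 'a" (infixr \<open>\<star>\<close> 75)
    and idt :: "'o \<Rightarrow> 'a"
    and tob :: "'o \<Rightarrow> 'o \<Rightarrow> 'o" (infixr \<open>\<box>\<close> 75)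
    and U :: 'o +
  fixes X :: 'o and m d e n :: 'a
  assumes homs: "hom m (X \<box> X) X" "hom d X (X \<box> X)" "hom e U X" "hom n X U"
    and mult_assoc: "m \<diamond> (m \<star> idt X) = m \<diamond> (idt X \<star> m)"
    and mult_unit: "m \<diamond> (e \<star> idt X) = idt X" "m \<diamond> (idt X \<star> e) = idt X"
    and comult_coassoc: "(d \<star> idt X) \<diamond> d = (idt X \<star> d) \<diamond> d"
    and comult_counit: "(n \<star> idt X) \<diamond> d = idt X" "(idt X \<star> n) \<diamond> d = idt X"
    and frobenius_left: "(idt X \<star> m) \<diamond> (d \<star> idt X) = d \<diamond> m"
    and frobenius_right: "d \<diamond> m = (m \<star> idt X) \<diamond> (idt X \<star> d)"
begin

definition pairing :: 'a where "pairing = n \<diamond> m"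
definition copairing :: 'a where "copairing = d \<diamond> e"

lemma hom_pairing: "hom pairing (X \<box> X) U" "hom copairing U (X \<box> X)"
  using homs by (simp_all add: pairing_def copairing_def hom_def)

lemma pairing_assoc: "pairing \<diamond> (m \<star> idt X) = pairing \<diamond> (idt X \<star> m)"
  using homs by (simp add: pairing_def hom_def cmp_assoc mult_assoc)

text \<open>
  The Frobenius relation, applied to the unit; \<open>comult_right\<close> follows in the same way.
\<close>

lemma comult_left: "(idt X \<star> m) \<diamond> (copairing \<star> idt X) = d"
proof -
  have "(idt X \<star> m) \<diamond> (copairing \<star> idt X) = ((idt X \<star> m) \<diamond> (d \<star> idt X)) \<diamond> (e \<star> idt X)"
    using homs by (simp add: copairing_def hom_def layers)
  also have "\<dots> = d \<diamond> (m \<diamond> (e \<star> idt X))"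
    unfolding frobenius_left using homs by (simp add: hom_def cmp_assoc)
  also have "\<dots> = d" unfolding mult_unit using homs by (simp add: hom_def)
  finally show ?thesis .
qed

lemma comult_right: "(m \<star> idt X) \<diamond> (idt X \<star> copairing) = d"
proof -
  have "(m \<star> idt X) \<diamond> (idt X \<star> copairing) = ((m \<star> idt X) \<diamond> (idt X \<star> d)) \<diamond> (idt X \<star> e)"
    using homs by (simp add: copairing_def hom_def layers)
  also have "\<dots> = d \<diamond> (m \<diamond> (idt X \<star> e))"
    unfolding frobenius_right[symmetric] using homs by (simp add: hom_def cmp_assoc)
  also have "\<dots> = d" unfolding mult_unit using homs by (simp add: hom_def)
  finally show ?thesis .
qed

lemma pairing_comult: "(pairing \<star> idt X) \<diamond> (idt X \<star> d) = m"
proof -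
  have "(pairing \<star> idt X) \<diamond> (idt X \<star> d) = (n \<star> idt X) \<diamond> ((m \<star> idt X) \<diamond> (idt X \<star> d))"
    using homs by (simp add: pairing_def hom_def layers)
  also have "\<dots> = ((n \<star> idt X) \<diamond> d) \<diamond> m"
    unfolding frobenius_right[symmetric] using homs by (simp add: hom_def cmp_assoc)
  also have "\<dots> = m" unfolding comult_counit using homs by (simp add: hom_def)
  finally show ?thesis .
qed

lemma self_dual: "dual_pair X X pairing copairing"
proof -
  have "(idt X \<star> pairing) \<diamond> (copairing \<star> idt X)
      = (idt X \<star> n) \<diamond> ((idt X \<star> m) \<diamond> (copairing \<star> idt X))"
    using homs hom_pairing by (simp add: pairing_def hom_def layers)
  then have 1: "(idt X \<star> pairing) \<diamond> (copairing \<star> idt X) = idt X"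
    by (simp only: comult_left comult_counit)
  have "(pairing \<star> idt X) \<diamond> (idt X \<star> copairing)
      = (n \<star> idt X) \<diamond> ((m \<star> idt X) \<diamond> (idt X \<star> copairing))"
    using homs hom_pairing by (simp add: pairing_def hom_def layers)
  then have 2: "(pairing \<star> idt X) \<diamond> (idt X \<star> copairing) = idt X"
    by (simp only: comult_right comult_counit)
  show ?thesis using hom_pairing 1 2 by (simp add: dual_pair_def)
qed

lemma comult_mult: "d \<diamond> m = (m \<star> m) \<diamond> (idt X \<star> (copairing \<star> idt X))"
proof -
  have "d \<diamond> m = (m \<star> idt X) \<diamond> (idt X \<star> ((idt X \<star> m) \<diamond> (copairing \<star> idt X)))"
    unfolding comult_left by (rule frobenius_right)
  also have "\<dots> = ((m \<star> idt X) \<diamond> (idt (X \<box> X) \<star> m)) \<diamond> (idt X \<star> (copairing \<star> idt X))"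
    using homs hom_pairing by (simp add: hom_def layers)
  also have "(m \<star> idt X) \<diamond> (idt (X \<box> X) \<star> m) = m \<star> m"
    using slide(1)[of m m] homs by (simp add: hom_def)
  finally show ?thesis .
qed

end

context frobenius_arrows
begin

section \<open>The pivotal pairing\<close>

text \<open>
  The transpose of the pairing is the canonical isomorphism from \<open>X\<close>, regarded as selfdual, to another
  left dual \<open>X'\<close>.
\<close>

lemma self_dual_twist:
  assumes dX: "dual_pair X X' eX cX"
  shows "hom (bend X X' cX pairing) X X'"
    and "eX \<diamond> (bend X X' cX pairing \<star> idt X) = pairing"
    and "(idt X \<star> bend X X' cX pairing) \<diamond> copairing = cX"
proof -
  have h: "hom eX (X' \<box> X) U" "hom cX U (X \<box> X')" using dX by (simp_all add: dual_pair_def)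
  show "hom (bend X X' cX pairing) X X'" by (rule hom_bend[OF h(2) hom_pairing(1)])
  show "eX \<diamond> (bend X X' cX pairing \<star> idt X) = pairing" by (rule ev_bend[OF dX hom_pairing(1)])
  show "(idt X \<star> bend X X' cX pairing) \<diamond> copairing = cX"
    using bend_coev[OF h(2) self_dual, of "idt X"] h hom_pairing
    by (simp add: hom_def idt_tob[symmetric])
qed

text \<open>
  The dual of the multiplication is the comultiplication, once the duals of \<open>X\<close> and of \<open>X \<otimes> X\<close> are
  identified with \<open>X\<close> and \<open>X \<otimes> X\<close> along \<open>\<alpha>\<close> and \<open>\<theta>\<close>. Both sides are transposes of the trilinear pairing
  \<open>\<epsilon> (x y z)\<close>.
\<close>

lemma mult_dual:
  assumes dX: "dual_pair X X' eX cX" and dZ: "dual_pair (X \<box> X) Z' eZ cZ"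
  defines "\<alpha> \<equiv> bend X X' cX pairing"
    and "\<theta> \<equiv> bend Z' (X' \<box> X') ((idt X \<star> (cX \<star> idt X')) \<diamond> cX) eZ"
    and "m' \<equiv> bend X' Z' cZ (eX \<diamond> (idt X' \<star> m))"
  shows "\<theta> \<diamond> m' \<diamond> \<alpha> = (\<alpha> \<star> \<alpha>) \<diamond> d"
proof -
  have h: "hom eX (X' \<box> X) U" "hom cX U (X \<box> X')" "hom eZ (Z' \<box> (X \<box> X)) U" "hom cZ U ((X \<box> X) \<box> Z')"
    using dX dZ by (simp_all add: dual_pair_def)
  note \<alpha> = self_dual_twist[OF dX, folded \<alpha>_def]
  have m': "hom m' X' Z'" unfolding m'_def
    using h homs by (intro hom_bend[where X = "X \<box> X"]) (simp_all add: hom_def)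
  let ?c = "(idt X \<star> (cX \<star> idt X')) \<diamond> cX"
  have hc: "hom ?c U ((X \<box> X) \<box> (X' \<box> X'))" using h by (simp add: hom_def)
  have hm: "hom (m' \<diamond> \<alpha>) X Z'" using m' \<alpha> by (simp add: hom_def)
  have w: "hom (eX \<diamond> (idt X' \<star> m)) (X' \<box> (X \<box> X)) U" using h homs by (simp add: hom_def)
  \<comment> \<open>The arrow \<open>m' \<alpha>\<close> is the transpose of this trilinear pairing.\<close>
  have "eZ \<diamond> ((m' \<diamond> \<alpha>) \<star> idt (X \<box> X)) = (eZ \<diamond> (m' \<star> idt (X \<box> X))) \<diamond> (\<alpha> \<star> idt (X \<box> X))"
    using h m' \<alpha>(1) by (simp add: hom_def layers)
  also have "eZ \<diamond> (m' \<star> idt (X \<box> X)) = eX \<diamond> (idt X' \<star> m)"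
    unfolding m'_def by (rule ev_bend[OF dZ w])
  also have "(eX \<diamond> (idt X' \<star> m)) \<diamond> (\<alpha> \<star> idt (X \<box> X)) = (eX \<diamond> (\<alpha> \<star> idt X)) \<diamond> (idt X \<star> m)"
    using slide[of \<alpha> m] h homs \<alpha>(1) by (simp add: hom_def cmp_assoc)
  also have "\<dots> = pairing \<diamond> (idt X \<star> m)" by (simp only: \<alpha>(2))
  finally have eq: "eZ \<diamond> ((m' \<diamond> \<alpha>) \<star> idt (X \<box> X)) = pairing \<diamond> (idt X \<star> m)" .
  have "\<theta> \<diamond> m' \<diamond> \<alpha> = bend X (X' \<box> X') ?c (pairing \<diamond> (idt X \<star> m))"
    unfolding \<theta>_def using bend_cmp[OF hc h(3) hm] by (simp only: eq)
  \<comment> \<open>Through \<open>\<alpha>\<close> the coevaluation of \<open>X \<otimes> X\<close> becomes two nested copairings, which are removed by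
    the Frobenius relations.\<close>
  also have "?c = (idt (X \<box> X) \<star> (\<alpha> \<star> \<alpha>)) \<diamond> (idt X \<star> (copairing \<star> idt X)) \<diamond> copairing"
  proof -
    have "(idt (X \<box> X) \<star> (\<alpha> \<star> \<alpha>)) \<diamond> (idt X \<star> (copairing \<star> idt X))
        = (idt X \<star> (((idt X \<star> \<alpha>) \<diamond> copairing) \<star> idt X')) \<diamond> (idt X \<star> \<alpha>)"
      using \<alpha>(1) hom_pairing interchange[of copairing "idt X \<star> \<alpha>" "idt X" \<alpha>]
        slide(1)[of "(idt X \<star> \<alpha>) \<diamond> copairing" \<alpha>]
      by (simp add: hom_def idt_tob tns_assoc interchange)
    also have "(idt X \<star> \<alpha>) \<diamond> copairing = cX" by (rule \<alpha>(3))
    finally have "((idt (X \<box> X) \<star> (\<alpha> \<star> \<alpha>)) \<diamond> (idt X \<star> (copairing \<star> idt X))) \<diamond> copairing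
        = (idt X \<star> (cX \<star> idt X')) \<diamond> ((idt X \<star> \<alpha>) \<diamond> copairing)"
      using \<alpha>(1) h hom_pairing by (simp add: hom_def cmp_assoc)
    then show ?thesis unfolding \<alpha>(3) using \<alpha>(1) h hom_pairing by (simp add: hom_def cmp_assoc)
  qed
  also have "bend X (X' \<box> X') ((idt (X \<box> X) \<star> (\<alpha> \<star> \<alpha>)) \<diamond> (idt X \<star> (copairing \<star> idt X)) \<diamond> copairing)
      (pairing \<diamond> (idt X \<star> m))
    = ((pairing \<diamond> (idt X \<star> m)) \<star> idt (X' \<box> X')) \<diamond> (idt (X \<box> (X \<box> X)) \<star> (\<alpha> \<star> \<alpha>)) \<diamond>
      (idt (X \<box> X) \<star> (copairing \<star> idt X)) \<diamond> (idt X \<star> copairing)"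
    using \<alpha>(1) h hom_pairing homs by (simp add: bend_def hom_def layers)
  also have "\<dots> = (((pairing \<diamond> (idt X \<star> m)) \<star> idt (X' \<box> X')) \<diamond> (idt (X \<box> (X \<box> X)) \<star> (\<alpha> \<star> \<alpha>))) \<diamond>
      (idt (X \<box> X) \<star> (copairing \<star> idt X)) \<diamond> (idt X \<star> copairing)"
    using \<alpha>(1) h hom_pairing homs by (simp add: hom_def cmp_assoc)
  also have "((pairing \<diamond> (idt X \<star> m)) \<star> idt (X' \<box> X')) \<diamond> (idt (X \<box> (X \<box> X)) \<star> (\<alpha> \<star> \<alpha>))
      = (\<alpha> \<star> \<alpha>) \<diamond> ((pairing \<diamond> (idt X \<star> m)) \<star> idt (X \<box> X))"
    using slide[of "pairing \<diamond> (idt X \<star> m)" "\<alpha> \<star> \<alpha>"] \<alpha>(1) hom_pairing homs by (simp add: hom_def)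
  also have "((\<alpha> \<star> \<alpha>) \<diamond> ((pairing \<diamond> (idt X \<star> m)) \<star> idt (X \<box> X))) \<diamond>
      (idt (X \<box> X) \<star> (copairing \<star> idt X)) \<diamond> (idt X \<star> copairing)
    = (\<alpha> \<star> \<alpha>) \<diamond> (((pairing \<star> idt X) \<diamond> (idt X \<star> ((m \<star> idt X) \<diamond> (idt X \<star> copairing)))) \<star> idt X) \<diamond>
      (idt X \<star> copairing)"
    using \<alpha>(1) hom_pairing homs by (simp add: hom_def layers)
  also have "\<dots> = (\<alpha> \<star> \<alpha>) \<diamond> d"
    by (simp only: comult_right pairing_comult)
  finally show ?thesis .
qed

text \<open>
  In terms of elements, \<open>\<omega> (x, y)\<close> is the evaluation of \<open>\<phi> x\<close> on \<open>\<alpha> y\<close>, and \<open>\<psi>\<close> expresses \<open>\<omega>\<close> through the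
  Frobenius pairing. The last equation, \<open>\<omega> (x y, z) = \<omega> (x, \<psi> (y) z)\<close>, says that \<open>\<psi>\<close> is multiplicative. It is here
  that the pivotal structure has to be monoidal: naturality replaces \<open>\<phi> m\<close> by the double dual of \<open>m\<close>
  applied to \<open>\<phi>2\<close>, which is \<open>\<phi> \<otimes> \<phi>\<close> by \<open>mon\<close>; evaluating moves one dual of \<open>m\<close> to the argument \<open>z\<close>, where
  it is the comultiplication by \<open>mult_dual\<close>. This leaves \<open>\<omega> (x, z2) \<omega> (y, z1)\<close> summed over the
  coproduct of \<open>z\<close>.
\<close>

lemma pivotal_pairing_mult:
  assumes dX: "dual_pair X X' eX cX" and dX': "hom e2 (X'' \<box> X') U"
    "dual_pair X' X'' e2 c2"
    and dZ: "dual_pair (X \<box> X) Z' eZ cZ" "dual_pair Z' Z'' e2Z c2Z" "hom e2Z (Z'' \<box> Z') U"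
    and \<phi>: "hom \<phi> X X''" "hom \<phi>2 (X \<box> X) Z''"
  defines "\<alpha> \<equiv> bend X X' cX pairing"
    and "\<theta> \<equiv> bend Z' (X' \<box> X') ((idt X \<star> (cX \<star> idt X')) \<diamond> cX) eZ"
    and "m' \<equiv> bend X' Z' cZ (eX \<diamond> (idt X' \<star> m))"
  assumes mon: "\<phi>2 = bend (X'' \<box> X'') Z'' c2Z
      ((e2 \<diamond> (idt X'' \<star> (e2 \<star> idt X'))) \<diamond> (idt (X'' \<box> X'') \<star> \<theta>)) \<diamond> (\<phi> \<star> \<phi>)"
    and nat: "bend Z'' X'' c2 (e2Z \<diamond> (idt Z'' \<star> m')) \<diamond> \<phi>2 = \<phi> \<diamond> m"
  defines "\<omega> \<equiv> e2 \<diamond> (\<phi> \<star> \<alpha>)"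
  defines "\<psi> \<equiv> bend X X copairing \<omega>"
  shows "hom \<omega> (X \<box> X) U" and "hom \<psi> X X" and "pairing \<diamond> (\<psi> \<star> idt X) = \<omega>"
    and "\<omega> \<diamond> (m \<star> idt X) = \<omega> \<diamond> (idt X \<star> (m \<diamond> (\<psi> \<star> idt X)))"
proof -
  have h: "hom eX (X' \<box> X) U" "hom cX U (X \<box> X')" "hom eZ (Z' \<box> (X \<box> X)) U" "hom cZ U ((X \<box> X) \<box> Z')"
    "hom c2Z U (Z' \<box> Z'')" "hom c2 U (X' \<box> X'')"
    using dX dX' dZ by (simp_all add: dual_pair_def)
  note \<alpha> = self_dual_twist[OF dX, folded \<alpha>_def]
  show \<omega>: "hom \<omega> (X \<box> X) U" unfolding \<omega>_def using dX' \<phi> \<alpha>(1) by (simp add: hom_def)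
  show \<psi>: "hom \<psi> X X" unfolding \<psi>_def by (rule hom_bend[OF hom_pairing(2) \<omega>])
  show \<psi>\<omega>: "pairing \<diamond> (\<psi> \<star> idt X) = \<omega>" unfolding \<psi>_def by (rule ev_bend[OF self_dual \<omega>])
  have m': "hom m' X' Z'" unfolding m'_def
    using h homs by (intro hom_bend[where X = "X \<box> X"]) (simp_all add: hom_def)
  have \<theta>: "hom \<theta> Z' (X' \<box> X')" unfolding \<theta>_def
    using h by (intro hom_bend[where X = "X \<box> X"]) (simp_all add: hom_def)
  let ?e = "e2 \<diamond> (idt X'' \<star> (e2 \<star> idt X'))"
  have e: "hom ?e (X'' \<box> (X'' \<box> (X' \<box> X'))) U" using dX' by (simp add: hom_def)
  let ?w = "?e \<diamond> (idt (X'' \<box> X'') \<star> \<theta>)"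
  have w: "hom ?w ((X'' \<box> X'') \<box> Z') U" using e \<theta> by (simp add: hom_def)
  let ?J = "bend (X'' \<box> X'') Z'' c2Z ?w"
  have J: "hom ?J (X'' \<box> X'') Z''" by (rule hom_bend[OF h(5) w])
  have "\<omega> \<diamond> (m \<star> idt X) = (e2 \<diamond> ((\<phi> \<diamond> m) \<star> idt X')) \<diamond> (idt (X \<box> X) \<star> \<alpha>)"
    unfolding \<omega>_def using dX' \<phi> \<alpha>(1) homs by (simp add: hom_def cmp_assoc interchange)
  \<comment> \<open>Naturality of \<open>\<phi>\<close> at the multiplication.\<close>
  also have "e2 \<diamond> ((\<phi> \<diamond> m) \<star> idt X') = e2Z \<diamond> (\<phi>2 \<star> m')"
    by (rule natural_pairing[OF _ dZ(3) \<phi>(2) h(1) dX'(2) \<phi>(1) homs(1) m'_def[THEN meta_eq_to_obj_eq] nat])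
      (use h in \<open>simp add: hom_def\<close>)
  also have "(e2Z \<diamond> (\<phi>2 \<star> m')) \<diamond> (idt (X \<box> X) \<star> \<alpha>) = (e2Z \<diamond> (?J \<star> idt Z')) \<diamond> ((\<phi> \<star> \<phi>) \<star> (m' \<diamond> \<alpha>))"
    unfolding mon using dZ(3) J \<phi>(1) m' \<alpha>(1) by (simp add: hom_def cmp_assoc interchange)
  also have "e2Z \<diamond> (?J \<star> idt Z') = ?w" by (rule ev_bend[OF dZ(2) w])
  also have "?w \<diamond> ((\<phi> \<star> \<phi>) \<star> (m' \<diamond> \<alpha>)) = ?e \<diamond> ((\<phi> \<star> \<phi>) \<star> (\<theta> \<diamond> m' \<diamond> \<alpha>))"
    using e \<theta> \<phi>(1) m' \<alpha>(1) interchange[of "\<phi> \<star> \<phi>" "idt (X'' \<box> X'')" "m' \<diamond> \<alpha>" \<theta>]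
    by (simp add: hom_def cmp_assoc)
  also have "\<theta> \<diamond> m' \<diamond> \<alpha> = (\<alpha> \<star> \<alpha>) \<diamond> d"
    unfolding \<theta>_def m'_def \<alpha>_def by (rule mult_dual[OF dX dZ(1)])
  also have "?e \<diamond> ((\<phi> \<star> \<phi>) \<star> ((\<alpha> \<star> \<alpha>) \<diamond> d))
      = (e2 \<diamond> (idt X'' \<star> (e2 \<star> idt X'))) \<diamond> (\<phi> \<star> ((\<phi> \<star> \<alpha>) \<star> \<alpha>)) \<diamond> (idt X \<star> (idt X \<star> d))"
    using dX' \<phi>(1) \<alpha>(1) homs by (simp add: hom_def cmp_assoc tns_assoc interchange)
  also have "\<dots> = e2 \<diamond> ((idt X'' \<star> (e2 \<star> idt X')) \<diamond> (\<phi> \<star> ((\<phi> \<star> \<alpha>) \<star> \<alpha>))) \<diamond> (idt X \<star> (idt X \<star> d))"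
    using dX' \<phi>(1) \<alpha>(1) homs by (simp add: hom_def cmp_assoc)
  also have "(idt X'' \<star> (e2 \<star> idt X')) \<diamond> (\<phi> \<star> ((\<phi> \<star> \<alpha>) \<star> \<alpha>)) = (\<phi> \<star> \<alpha>) \<diamond> (idt X \<star> (\<omega> \<star> idt X))"
    unfolding \<omega>_def using dX'(1) \<phi>(1) \<alpha>(1) slide(2)[of "e2 \<diamond> (\<phi> \<star> \<alpha>)" \<alpha>]
    by (simp add: hom_def interchange)
  also have "e2 \<diamond> ((\<phi> \<star> \<alpha>) \<diamond> (idt X \<star> (\<omega> \<star> idt X))) \<diamond> (idt X \<star> (idt X \<star> d))
      = \<omega> \<diamond> (idt X \<star> ((\<omega> \<star> idt X) \<diamond> (idt X \<star> d)))"
    unfolding \<omega>_def using dX' \<phi>(1) \<alpha>(1) homs by (simp add: hom_def cmp_assoc tns_idt_cmp)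
  \<comment> \<open>Contracting one leg of the coproduct of \<open>z\<close> with \<open>\<psi> y\<close> multiplies \<open>\<psi> y\<close> and \<open>z\<close>.\<close>
  also have "(\<omega> \<star> idt X) \<diamond> (idt X \<star> d) = m \<diamond> (\<psi> \<star> idt X)"
  proof -
    have "(\<omega> \<star> idt X) \<diamond> (idt X \<star> d) = (pairing \<star> idt X) \<diamond> ((\<psi> \<star> idt (X \<box> X)) \<diamond> (idt X \<star> d))"
      unfolding \<psi>\<omega>[symmetric] using \<psi> hom_pairing homs by (simp add: hom_def layers)
    also have "(\<psi> \<star> idt (X \<box> X)) \<diamond> (idt X \<star> d) = (idt X \<star> d) \<diamond> (\<psi> \<star> idt X)"
      using slide[of \<psi> d] \<psi> homs by (simp add: hom_def)
    also have "(pairing \<star> idt X) \<diamond> ((idt X \<star> d) \<diamond> (\<psi> \<star> idt X)) = m \<diamond> (\<psi> \<star> idt X)"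
      using \<psi> hom_pairing homs by (simp add: hom_def cmp_assoc[symmetric] pairing_comult)
    finally show ?thesis .
  qed
  finally show "\<omega> \<diamond> (m \<star> idt X) = \<omega> \<diamond> (idt X \<star> (m \<diamond> (\<psi> \<star> idt X)))" .
qed

lemma trace_pairing:
  assumes dX: "dual_pair X X' eX cX" and e2: "hom e2 (X'' \<box> X') U" and \<phi>: "hom \<phi> X X''" and f: "hom f X X"
  shows "e2 \<diamond> ((\<phi> \<diamond> f) \<star> idt X') \<diamond> cX
    = (e2 \<diamond> (\<phi> \<star> bend X X' cX pairing)) \<diamond> (f \<star> idt X) \<diamond> copairing"
proof -
  note \<alpha> = self_dual_twist[OF dX]
  let ?\<alpha> = "bend X X' cX pairing"
  have "e2 \<diamond> ((\<phi> \<diamond> f) \<star> idt X') \<diamond> cX = e2 \<diamond> ((\<phi> \<diamond> f) \<star> idt X') \<diamond> (idt X \<star> ?\<alpha>) \<diamond> copairing"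
    unfolding \<alpha>(3) ..
  also have "\<dots> = e2 \<diamond> (((\<phi> \<diamond> f) \<star> idt X') \<diamond> (idt X \<star> ?\<alpha>)) \<diamond> copairing"
    using e2 \<phi> f \<alpha>(1) hom_pairing by (simp add: hom_def cmp_assoc)
  also have "((\<phi> \<diamond> f) \<star> idt X') \<diamond> (idt X \<star> ?\<alpha>) = (\<phi> \<star> ?\<alpha>) \<diamond> (f \<star> idt X)"
    using \<phi> f \<alpha>(1) by (simp add: hom_def interchange)
  also have "e2 \<diamond> ((\<phi> \<star> ?\<alpha>) \<diamond> (f \<star> idt X)) \<diamond> copairing
      = (e2 \<diamond> (\<phi> \<star> ?\<alpha>)) \<diamond> (f \<star> idt X) \<diamond> copairing"
    using e2 \<phi> f \<alpha>(1) hom_pairing by (simp add: hom_def cmp_assoc)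
  finally show ?thesis .
qed

end

section \<open>Convolution of conditional expectations\<close>

text \<open>
  Scalars are endomorphisms \<open>s\<close> of the unit object, and \<open>s \<star> f\<close> is the multiple of \<open>f\<close> by \<open>s\<close>.
\<close>

locale connected_frobenius_arrows = frobenius_arrows +
  assumes scalar_central: "\<lbrakk>hom s U U; arr f\<rbrakk> \<Longrightarrow> s \<star> f = f \<star> s"
    and connected: "hom h U X \<Longrightarrow> \<exists>s. hom s U U \<and> h = e \<diamond> s"

context frobenius_arrows
begin

definition convolution :: "'a \<Rightarrow> 'a \<Rightarrow> 'a"
  where "convolution a b = m \<diamond> (a \<star> b) \<diamond> d"

text \<open>
  These are the properties, expressed inside \<open>X\<close>, of a selfadjoint conditional expectation onto a
  subalgebra: the range is closed under multiplication, and the projection is linear over it on both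
  sides.
\<close>

definition expectation :: "'a \<Rightarrow> bool"
  where "expectation b \<longleftrightarrow> hom b X X \<and> b \<diamond> b = b \<and> b \<diamond> e = e \<and>
    b \<diamond> m \<diamond> (b \<star> idt X) = m \<diamond> (b \<star> b) \<and> b \<diamond> m \<diamond> (idt X \<star> b) = m \<diamond> (b \<star> b) \<and>
    pairing \<diamond> (b \<star> idt X) = pairing \<diamond> (idt X \<star> b)"

lemma expectationD:
  assumes "expectation b"
  shows "hom b X X" "b \<diamond> b = b" "b \<diamond> e = e"
    "b \<diamond> m \<diamond> (b \<star> idt X) = m \<diamond> (b \<star> b)" "b \<diamond> m \<diamond> (idt X \<star> b) = m \<diamond> (b \<star> b)"
    "pairing \<diamond> (b \<star> idt X) = pairing \<diamond> (idt X \<star> b)"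
  using assms by (simp_all add: expectation_def)

lemma hom_convolution: "\<lbrakk>hom a X X; hom b X X\<rbrakk> \<Longrightarrow> hom (convolution a b) X X"
  using homs by (simp add: convolution_def hom_def)

text \<open>
  Regrouping: \<open>(x y) (z w) = (x (y z)) w\<close>.
\<close>

lemma mult_mult: "m \<diamond> (m \<star> m) = m \<diamond> ((m \<diamond> (idt X \<star> m)) \<star> idt X)"
proof -
  have "m \<diamond> (m \<star> m) = (m \<diamond> (idt X \<star> m)) \<diamond> (m \<star> idt (X \<box> X))"
    using homs slide(2)[of m m] by (simp add: hom_def cmp_assoc)
  also have "m \<diamond> (idt X \<star> m) = m \<diamond> (m \<star> idt X)" by (simp add: mult_assoc)
  also have "(m \<diamond> (m \<star> idt X)) \<diamond> (m \<star> idt (X \<box> X)) = m \<diamond> ((m \<diamond> (m \<star> idt X)) \<star> idt X)"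
    using homs by (simp add: hom_def layers)
  finally show ?thesis by (simp only: mult_assoc)
qed

text \<open>
  The conclusion is the adjoint of the hypothesis \<open>a b = b\<close>.
\<close>

lemma expectation_selfadjoint_cmp:
  assumes a: "expectation a" and b: "expectation b" and ab: "a \<diamond> b = b"
  shows "b \<diamond> a = b"
proof -
  note A = expectationD[OF a] and B = expectationD[OF b]
  have "pairing \<diamond> (idt X \<star> (b \<diamond> a)) = (pairing \<diamond> (idt X \<star> b)) \<diamond> (idt X \<star> a)"
    using A(1) B(1) hom_pairing by (simp add: hom_def layers)
  also have "\<dots> = (pairing \<diamond> (idt X \<star> a)) \<diamond> (b \<star> idt X)"
    unfolding B(6)[symmetric] using A(1) B(1) hom_pairing by (simp add: hom_def cmp_assoc interchange)
  also have "\<dots> = pairing \<diamond> ((a \<diamond> b) \<star> idt X)"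
    unfolding A(6)[symmetric] using A(1) B(1) hom_pairing by (simp add: hom_def layers)
  also have "\<dots> = pairing \<diamond> (idt X \<star> b)" unfolding ab by (rule B(6))
  finally have eq: "pairing \<diamond> (idt X \<star> (b \<diamond> a)) = pairing \<diamond> (idt X \<star> b)" .
  have "hom (b \<diamond> a) X X" using A(1) B(1) by (simp add: hom_def)
  then show ?thesis using dual_pair_cancel_right[OF self_dual _ B(1) eq] by simp
qed

text \<open>
  The convolution takes its values in products of elements of the range of \<open>a\<close>.
\<close>

lemma expectation_absorb:
  assumes a: "expectation a" shows "a \<diamond> convolution a a = convolution a a"
proof -
  note A = expectationD[OF a]
  have "a \<diamond> m \<diamond> (a \<star> a) = (a \<diamond> m \<diamond> (a \<star> idt X)) \<diamond> (idt X \<star> a)"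
    using A(1) homs by (simp add: hom_def cmp_assoc interchange)
  also have "\<dots> = m \<diamond> (a \<star> (a \<diamond> a))"
    unfolding A(4) using A(1) homs by (simp add: hom_def cmp_assoc interchange)
  finally have "a \<diamond> m \<diamond> (a \<star> a) = m \<diamond> (a \<star> a)" by (simp only: A(2))
  then have "(a \<diamond> m \<diamond> (a \<star> a)) \<diamond> d = (m \<diamond> (a \<star> a)) \<diamond> d" by simp
  then show ?thesis using A(1) homs by (simp add: convolution_def hom_def cmp_assoc)
qed

text \<open>
  The products of the ranges of \<open>a\<close> and \<open>b\<close> include both ranges, since each of these contains the unit.
\<close>

lemma expectation_units:
  assumes a: "expectation a" and b: "expectation b"
  shows "m \<diamond> (a \<star> b) \<diamond> (idt X \<star> e) = a" "m \<diamond> (a \<star> b) \<diamond> (e \<star> idt X) = b"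
proof -
  note A = expectationD[OF a] and B = expectationD[OF b]
  have "m \<diamond> (a \<star> b) \<diamond> (idt X \<star> e) = m \<diamond> (a \<star> (b \<diamond> e))"
    using A(1) B(1) homs by (simp add: hom_def interchange)
  also have "\<dots> = (m \<diamond> (idt X \<star> e)) \<diamond> a"
    unfolding B(3) using A(1) homs slide(2)[of a e] by (simp add: hom_def cmp_assoc)
  finally show "m \<diamond> (a \<star> b) \<diamond> (idt X \<star> e) = a" unfolding mult_unit using A(1) by (simp add: hom_def)
  have "m \<diamond> (a \<star> b) \<diamond> (e \<star> idt X) = m \<diamond> ((a \<diamond> e) \<star> b)"
    using A(1) B(1) homs by (simp add: hom_def interchange)
  also have "\<dots> = (m \<diamond> (e \<star> idt X)) \<diamond> b"
    unfolding A(3) using B(1) homs slide(1)[of e b] by (simp add: hom_def cmp_assoc)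
  finally show "m \<diamond> (a \<star> b) \<diamond> (e \<star> idt X) = b" unfolding mult_unit using B(1) by (simp add: hom_def)
qed

end

context connected_frobenius_arrows
begin

lemma scalar_cmp:
  assumes s: "hom s U U" and f: "hom f Y Z" and g: "hom g W Y"
  shows "(s \<star> f) \<diamond> g = s \<star> (f \<diamond> g)" "f \<diamond> (s \<star> g) = s \<star> (f \<diamond> g)"
  using assms interchange[of "idt U" s g f] interchange[of s "idt U" g f] by (simp_all add: hom_def)

text \<open>
  The left-hand side commutes with right multiplication, hence is left multiplication by its value at the
  unit.
\<close>

lemma connected_comult:
  assumes f: "hom f X X" and s: "hom s U U" and eq: "m \<diamond> (f \<star> idt X) \<diamond> copairing = e \<diamond> s"
  shows "m \<diamond> (f \<star> idt X) \<diamond> d = s \<star> idt X"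
proof -
  have "m \<diamond> (f \<star> idt X) \<diamond> d = m \<diamond> (f \<star> idt X) \<diamond> ((idt X \<star> m) \<diamond> (copairing \<star> idt X))"
    by (simp only: comult_left)
  also have "\<dots> = m \<diamond> ((f \<star> idt X) \<diamond> (idt X \<star> m)) \<diamond> (copairing \<star> idt X)"
    using f homs hom_pairing by (simp add: hom_def cmp_assoc)
  also have "(f \<star> idt X) \<diamond> (idt X \<star> m) = (idt X \<star> m) \<diamond> (f \<star> idt (X \<box> X))"
    using slide[of f m] f homs by (simp add: hom_def)
  also have "m \<diamond> ((idt X \<star> m) \<diamond> (f \<star> idt (X \<box> X))) \<diamond> (copairing \<star> idt X)
      = (m \<diamond> (idt X \<star> m)) \<diamond> (f \<star> idt (X \<box> X)) \<diamond> (copairing \<star> idt X)"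
    using f homs hom_pairing by (simp add: hom_def cmp_assoc)
  also have "\<dots> = m \<diamond> ((m \<diamond> (f \<star> idt X) \<diamond> copairing) \<star> idt X)"
    unfolding mult_assoc[symmetric] using f homs hom_pairing by (simp add: hom_def layers)
  also have "\<dots> = (m \<diamond> (e \<star> idt X)) \<diamond> (s \<star> idt X)"
    unfolding eq using s homs by (simp add: hom_def layers)
  also have "\<dots> = s \<star> idt X" unfolding mult_unit using s by (simp add: hom_def)
  finally show ?thesis .
qed

text \<open>
  Let \<open>x\<close> and \<open>y\<close> lie in the ranges \<open>A\<close> of \<open>a\<close> and \<open>B\<close> of \<open>b\<close>. The coproduct of \<open>x y\<close> is the sum of
  \<open>x u \<otimes> v y\<close>, where \<open>u \<otimes> v\<close> runs through the coproduct of the unit. Since \<open>a\<close> and \<open>b\<close> are linear over \<open>A\<close> and \<open>B\<close>,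
  the convolution maps \<open>x y\<close> to \<open>x t y\<close> where \<open>t\<close> is the sum of the \<open>a (u) b (v)\<close>; and \<open>t\<close> is the scalar \<open>k\<close>.
\<close>

lemma convolution_mult:
  assumes a: "expectation a" and b: "expectation b"
    and k: "hom k U U" and eq: "m \<diamond> (a \<star> b) \<diamond> copairing = e \<diamond> k"
  shows "convolution a b \<diamond> m \<diamond> (a \<star> b) = k \<star> (m \<diamond> (a \<star> b))"
proof -
  note A = expectationD[OF a] and B = expectationD[OF b]
  let ?q = "idt X \<star> (copairing \<star> idt X)"
  have "convolution a b \<diamond> m \<diamond> (a \<star> b) = m \<diamond> (a \<star> b) \<diamond> (d \<diamond> m) \<diamond> (a \<star> b)"
    using A(1) B(1) homs by (simp add: convolution_def hom_def cmp_assoc)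
  also have "\<dots> = m \<diamond> (((a \<star> b) \<diamond> (m \<star> m)) \<diamond> (?q \<diamond> (a \<star> b)))"
    unfolding comult_mult using A(1) B(1) homs hom_pairing by (simp add: hom_def cmp_assoc)
  also have "(a \<star> b) \<diamond> (m \<star> m) = (a \<diamond> m) \<star> (b \<diamond> m)"
    using A(1) B(1) homs by (simp add: hom_def interchange)
  also have "?q \<diamond> (a \<star> b) = (a \<star> (idt (X \<box> X) \<star> b)) \<diamond> ?q"
    using A(1) B(1) hom_pairing slide[of copairing b] by (simp add: hom_def interchange)
  also have "((a \<diamond> m) \<star> (b \<diamond> m)) \<diamond> ((a \<star> (idt (X \<box> X) \<star> b)) \<diamond> ?q)
      = ((a \<diamond> m \<diamond> (a \<star> idt X)) \<star> (b \<diamond> m \<diamond> (idt X \<star> b))) \<diamond> ?q"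
    using A(1) B(1) homs hom_pairing
      interchange[of "a \<star> idt X" "a \<diamond> m" "idt X \<star> b" "b \<diamond> m"]
    by (simp add: hom_def cmp_assoc[symmetric] idt_tob tns_assoc)
  also have "\<dots> = (m \<star> m) \<diamond> (((a \<star> a) \<star> (b \<star> b)) \<diamond> ?q)"
    unfolding A(4) B(5) using A(1) B(1) homs hom_pairing
      interchange[of "a \<star> a" m "b \<star> b" m]
    by (simp add: hom_def cmp_assoc[symmetric])
  also have "((a \<star> a) \<star> (b \<star> b)) \<diamond> ?q = a \<star> (((a \<star> b) \<diamond> copairing) \<star> b)"
    using A(1) B(1) hom_pairing interchange[of copairing "a \<star> b" "idt X" b]
    by (simp add: hom_def tns_assoc interchange)
  also have "m \<diamond> (m \<star> m) \<diamond> (a \<star> (((a \<star> b) \<diamond> copairing) \<star> b))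
      = (m \<diamond> (m \<star> m)) \<diamond> (a \<star> (((a \<star> b) \<diamond> copairing) \<star> b))"
    using A(1) B(1) homs hom_pairing by (simp add: hom_def cmp_assoc)
  also have "\<dots> = m \<diamond> ((m \<diamond> (idt X \<star> m)) \<star> idt X) \<diamond> ((a \<star> ((a \<star> b) \<diamond> copairing)) \<star> b)"
    unfolding mult_mult using A(1) B(1) homs hom_pairing
    by (simp add: hom_def cmp_assoc tns_assoc)
  also have "((m \<diamond> (idt X \<star> m)) \<star> idt X) \<diamond> ((a \<star> ((a \<star> b) \<diamond> copairing)) \<star> b)
      = (m \<diamond> (a \<star> (m \<diamond> (a \<star> b) \<diamond> copairing))) \<star> b"
    using A(1) B(1) homs hom_pairing
      interchange[of "a \<star> ((a \<star> b) \<diamond> copairing)" "m \<diamond> (idt X \<star> m)" b "idt X"]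
    by (simp add: hom_def cmp_assoc interchange)
  also have "m \<diamond> (a \<star> (m \<diamond> (a \<star> b) \<diamond> copairing)) = k \<star> a"
  proof -
    have "m \<diamond> (a \<star> (e \<diamond> k)) = (m \<diamond> (idt X \<star> e)) \<diamond> (a \<star> k)"
      using A(1) homs k by (simp add: hom_def cmp_assoc interchange)
    also have "\<dots> = k \<star> a"
      unfolding mult_unit using A(1) k scalar_central[OF k, of a] by (simp add: hom_def)
    finally show ?thesis unfolding eq .
  qed
  also have "m \<diamond> ((k \<star> a) \<star> b) = k \<star> (m \<diamond> (a \<star> b))"
    using A(1) B(1) homs k scalar_cmp(2)[OF k homs(1), of "a \<star> b"]
    by (simp add: hom_def tns_assoc)
  finally show ?thesis .
qed

lemma convolution_range:
  assumes a: "expectation a" and b: "expectation b"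
    and k: "hom k U U" and eq: "m \<diamond> (a \<star> b) \<diamond> copairing = e \<diamond> k"
  shows "convolution a b \<diamond> a = k \<star> a" "convolution a b \<diamond> b = k \<star> b"
    "convolution a b \<diamond> convolution a b = k \<star> convolution a b"
proof -
  note A = expectationD[OF a] and B = expectationD[OF b]
  note q = hom_convolution[OF A(1) B(1)]
  have *: "convolution a b \<diamond> (m \<diamond> (a \<star> b) \<diamond> u) = k \<star> (m \<diamond> (a \<star> b) \<diamond> u)"
    if u: "hom u Y (X \<box> X)" for u Y
  proof -
    have "convolution a b \<diamond> (m \<diamond> (a \<star> b) \<diamond> u) = (convolution a b \<diamond> m \<diamond> (a \<star> b)) \<diamond> u"
      using A(1) B(1) q u homs by (simp add: hom_def cmp_assoc)
    also have "\<dots> = k \<star> ((m \<diamond> (a \<star> b)) \<diamond> u)"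
      unfolding convolution_mult[OF assms] using A(1) B(1) homs u
      by (intro scalar_cmp[OF k]) (simp_all add: hom_def)
    finally show ?thesis using A(1) B(1) homs u by (simp add: hom_def cmp_assoc)
  qed
  show "convolution a b \<diamond> a = k \<star> a"
    using *[of "idt X \<star> e" X] homs by (simp add: hom_def expectation_units[OF a b])
  show "convolution a b \<diamond> b = k \<star> b"
    using *[of "e \<star> idt X" X] homs by (simp add: hom_def expectation_units[OF a b])
  show "convolution a b \<diamond> convolution a b = k \<star> convolution a b"
    using *[OF homs(2)] by (simp add: convolution_def)
qed

text \<open>
  If \<open>w\<close> is the pivotal pairing, \<open>w \<diamond> (f \<star> idt X) \<diamond> copairing\<close> is the trace of \<open>f\<close>. By the
  multiplicativity \<open>wm\<close> the factor \<open>b\<close> of the convolution meets the remaining leg of the copairing, where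
  \<open>connected_comult\<close> contracts it to the scalar \<open>s\<close>; what is left is the trace of \<open>a\<close>.
\<close>

lemma convolution_trace:
  assumes w: "hom w (X \<box> X) U" and p: "hom p X X" and wp: "pairing \<diamond> (p \<star> idt X) = w"
    and wm: "w \<diamond> (m \<star> idt X) = w \<diamond> (idt X \<star> (m \<diamond> (p \<star> idt X)))"
    and a: "hom a X X" and b: "hom b X X"
    and s: "hom s U U" and eq: "m \<diamond> ((p \<diamond> b) \<star> idt X) \<diamond> copairing = e \<diamond> s"
  shows "w \<diamond> (convolution a b \<star> idt X) \<diamond> copairing = s \<star> (w \<diamond> (a \<star> idt X) \<diamond> copairing)"
    and "w \<diamond> (b \<star> idt X) \<diamond> copairing = n \<diamond> e \<diamond> s"
proof -
  have coassoc: "(d \<star> idt X) \<diamond> copairing = (idt X \<star> d) \<diamond> copairing"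
    using homs comult_coassoc cmp_assoc[of "d \<star> idt X" d e] cmp_assoc[of "idt X \<star> d" d e]
    by (simp add: copairing_def hom_def)
  have "w \<diamond> (convolution a b \<star> idt X) \<diamond> copairing
      = (w \<diamond> (m \<star> idt X)) \<diamond> ((a \<star> b) \<star> idt X) \<diamond> (d \<star> idt X) \<diamond> copairing"
    using w a b homs hom_pairing
    by (simp add: convolution_def hom_def cmp_assoc cmp_tns_idt)
  also have "\<dots> = w \<diamond> ((idt X \<star> (m \<diamond> (p \<star> idt X))) \<diamond> ((a \<star> b) \<star> idt X)) \<diamond> (idt X \<star> d) \<diamond> copairing"
    unfolding wm coassoc using w p a b homs hom_pairing
    by (simp add: hom_def cmp_assoc)
  also have "(idt X \<star> (m \<diamond> (p \<star> idt X))) \<diamond> ((a \<star> b) \<star> idt X) = a \<star> (m \<diamond> ((p \<diamond> b) \<star> idt X))"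
    using p a b homs by (simp add: hom_def tns_assoc cmp_assoc interchange)
  also have "w \<diamond> (a \<star> (m \<diamond> ((p \<diamond> b) \<star> idt X))) \<diamond> (idt X \<star> d) \<diamond> copairing
      = w \<diamond> (a \<star> (m \<diamond> ((p \<diamond> b) \<star> idt X) \<diamond> d)) \<diamond> copairing"
    using w p a b homs hom_pairing
      interchange[of "idt X" a d "m \<diamond> ((p \<diamond> b) \<star> idt X)"]
    by (simp add: hom_def cmp_assoc[symmetric])
  also have "m \<diamond> ((p \<diamond> b) \<star> idt X) \<diamond> d = s \<star> idt X"
    using p b by (intro connected_comult[OF _ s eq]) (simp add: hom_def)
  also have "a \<star> (s \<star> idt X) = s \<star> (a \<star> idt X)"
    using a s scalar_central[OF s, of a] tns_assoc[of a s "idt X"] tns_assoc[of s a "idt X"]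
    by (simp add: hom_def)
  also have "w \<diamond> (s \<star> (a \<star> idt X)) \<diamond> copairing = s \<star> (w \<diamond> (a \<star> idt X) \<diamond> copairing)"
    using w a hom_pairing s scalar_cmp(1)[OF s, of "a \<star> idt X" "X \<box> X" "X \<box> X" copairing U]
      scalar_cmp(2)[OF s w, of "(a \<star> idt X) \<diamond> copairing" U]
    by (simp add: hom_def)
  finally show "w \<diamond> (convolution a b \<star> idt X) \<diamond> copairing = s \<star> (w \<diamond> (a \<star> idt X) \<diamond> copairing)" .
  have "w \<diamond> (b \<star> idt X) \<diamond> copairing = n \<diamond> (m \<diamond> ((p \<diamond> b) \<star> idt X) \<diamond> copairing)"
    unfolding wp[symmetric] pairing_def using p b homs hom_pairing by (simp add: hom_def layers)
  then show "w \<diamond> (b \<star> idt X) \<diamond> copairing = n \<diamond> e \<diamond> s" by (simp only: eq)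
qed

end

section \<open>The expectation onto a Frobenius subalgebra\<close>

locale frobenius_subalgebra_arrows =
  A: frobenius_arrows dom cod arr cmp tns idt tob U A mA dA eA nA +
  X: frobenius_arrows dom cod arr cmp tns idt tob U X m d e n
  for dom cod :: "'a \<Rightarrow> 'o" and arr :: "'a \<Rightarrow> bool"
    and cmp :: "'a \<Rightarrow> 'a \<Rightarrow> 'a" (infixr \<open>\<diamond>\<close> 70)
    and tns :: "'a \<Rightarrow> 'a \<Rightarrow> 'a" (infixr \<open>\<star>\<close> 75)
    and idt :: "'o \<Rightarrow> 'a"
    and tob :: "'o \<Rightarrow> 'o \<Rightarrow> 'o" (infixr \<open>\<box>\<close> 75)
    and U A :: 'o and mA dA eA nA :: 'a and X :: 'o and m d e n :: 'a +
  fixes i p :: 'a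
  assumes hom_incl: "A.hom i A X"
    and incl_mult: "i \<diamond> mA = m \<diamond> (i \<star> i)" and incl_unit: "i \<diamond> eA = e"
    and retract_def: "p = A.bend X A A.copairing (X.pairing \<diamond> (idt X \<star> i))"
    and incl_dual: "A.bend A X X.copairing (A.pairing \<diamond> (idt A \<star> p)) = i"
    and retract_incl: "p \<diamond> i = idt A"
begin

text \<open>
  The inclusion \<open>i\<close> and the retraction \<open>p\<close> are adjoint to each other on both sides (\<open>P1\<close>, \<open>P2\<close>). As the pairing of
  \<open>A\<close> is nondegenerate, the adjoint of the multiplicativity of \<open>i\<close> is the linearity of \<open>p\<close> over \<open>A\<close>, on the right
  (\<open>M1\<close>) and on the left (\<open>M2\<close>).
\<close>

lemma expectation: "X.expectation (i \<diamond> p)"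
proof -
  note hom_def = A.hom_def and i = hom_incl and im = incl_mult and ie = incl_unit and pi = retract_incl
  have ph: "A.hom p X A"
    unfolding retract_def using A.hom_pairing X.hom_pairing i
    by (intro A.hom_bend[where X = A]) (simp_all add: hom_def)
  have P1: "A.pairing \<diamond> (p \<star> idt A) = X.pairing \<diamond> (idt X \<star> i)"
    unfolding retract_def using A.ev_bend[OF A.self_dual, of "X.pairing \<diamond> (idt X \<star> i)" X] i X.hom_pairing
    by (simp add: hom_def)
  have P2: "X.pairing \<diamond> (i \<star> idt X) = A.pairing \<diamond> (idt A \<star> p)"
    using A.ev_bend[OF X.self_dual, of "A.pairing \<diamond> (idt A \<star> p)" A] ph A.hom_pairing incl_dual
    by (simp add: hom_def)
  have M1: "p \<diamond> m \<diamond> (idt X \<star> i) = mA \<diamond> (p \<star> idt A)"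
  proof (rule A.dual_pair_cancel[OF A.self_dual])
    have "A.pairing \<diamond> ((p \<diamond> m \<diamond> (idt X \<star> i)) \<star> idt A)
        = (A.pairing \<diamond> (p \<star> idt A)) \<diamond> (m \<star> idt A) \<diamond> (idt X \<star> (i \<star> idt A))"
      using ph i A.hom_pairing X.homs by (simp add: hom_def A.layers)
    also have "\<dots> = X.pairing \<diamond> ((idt X \<star> i) \<diamond> (m \<star> idt A)) \<diamond> (idt X \<star> (i \<star> idt A))"
      unfolding P1 using i X.hom_pairing X.homs by (simp add: hom_def A.cmp_assoc)
    also have "(idt X \<star> i) \<diamond> (m \<star> idt A) = (m \<star> idt X) \<diamond> (idt X \<star> (idt X \<star> i))"
      using A.slide[of m i] i X.homs by (simp add: hom_def A.idt_tob A.tns_assoc)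
    also have "X.pairing \<diamond> ((m \<star> idt X) \<diamond> (idt X \<star> (idt X \<star> i))) \<diamond> (idt X \<star> (i \<star> idt A))
        = (X.pairing \<diamond> (m \<star> idt X)) \<diamond> (idt X \<star> (i \<star> i))"
      using i X.hom_pairing X.homs by (simp add: hom_def A.cmp_assoc A.interchange)
    also have "\<dots> = X.pairing \<diamond> (idt X \<star> (m \<diamond> (i \<star> i)))"
      unfolding X.pairing_assoc using i X.hom_pairing X.homs by (simp add: hom_def A.cmp_assoc A.tns_idt_cmp)
    also have "\<dots> = (X.pairing \<diamond> (idt X \<star> i)) \<diamond> (idt X \<star> mA)"
      unfolding im[symmetric] using i X.hom_pairing A.homs by (simp add: hom_def A.cmp_assoc A.tns_idt_cmp)
    also have "\<dots> = (A.pairing \<diamond> (idt A \<star> mA)) \<diamond> (p \<star> idt (A \<box> A))"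
      unfolding P1[symmetric] using ph A.hom_pairing A.homs A.slide[of p mA] by (simp add: hom_def A.cmp_assoc)
    also have "\<dots> = A.pairing \<diamond> ((mA \<diamond> (p \<star> idt A)) \<star> idt A)"
      unfolding A.pairing_assoc[symmetric] using ph A.hom_pairing A.homs by (simp add: hom_def A.layers)
    finally show "A.pairing \<diamond> ((p \<diamond> m \<diamond> (idt X \<star> i)) \<star> idt A) = A.pairing \<diamond> ((mA \<diamond> (p \<star> idt A)) \<star> idt A)" .
  qed (use ph i A.homs X.homs in \<open>simp_all add: hom_def\<close>)
  have M2: "p \<diamond> m \<diamond> (i \<star> idt X) = mA \<diamond> (idt A \<star> p)"
  proof (rule A.dual_pair_cancel_right[OF A.self_dual])
    have "A.pairing \<diamond> (idt A \<star> (p \<diamond> m \<diamond> (i \<star> idt X)))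
        = (A.pairing \<diamond> (idt A \<star> p)) \<diamond> (idt A \<star> (m \<diamond> (i \<star> idt X)))"
      using ph i A.hom_pairing X.homs by (simp add: hom_def A.cmp_assoc A.tns_idt_cmp)
    also have "\<dots> = (X.pairing \<diamond> (idt X \<star> m)) \<diamond> ((i \<star> i) \<star> idt X)"
      unfolding P2[symmetric] using i X.hom_pairing X.homs
      by (simp add: hom_def A.cmp_assoc A.interchange A.tns_assoc)
    also have "\<dots> = X.pairing \<diamond> ((m \<diamond> (i \<star> i)) \<star> idt X)"
      unfolding X.pairing_assoc[symmetric] using i X.hom_pairing X.homs by (simp add: hom_def A.cmp_assoc A.cmp_tns_idt)
    also have "\<dots> = (X.pairing \<diamond> (i \<star> idt X)) \<diamond> (mA \<star> idt X)"
      unfolding im[symmetric] using i X.hom_pairing A.homs by (simp add: hom_def A.cmp_assoc A.cmp_tns_idt)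
    also have "\<dots> = (A.pairing \<diamond> (mA \<star> idt A)) \<diamond> (idt (A \<box> A) \<star> p)"
      unfolding P2 using ph A.hom_pairing A.homs A.slide[of mA p] by (simp add: hom_def A.cmp_assoc)
    also have "\<dots> = A.pairing \<diamond> (idt A \<star> (mA \<diamond> (idt A \<star> p)))"
      unfolding A.pairing_assoc using ph A.hom_pairing A.homs by (simp add: hom_def A.layers)
    finally show "A.pairing \<diamond> (idt A \<star> (p \<diamond> m \<diamond> (i \<star> idt X))) = A.pairing \<diamond> (idt A \<star> (mA \<diamond> (idt A \<star> p)))" .
  qed (use ph i A.homs X.homs in \<open>simp_all add: hom_def\<close>)
  have "(i \<diamond> p) \<diamond> (i \<diamond> p) = i \<diamond> (p \<diamond> i) \<diamond> p" using i ph by (simp add: hom_def A.cmp_assoc)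
  then have idem: "(i \<diamond> p) \<diamond> (i \<diamond> p) = i \<diamond> p" unfolding pi using ph by (simp add: hom_def)
  have "(i \<diamond> p) \<diamond> (i \<diamond> eA) = i \<diamond> (p \<diamond> i) \<diamond> eA" using i ph A.homs by (simp add: hom_def A.cmp_assoc)
  then have unit: "(i \<diamond> p) \<diamond> e = e" unfolding pi ie[symmetric] using A.homs by (simp add: hom_def)
  have "(i \<diamond> p) \<diamond> m \<diamond> ((i \<diamond> p) \<star> idt X) = i \<diamond> (p \<diamond> m \<diamond> (i \<star> idt X)) \<diamond> (p \<star> idt X)"
    using i ph X.homs by (simp add: hom_def A.layers)
  also have "\<dots> = (i \<diamond> mA) \<diamond> (p \<star> p)"
    unfolding M2 using i ph A.homs by (simp add: hom_def A.cmp_assoc A.interchange)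
  also have "\<dots> = m \<diamond> ((i \<diamond> p) \<star> (i \<diamond> p))"
    unfolding im using i ph X.homs by (simp add: hom_def A.cmp_assoc A.interchange)
  finally have left: "(i \<diamond> p) \<diamond> m \<diamond> ((i \<diamond> p) \<star> idt X) = m \<diamond> ((i \<diamond> p) \<star> (i \<diamond> p))" .
  have "(i \<diamond> p) \<diamond> m \<diamond> (idt X \<star> (i \<diamond> p)) = i \<diamond> (p \<diamond> m \<diamond> (idt X \<star> i)) \<diamond> (idt X \<star> p)"
    using i ph X.homs by (simp add: hom_def A.layers)
  also have "\<dots> = (i \<diamond> mA) \<diamond> (p \<star> p)"
    unfolding M1 using i ph A.homs by (simp add: hom_def A.cmp_assoc A.interchange)
  also have "\<dots> = m \<diamond> ((i \<diamond> p) \<star> (i \<diamond> p))"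
    unfolding im using i ph X.homs by (simp add: hom_def A.cmp_assoc A.interchange)
  finally have right: "(i \<diamond> p) \<diamond> m \<diamond> (idt X \<star> (i \<diamond> p)) = m \<diamond> ((i \<diamond> p) \<star> (i \<diamond> p))" .
  have "X.pairing \<diamond> ((i \<diamond> p) \<star> idt X) = (X.pairing \<diamond> (i \<star> idt X)) \<diamond> (p \<star> idt X)"
    using i ph X.hom_pairing by (simp add: hom_def A.layers)
  also have "\<dots> = (A.pairing \<diamond> (p \<star> idt A)) \<diamond> (idt X \<star> p)"
    unfolding P2 using ph A.hom_pairing by (simp add: hom_def A.cmp_assoc A.interchange)
  also have "\<dots> = X.pairing \<diamond> (idt X \<star> (i \<diamond> p))"
    unfolding P1 using i ph X.hom_pairing by (simp add: hom_def A.layers)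
  finally have adj: "X.pairing \<diamond> ((i \<diamond> p) \<star> idt X) = X.pairing \<diamond> (idt X \<star> (i \<diamond> p))" .
  show ?thesis
    unfolding X.expectation_def using i ph idem unit left right adj by (simp add: hom_def)
qed

end

section \<open>Morphisms of a strict monoidal category as typed arrows\<close>

text \<open>
  Hom-sets may overlap, so a morphism does not determine its domain and codomain; a typed arrow records
  them.
\<close>

type_synonym ('o, 'm) typed = "'o \<times> 'm \<times> 'o"

abbreviation tcod :: "('o, 'm) typed \<Rightarrow> 'o" where "tcod t \<equiv> snd (snd t)"

definition tarr :: "('o, 'm) tcat \<Rightarrow> ('o, 'm) typed \<Rightarrow> bool"
  where "tarr C t \<longleftrightarrow> fst (snd t) \<in> Arr C (fst t) (tcod t)"

definition tcmp :: "('o, 'm) tcat \<Rightarrow> ('o, 'm) typed \<Rightarrow> ('o, 'm) typed \<Rightarrow> ('o, 'm) typed"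
  where "tcmp C g f = (fst f, fst (snd g) \<cdot>\<^bsub>C\<^esub> fst (snd f), tcod g)"

definition ttns :: "('o, 'm) tcat \<Rightarrow> ('o, 'm) typed \<Rightarrow> ('o, 'm) typed \<Rightarrow> ('o, 'm) typed"
  where "ttns C f g =
    (fst f \<otimes>\<^sub>O\<^bsub>C\<^esub> fst g, fst (snd f) \<otimes>\<^sub>A\<^bsub>C\<^esub> fst (snd g), tcod f \<otimes>\<^sub>O\<^bsub>C\<^esub> tcod g)"

definition tidt :: "('o, 'm) tcat \<Rightarrow> 'o \<Rightarrow> ('o, 'm) typed"
  where "tidt C X = (X, \<i>\<d>\<^bsub>C\<^esub> X, X)"

lemmas typed_defs = tcmp_def ttns_def tidt_def

sublocale strict_monoidal_category \<subseteq>
  T: strict_monoidal_arrows fst tcod "tarr C" "tcmp C" "ttns C" "tidt C" "tens_ob C" "unit_ob C"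
proof
  fix f g f' g' h :: "'a \<times> 'b \<times> 'a" and X Y Z :: 'a
  show "(X \<otimes>\<^sub>O Y) \<otimes>\<^sub>O Z = X \<otimes>\<^sub>O Y \<otimes>\<^sub>O Z" by (rule tens_ob_assoc)
  show "\<I> \<otimes>\<^sub>O X = X" by (rule tens_ob_unit_left)
  show "X \<otimes>\<^sub>O \<I> = X" by (rule tens_ob_unit_right)
  show "tarr C (tcmp C g f)" if "tarr C g" "tarr C f" "tcod f = fst g"
    using that comp_closed by (auto simp: tarr_def tcmp_def)
  show "tarr C (ttns C f g)" if "tarr C f" "tarr C g"
    using that tens_closed by (auto simp: tarr_def ttns_def)
  show "tarr C (tidt C X)" by (simp add: tarr_def tidt_def id_closed)
  show "tcmp C (tcmp C h g) f = tcmp C h (tcmp C g f)"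
    if "tarr C h" "tarr C g" "tarr C f" "tcod g = fst h" "tcod f = fst g"
    using that comp_assoc by (auto simp: tarr_def tcmp_def)
  show "tcmp C (tidt C X) f = f" if "tarr C f" "tcod f = X"
    using that id_left by (auto simp: tarr_def typed_defs prod_eq_iff)
  show "tcmp C f (tidt C X) = f" if "tarr C f" "fst f = X"
    using that id_right by (auto simp: tarr_def typed_defs prod_eq_iff)
  show "ttns C (ttns C f g) h = ttns C f (ttns C g h)" if "tarr C f" "tarr C g" "tarr C h"
    using that tens_assoc by (auto simp: tarr_def ttns_def tens_ob_assoc)
  show "ttns C (tidt C \<I>) f = f" if "tarr C f"
    using that tens_unit_left by (auto simp: tarr_def typed_defs prod_eq_iff tens_ob_unit_left)
  show "ttns C f (tidt C \<I>) = f" if "tarr C f"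
    using that tens_unit_right by (auto simp: tarr_def typed_defs prod_eq_iff tens_ob_unit_right)
  show "tidt C (X \<otimes>\<^sub>O Y) = ttns C (tidt C X) (tidt C Y)"
    by (simp add: typed_defs tens_id)
  show "tcmp C (ttns C f' g') (ttns C f g) = ttns C (tcmp C f' f) (tcmp C g' g)"
    if "tarr C f" "tarr C f'" "tarr C g" "tarr C g'" "tcod f = fst f'" "tcod g = fst g'"
    using that tens_comp by (auto simp: tarr_def typed_defs)
qed (simp_all add: typed_defs)

context strict_monoidal_category
begin

lemma hom_typed [simp]: "T.hom (X, f, Y) X' Y' \<longleftrightarrow> X = X' \<and> Y = Y' \<and> f \<in> Arr C X' Y'"
  by (auto simp: T.hom_def tarr_def)

lemma left_dual_pair:
  assumes "left_dual C X E"
  shows "T.dual_pair X (dual_ob E) (dual_ob E \<otimes>\<^sub>O X, ev E, \<I>) (\<I>, coev E, X \<otimes>\<^sub>O dual_ob E)"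
  using assms by (simp add: T.dual_pair_def left_dual_def typed_defs tens_ob_unit_left tens_ob_unit_right)

lemma dual_arr_bend:
  assumes "f \<in> Arr C X Y" "ev E \<in> Arr C (dual_ob E \<otimes>\<^sub>O Y) \<I>" "coev D \<in> Arr C \<I> (X \<otimes>\<^sub>O dual_ob D)"
  shows "(dual_ob E, dual_arr C D E f, dual_ob D) =
    T.bend (dual_ob E) (dual_ob D) (\<I>, coev D, X \<otimes>\<^sub>O dual_ob D)
      (tcmp C (dual_ob E \<otimes>\<^sub>O Y, ev E, \<I>) (ttns C (tidt C (dual_ob E)) (X, f, Y)))"
proof -
  let ?f = "(X, f, Y)" and ?e = "(dual_ob E \<otimes>\<^sub>O Y, ev E, \<I>)" and ?c = "(\<I>, coev D, X \<otimes>\<^sub>O dual_ob D)"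
  have t: "tarr C ?f" "tarr C ?e" "tarr C ?c" using assms by (simp_all add: tarr_def)
  have "T.bend (dual_ob E) (dual_ob D) ?c (tcmp C ?e (ttns C (tidt C (dual_ob E)) ?f))
    = tcmp C (ttns C ?e (tidt C (dual_ob D)))
        (tcmp C (ttns C (tidt C (dual_ob E)) (ttns C ?f (tidt C (dual_ob D))))
          (ttns C (tidt C (dual_ob E)) ?c))"
    using t by (simp add: T.bend_def T.layers)
  also have "\<dots> = (dual_ob E, dual_arr C D E f, dual_ob D)"
    by (simp add: dual_arr_def typed_defs tens_ob_unit_left tens_ob_unit_right)
  finally show ?thesis by simp
qed

end

section \<open>Images and split idempotents in abelian categories\<close>

context linear_category
begin

sublocale hom: vectorspace class_ring "Hom C X Y" for X Y
  by (rule hom_vectorspace)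

lemma zero_comp:
  assumes "f \<in> Arr C X Y"
  shows "\<zero>\<^bsub>Hom C Y Z\<^esub> \<cdot> f = \<zero>\<^bsub>Hom C X Z\<^esub>"
proof -
  have "(\<zero>\<^bsub>Hom C Y Z\<^esub> \<cdot> f) \<oplus>\<^bsub>Hom C X Z\<^esub> (\<zero>\<^bsub>Hom C Y Z\<^esub> \<cdot> f) = \<zero>\<^bsub>Hom C Y Z\<^esub> \<cdot> f"
    using comp_add_left[of "\<zero>\<^bsub>Hom C Y Z\<^esub>" Y Z "\<zero>\<^bsub>Hom C Y Z\<^esub>" f X] assms by simp
  moreover have "\<zero>\<^bsub>Hom C Y Z\<^esub> \<cdot> f \<in> Arr C X Z" using assms by (intro comp_closed) auto
  ultimately show ?thesis by simp
qed

lemma comp_zero: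
  assumes "g \<in> Arr C Y Z"
  shows "g \<cdot> \<zero>\<^bsub>Hom C X Y\<^esub> = \<zero>\<^bsub>Hom C X Z\<^esub>"
proof -
  have "(g \<cdot> \<zero>\<^bsub>Hom C X Y\<^esub>) \<oplus>\<^bsub>Hom C X Z\<^esub> (g \<cdot> \<zero>\<^bsub>Hom C X Y\<^esub>) = g \<cdot> \<zero>\<^bsub>Hom C X Y\<^esub>"
    using comp_add_right[of g Y Z "\<zero>\<^bsub>Hom C X Y\<^esub>" X "\<zero>\<^bsub>Hom C X Y\<^esub>"] assms by simp
  moreover have "g \<cdot> \<zero>\<^bsub>Hom C X Y\<^esub> \<in> Arr C X Z" using assms by (intro comp_closed) auto
  ultimately show ?thesis by simp
qed

lemma comp_diff_left:
  assumes "g \<in> Arr C Y Z" "g' \<in> Arr C Y Z" "f \<in> Arr C X Y"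
  shows "(g \<ominus>\<^bsub>Hom C Y Z\<^esub> g') \<cdot> f = (g \<cdot> f) \<ominus>\<^bsub>Hom C X Z\<^esub> (g' \<cdot> f)"
proof -
  let ?d = "g \<ominus>\<^bsub>Hom C Y Z\<^esub> g'"
  have d: "?d \<in> Arr C Y Z" using assms by simp
  have "?d \<oplus>\<^bsub>Hom C Y Z\<^esub> g' = g"
    using assms by (simp add: hom.M.minus_eq hom.M.a_assoc hom.M.l_neg)
  then have "(?d \<cdot> f) \<oplus>\<^bsub>Hom C X Z\<^esub> (g' \<cdot> f) = g \<cdot> f"
    using comp_add_left[OF d assms(2,3)] by simp
  moreover have "?d \<cdot> f \<in> Arr C X Z" "g' \<cdot> f \<in> Arr C X Z" "g \<cdot> f \<in> Arr C X Z"
    using d assms comp_closed by blast+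
  ultimately show ?thesis
    by (metis hom.M.minus_eq hom.M.a_assoc hom.M.r_neg hom.M.r_zero hom.M.a_inv_closed)
qed

end

context abelian_linear_category
begin

text \<open>
  The image is the kernel of the cokernel \<open>q\<close> of \<open>f\<close>. To see that \<open>g\<close> is epic, let \<open>w\<close> vanish on \<open>g\<close>. The kernel
  \<open>l\<close> of \<open>w\<close> is then a subobject of the image through which \<open>f\<close> factors. As a monomorphism, \<open>i l\<close> is the kernel of
  some \<open>h\<close>, which vanishes on \<open>f\<close>, hence factors through \<open>q\<close> and vanishes on \<open>i\<close>. So \<open>l\<close> is an isomorphism and
  \<open>w = 0\<close>.
\<close>

lemma image_factorization:
  assumes f: "f \<in> Arr C X Y"
  obtains I i g where "monic C I Y i" "epic C X I g" "i \<cdot> g = f"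
proof -
  obtain Q q where q: "is_cokernel C X Y f Q q" using ex_cokernel[OF f] by blast
  have qY: "q \<in> Arr C Y Q" and qf: "q \<cdot> f = \<zero>\<^bsub>Hom C X Q\<^esub>"
    and q_univ: "\<And>W g. \<lbrakk>g \<in> Arr C Y W; g \<cdot> f = \<zero>\<^bsub>Hom C X W\<^esub>\<rbrakk> \<Longrightarrow> \<exists>!h. h \<in> Arr C Q W \<and> h \<cdot> q = g"
    using q by (auto simp: is_cokernel_def)
  obtain I i where i: "is_kernel C Y Q q I i" using ex_kernel[OF qY] by blast
  have iI: "i \<in> Arr C I Y" and qi: "q \<cdot> i = \<zero>\<^bsub>Hom C I Q\<^esub>"
    and i_univ: "\<And>W g. \<lbrakk>g \<in> Arr C W Y; q \<cdot> g = \<zero>\<^bsub>Hom C W Q\<^esub>\<rbrakk> \<Longrightarrow> \<exists>!h. h \<in> Arr C W I \<and> i \<cdot> h = g"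
    using i by (auto simp: is_kernel_def)
  have i_monic: "monic C I Y i"
    unfolding monic_def
  proof (intro conjI allI ballI impI iI)
    fix W g h assume gh: "g \<in> Arr C W I" "h \<in> Arr C W I" "i \<cdot> g = i \<cdot> h"
    have "q \<cdot> (i \<cdot> g) = \<zero>\<^bsub>Hom C W Q\<^esub>"
      using comp_assoc[OF qY iI gh(1)] qi zero_comp[OF gh(1)] by simp
    then show "g = h" using i_univ[of "i \<cdot> g" W] gh comp_closed[OF iI gh(1)] by metis
  qed
  obtain g where g: "g \<in> Arr C X I" "i \<cdot> g = f" using i_univ[OF f qf] by blast
  have "epic C X I g"
    unfolding epic_def
  proof (intro conjI allI ballI impI g(1))
    fix W u v assume uv: "u \<in> Arr C I W" "v \<in> Arr C I W" "u \<cdot> g = v \<cdot> g"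
    let ?w = "u \<ominus>\<^bsub>Hom C I W\<^esub> v"
    have w: "?w \<in> Arr C I W" using uv by simp
    have wg: "?w \<cdot> g = \<zero>\<^bsub>Hom C X W\<^esub>"
      using comp_diff_left[OF uv(1,2) g(1)] uv comp_closed[OF uv(2) g(1)]
      by (simp add: hom.M.minus_eq hom.M.r_neg)
    obtain L l where l: "is_kernel C I W ?w L l" using ex_kernel[OF w] by blast
    have lL: "l \<in> Arr C L I" and wl: "?w \<cdot> l = \<zero>\<^bsub>Hom C L W\<^esub>"
      and l_univ: "\<And>V h. \<lbrakk>h \<in> Arr C V I; ?w \<cdot> h = \<zero>\<^bsub>Hom C V W\<^esub>\<rbrakk> \<Longrightarrow> \<exists>!k. k \<in> Arr C V L \<and> l \<cdot> k = h"
      using l by (auto simp: is_kernel_def)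
    obtain g' where g': "g' \<in> Arr C X L" "l \<cdot> g' = g" using l_univ[OF g(1) wg] by blast
    have il: "i \<cdot> l \<in> Arr C L Y" using comp_closed[OF iI lL] .
    have "monic C L Y (i \<cdot> l)"
      unfolding monic_def
    proof (intro conjI allI ballI impI il)
      fix V a b assume ab: "a \<in> Arr C V L" "b \<in> Arr C V L" "(i \<cdot> l) \<cdot> a = (i \<cdot> l) \<cdot> b"
      have "i \<cdot> (l \<cdot> a) = i \<cdot> (l \<cdot> b)"
        using ab comp_assoc[OF iI lL] by simp
      moreover have "l \<cdot> a \<in> Arr C V I" "l \<cdot> b \<in> Arr C V I"
        using comp_closed[OF lL] ab by blast+
      ultimately have "l \<cdot> a = l \<cdot> b"
        using i_monic by (simp add: monic_def)
      moreover have "?w \<cdot> (l \<cdot> a) = \<zero>\<^bsub>Hom C V W\<^esub>"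
        using comp_assoc[OF w lL ab(1)] wl zero_comp[OF ab(1)] by simp
      ultimately show "a = b"
        using l_univ[of "l \<cdot> a" V] comp_closed[OF lL ab(1)] ab by metis
    qed
    then obtain Z h where h: "is_kernel C Y Z h L (i \<cdot> l)" using monic_is_kernel by blast
    have hY: "h \<in> Arr C Y Z" and hil: "h \<cdot> (i \<cdot> l) = \<zero>\<^bsub>Hom C L Z\<^esub>"
      and h_univ: "\<And>V k. \<lbrakk>k \<in> Arr C V Y; h \<cdot> k = \<zero>\<^bsub>Hom C V Z\<^esub>\<rbrakk> \<Longrightarrow>
        \<exists>!s. s \<in> Arr C V L \<and> (i \<cdot> l) \<cdot> s = k"
      using h by (auto simp: is_kernel_def)
    have "f = (i \<cdot> l) \<cdot> g'" using g g' comp_assoc[OF iI lL g'(1)] by simp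
    then have "h \<cdot> f = \<zero>\<^bsub>Hom C X Z\<^esub>"
      using comp_assoc[OF hY il g'(1)] hil zero_comp[OF g'(1)] by simp
    then obtain h' where h': "h' \<in> Arr C Q Z" "h' \<cdot> q = h" using q_univ[OF hY] by blast
    have "h \<cdot> i = \<zero>\<^bsub>Hom C I Z\<^esub>"
      using comp_assoc[OF h'(1) qY iI] h' qi comp_zero[OF h'(1)] by simp
    then obtain s where s: "s \<in> Arr C I L" "(i \<cdot> l) \<cdot> s = i" using h_univ[OF iI] by blast
    have "i \<cdot> (l \<cdot> s) = i \<cdot> \<i>\<d> I" using s comp_assoc[OF iI lL s(1)] id_right[OF iI] by simp
    then have "l \<cdot> s = \<i>\<d> I"
      using i_monic comp_closed[OF lL s(1)] id_closed by (auto simp: monic_def)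
    then have "?w = (?w \<cdot> l) \<cdot> s" using comp_assoc[OF w lL s(1)] id_right[OF w] by simp
    then have "?w = \<zero>\<^bsub>Hom C I W\<^esub>" using wl zero_comp[OF s(1)] by simp
    then show "u = v" using uv by simp
  qed
  then show thesis using that i_monic g(2) by blast
qed

text \<open>
  The range of \<open>f\<close> is the kernel of \<open>1 - f\<close>.
\<close>

lemma split_idempotent:
  assumes f: "f \<in> Arr C X X" "f \<cdot> f = f"
  obtains k K p where "k \<in> Arr C K X" "p \<in> Arr C X K" "k \<cdot> p = f" "p \<cdot> k = \<i>\<d> K"
proof -
  let ?w = "\<i>\<d> X \<ominus>\<^bsub>Hom C X X\<^esub> f"
  have w: "?w \<in> Arr C X X" using f id_closed by simp
  obtain K k where k: "is_kernel C X X ?w K k" using ex_kernel[OF w] by blast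
  have kK: "k \<in> Arr C K X" and wk: "?w \<cdot> k = \<zero>\<^bsub>Hom C K X\<^esub>"
    and univ: "\<And>V h. \<lbrakk>h \<in> Arr C V X; ?w \<cdot> h = \<zero>\<^bsub>Hom C V X\<^esub>\<rbrakk> \<Longrightarrow> \<exists>!s. s \<in> Arr C V K \<and> k \<cdot> s = h"
    using k by (auto simp: is_kernel_def)
  have "k \<ominus>\<^bsub>Hom C K X\<^esub> (f \<cdot> k) = \<zero>\<^bsub>Hom C K X\<^esub>"
    using comp_diff_left[OF id_closed f(1) kK] id_left[OF kK] wk by simp
  then have fk: "f \<cdot> k = k" using kK comp_closed[OF f(1) kK] by simp
  have "?w \<cdot> f = \<zero>\<^bsub>Hom C X X\<^esub>"
    using comp_diff_left[OF id_closed f(1) f(1)] id_left[OF f(1)] f by (simp add: hom.M.minus_eq hom.M.r_neg)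
  then obtain p where p: "p \<in> Arr C X K" "k \<cdot> p = f" using univ[OF f(1)] by blast
  have "k \<cdot> (p \<cdot> k) = k" using comp_assoc[OF kK p(1) kK] p(2) fk by simp
  then have "p \<cdot> k = \<i>\<d> K"
    using univ[OF kK wk] comp_closed[OF p(1) kK] id_closed[of K] id_right[OF kK] by metis
  then show thesis using that kK p by blast
qed

end

section \<open>Traces in a positive tensor category\<close>

context tensor_category
begin

text \<open>
  The identification of \<open>End 1\<close> with the complex numbers.
\<close>

definition scal :: "'b \<Rightarrow> complex"
  where "scal s = (THE c. c \<odot>\<^bsub>Hom C \<I> \<I>\<^esub> \<i>\<d> \<I> = s)"

lemma scal_unique: "c \<odot>\<^bsub>Hom C \<I> \<I>\<^esub> \<i>\<d> \<I> = c' \<odot>\<^bsub>Hom C \<I> \<I>\<^esub> \<i>\<d> \<I> \<Longrightarrow> c = c'"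
  using end_unit by (auto simp: bij_betw_def inj_on_def)

lemma scal_smult_id [simp]: "scal (c \<odot>\<^bsub>Hom C \<I> \<I>\<^esub> \<i>\<d> \<I>) = c"
  unfolding scal_def using scal_unique by blast

lemma scal_eq:
  assumes "s \<in> Arr C \<I> \<I>"
  shows "s = scal s \<odot>\<^bsub>Hom C \<I> \<I>\<^esub> \<i>\<d> \<I>"
proof -
  have "s \<in> (\<lambda>c. c \<odot>\<^bsub>Hom C \<I> \<I>\<^esub> \<i>\<d> \<I>) ` UNIV"
    unfolding bij_betw_imp_surj_on[OF end_unit] by (rule assms)
  then obtain c where "s = c \<odot>\<^bsub>Hom C \<I> \<I>\<^esub> \<i>\<d> \<I>" by blast
  then show ?thesis by simp
qed

lemma smult_closed: "f \<in> Arr C X Y \<Longrightarrow> c \<odot>\<^bsub>Hom C X Y\<^esub> f \<in> Arr C X Y"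
  using hom.smult_closed[of c f X Y] by simp

lemma smult_smult: "f \<in> Arr C X Y \<Longrightarrow> c \<odot>\<^bsub>Hom C X Y\<^esub> (c' \<odot>\<^bsub>Hom C X Y\<^esub> f) = (c * c') \<odot>\<^bsub>Hom C X Y\<^esub> f"
  using hom.smult_assoc1[of c c' f X Y] by simp

lemma smult_one: "f \<in> Arr C X Y \<Longrightarrow> 1 \<odot>\<^bsub>Hom C X Y\<^esub> f = f"
  using hom.smult_one[of f X Y] by simp

lemma smult_zero_left: "f \<in> Arr C X Y \<Longrightarrow> 0 \<odot>\<^bsub>Hom C X Y\<^esub> f = \<zero>\<^bsub>Hom C X Y\<^esub>"
  using hom.smult_l_null[of f X Y] by simp

lemma scal_add: "\<lbrakk>s \<in> Arr C \<I> \<I>; t \<in> Arr C \<I> \<I>\<rbrakk> \<Longrightarrow> scal (s \<oplus>\<^bsub>Hom C \<I> \<I>\<^esub> t) = scal s + scal t"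
proof -
  assume s: "s \<in> Arr C \<I> \<I>" "t \<in> Arr C \<I> \<I>"
  have "s \<oplus>\<^bsub>Hom C \<I> \<I>\<^esub> t = (scal s + scal t) \<odot>\<^bsub>Hom C \<I> \<I>\<^esub> \<i>\<d> \<I>"
    using hom.smult_l_distr[of "scal s" "scal t" "\<i>\<d> \<I>" \<I> \<I>] id_closed scal_eq[OF s(1)] scal_eq[OF s(2)] by simp
  then show ?thesis by simp
qed

lemma scal_smult: "s \<in> Arr C \<I> \<I> \<Longrightarrow> scal (c \<odot>\<^bsub>Hom C \<I> \<I>\<^esub> s) = c * scal s"
  using smult_smult[of "\<i>\<d> \<I>" \<I> \<I> c "scal s"] id_closed scal_eq[of s] scal_smult_id by metis

lemma scal_comp:
  assumes "s \<in> Arr C \<I> \<I>" "t \<in> Arr C \<I> \<I>"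
  shows "scal (s \<cdot> t) = scal s * scal t"
proof -
  have "s \<cdot> t = scal s \<odot>\<^bsub>Hom C \<I> \<I>\<^esub> (\<i>\<d> \<I> \<cdot> t)"
    using comp_smult_left[OF id_closed assms(2), of "scal s"] scal_eq[OF assms(1)] by simp
  then show ?thesis using assms id_left scal_smult by simp
qed

lemma scalar_tens:
  assumes "s \<in> Arr C \<I> \<I>" "f \<in> Arr C X Y"
  shows "s \<otimes>\<^sub>A f = scal s \<odot>\<^bsub>Hom C X Y\<^esub> f" "f \<otimes>\<^sub>A s = scal s \<odot>\<^bsub>Hom C X Y\<^esub> f"
proof -
  have "(scal s \<odot>\<^bsub>Hom C \<I> \<I>\<^esub> \<i>\<d> \<I>) \<otimes>\<^sub>A f = scal s \<odot>\<^bsub>Hom C X Y\<^esub> f"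
    using tens_smult_left[OF id_closed[of "\<I>"] assms(2), of "scal s"] tens_unit_left[OF assms(2)]
    by (simp add: tens_ob_unit_left)
  then show "s \<otimes>\<^sub>A f = scal s \<odot>\<^bsub>Hom C X Y\<^esub> f" using scal_eq[OF assms(1)] by simp
  have "f \<otimes>\<^sub>A (scal s \<odot>\<^bsub>Hom C \<I> \<I>\<^esub> \<i>\<d> \<I>) = scal s \<odot>\<^bsub>Hom C X Y\<^esub> f"
    using tens_smult_right[OF assms(2) id_closed[of "\<I>"], of "scal s"] tens_unit_right[OF assms(2)]
    by (simp add: tens_ob_unit_right)
  then show "f \<otimes>\<^sub>A s = scal s \<odot>\<^bsub>Hom C X Y\<^esub> f" using scal_eq[OF assms(1)] by simp
qed

text \<open>
  Composition takes the place of the multiplicative fields of the record of a Hom-space.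
\<close>

definition end_algebra :: "'a \<Rightarrow> (complex, 'b) module"
  where "end_algebra X = (Hom C X X)\<lparr>mult := Comp C, one := \<i>\<d> X\<rparr>"

lemma end_algebra_simps [simp]:
  "carrier (end_algebra X) = Arr C X X" "mult (end_algebra X) = Comp C"
  "one (end_algebra X) = \<i>\<d> X" "zero (end_algebra X) = \<zero>\<^bsub>Hom C X X\<^esub>"
  "add (end_algebra X) = add (Hom C X X)" "smult (end_algebra X) = smult (Hom C X X)"
  by (simp_all add: end_algebra_def)

lemma end_algebra_finite_dim: "finite_dim_algebra (end_algebra X)"
proof -
  have "abelian_group (Hom C X X)" by (rule hom.abelian_group_axioms)
  then have ag: "abelian_group (end_algebra X)"
    by (simp add: abelian_group_def abelian_group_axioms_def abelian_monoid_def)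
  have module: "module class_ring (end_algebra X)"
    using hom.module_axioms[of X X] ag by (simp add: Module.module_def Module.module_axioms_def)
  then have vs: "vectorspace class_ring (end_algebra X)"
    using hom.field_axioms by (simp add: vectorspace_def)
  have ring: "ring (end_algebra X)"
  proof (rule ring.intro[OF ag])
    show "monoid (end_algebra X)"
      by (rule monoid.intro) (auto simp: comp_closed id_closed comp_assoc id_left id_right)
    show "ring_axioms (end_algebra X)"
      by (rule ring_axioms.intro) (auto simp: comp_add_left comp_add_right)
  qed
  have finsum: "finsum (end_algebra X) = finsum (Hom C X X)"
    by (intro ext) (simp add: finsum_def)
  have lincomb: "module.lincomb (end_algebra X) = module.lincomb (Hom C X X)"
    by (intro ext) (simp add: module.lincomb_def[OF module] module.lincomb_def[OF hom.module_axioms] finsum)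
  have span: "LinearCombinations.module.span class_ring (end_algebra X) S
      = LinearCombinations.module.span class_ring (Hom C X X) S" for S
    unfolding LinearCombinations.module.span_def[OF module]
      LinearCombinations.module.span_def[OF hom.module_axioms[of X X]] lincomb ..
  have "vectorspace.fin_dim class_ring (end_algebra X)"
    using hom_fin_dim[of X X]
    unfolding vectorspace.fin_dim_def[OF vs] vectorspace.fin_dim_def[OF hom_vectorspace[of X X]] span
    by simp
  then show ?thesis
    using ring vs
    by (simp add: finite_dim_algebra_def finite_dim_algebra_axioms_def comp_smult_left comp_smult_right)
qed

end

text \<open>
  Positivity enters the proof as the nonvanishing of the dimensions of nonzero objects.
\<close>

locale positive_tensor_category = tensor_category +
  fixes D :: "'a \<Rightarrow> ('a, 'b) dual" and \<phi> :: "'a \<Rightarrow> 'b"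
  assumes left_duals: "left_dual C X (D X)"
    and pivotal: "pivotal_structure C D \<phi>"
    and dim_nonzero: "\<not> zero_ob C Y \<Longrightarrow> scal (pivotal_dim C D \<phi> Y) \<noteq> 0"
begin

abbreviation dual_of :: "'a \<Rightarrow> 'a" where "dual_of X \<equiv> dual_ob (D X)"

abbreviation ev_of :: "'a \<Rightarrow> ('a, 'b) typed" where "ev_of X \<equiv> (dual_of X \<otimes>\<^sub>O X, ev (D X), \<I>)"

abbreviation coev_of :: "'a \<Rightarrow> ('a, 'b) typed" where "coev_of X \<equiv> (\<I>, coev (D X), X \<otimes>\<^sub>O dual_of X)"

abbreviation piv :: "'a \<Rightarrow> ('a, 'b) typed" where "piv X \<equiv> (X, \<phi> X, dual_of (dual_of X))"

lemma dual_of_pair: "T.dual_pair X (dual_of X) (ev_of X) (coev_of X)"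
  by (rule left_dual_pair[OF left_duals])

lemma ev_closed: "ev (D X) \<in> Arr C (dual_of X \<otimes>\<^sub>O X) \<I>"
  and coev_closed: "coev (D X) \<in> Arr C \<I> (X \<otimes>\<^sub>O dual_of X)"
  using left_duals[of X] by (simp_all add: left_dual_def)

lemma piv_closed: "\<phi> X \<in> Arr C X (dual_of (dual_of X))"
  using pivotal by (simp add: pivotal_structure_def isomorphism_def bidual_ob_def)

lemma piv_natural:
  assumes f: "f \<in> Arr C X Y"
  shows "tcmp C (T.bend (dual_of (dual_of X)) (dual_of (dual_of Y)) (coev_of (dual_of Y))
      (tcmp C (ev_of (dual_of X)) (ttns C (tidt C (dual_of (dual_of X)))
        (T.bend (dual_of Y) (dual_of X) (coev_of X)
          (tcmp C (ev_of Y) (ttns C (tidt C (dual_of Y)) (X, f, Y))))))) (piv X)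
    = tcmp C (piv Y) (X, f, Y)"
proof -
  let ?f = "dual_arr C (D X) (D Y) f"
  have b: "T.bend (dual_of Y) (dual_of X) (coev_of X) (tcmp C (ev_of Y) (ttns C (tidt C (dual_of Y)) (X, f, Y)))
      = (dual_of Y, ?f, dual_of X)"
    by (rule dual_arr_bend[OF f ev_closed coev_closed, symmetric])
  have "T.hom (dual_of Y, ?f, dual_of X) (dual_of Y) (dual_of X)"
    unfolding b[symmetric]
  proof (rule T.hom_bend[where X = X])
    show "T.hom (coev_of X) \<I> (X \<otimes>\<^sub>O dual_of X)" by (simp add: coev_closed)
    have "T.hom (ev_of Y) (dual_of Y \<otimes>\<^sub>O Y) \<I>" "T.hom (X, f, Y) X Y" by (simp_all add: ev_closed f)
    then show "T.hom (tcmp C (ev_of Y) (ttns C (tidt C (dual_of Y)) (X, f, Y))) (dual_of Y \<otimes>\<^sub>O X) \<I>"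
      by (simp add: T.hom_def del: hom_typed)
  qed
  then have f': "?f \<in> Arr C (dual_of Y) (dual_of X)" by simp
  have "bidual_arr C D X Y f \<cdot> \<phi> X = \<phi> Y \<cdot> f"
    using pivotal f by (simp add: pivotal_structure_def)
  moreover have "T.bend (dual_of (dual_of X)) (dual_of (dual_of Y)) (coev_of (dual_of Y))
      (tcmp C (ev_of (dual_of X)) (ttns C (tidt C (dual_of (dual_of X))) (dual_of Y, ?f, dual_of X)))
    = (dual_of (dual_of X), bidual_arr C D X Y f, dual_of (dual_of Y))"
    unfolding bidual_arr_def by (rule dual_arr_bend[OF f' ev_closed coev_closed, symmetric])
  ultimately show ?thesis unfolding b by (simp add: tcmp_def)
qed

definition trace :: "'a \<Rightarrow> 'b \<Rightarrow> complex"
  where "trace X f =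
    scal (ev (D (dual_of X)) \<cdot> ((\<phi> X \<cdot> f) \<otimes>\<^sub>A \<i>\<d> (dual_of X)) \<cdot> coev (D X))"

lemma typed_trace:
  "tcmp C (ev_of (dual_of X)) (tcmp C (ttns C (tcmp C (piv X) (X, f, X)) (tidt C (dual_of X))) (coev_of X))
    = (\<I>, ev (D (dual_of X)) \<cdot> ((\<phi> X \<cdot> f) \<otimes>\<^sub>A \<i>\<d> (dual_of X)) \<cdot> coev (D X), \<I>)"
  by (simp add: typed_defs)

lemma trace_arrow_closed:
  assumes "f \<in> Arr C X X"
  shows "ev (D (dual_of X)) \<cdot> ((\<phi> X \<cdot> f) \<otimes>\<^sub>A \<i>\<d> (dual_of X)) \<cdot> coev (D X) \<in> Arr C \<I> \<I>"
proof -
  have "\<phi> X \<cdot> f \<in> Arr C X (dual_of (dual_of X))" by (rule comp_closed[OF piv_closed assms])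
  from comp_closed[OF tens_closed[OF this id_closed] coev_closed]
  show ?thesis by (rule comp_closed[OF ev_closed])
qed

lemma trace_cyclic:
  assumes f: "f \<in> Arr C X Y" and g: "g \<in> Arr C Y X"
  shows "trace Y (f \<cdot> g) = trace X (g \<cdot> f)"
proof -
  note h = ev_closed coev_closed piv_closed
  have "tcmp C (ev_of (dual_of Y)) (tcmp C (ttns C (tcmp C (piv Y) (tcmp C (X, f, Y) (Y, g, X))) (tidt C (dual_of Y))) (coev_of Y))
    = tcmp C (ev_of (dual_of X)) (tcmp C (ttns C (tcmp C (piv X) (tcmp C (Y, g, X) (X, f, Y))) (tidt C (dual_of X))) (coev_of X))"
    by (rule T.trace_cyclic[OF _ _ _ dual_of_pair dual_of_pair _ _ _ piv_natural[OF f]])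
      (use h f g in simp_all)
  then show ?thesis by (simp add: trace_def typed_defs)
qed

lemma trace_additive:
  assumes f: "f \<in> Arr C X X" and g: "g \<in> Arr C X X"
  shows "trace X (f \<oplus>\<^bsub>Hom C X X\<^esub> g) = trace X f + trace X g"
proof -
  let ?X = "dual_of X" and ?P = "dual_of (dual_of X)"
  have c: "\<phi> X \<cdot> f \<in> Arr C X ?P" "\<phi> X \<cdot> g \<in> Arr C X ?P"
    using piv_closed f g comp_closed by blast+
  have t: "(\<phi> X \<cdot> f) \<otimes>\<^sub>A \<i>\<d> ?X \<in> Arr C (X \<otimes>\<^sub>O ?X) (?P \<otimes>\<^sub>O ?X)"
    "(\<phi> X \<cdot> g) \<otimes>\<^sub>A \<i>\<d> ?X \<in> Arr C (X \<otimes>\<^sub>O ?X) (?P \<otimes>\<^sub>O ?X)"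
    using c id_closed tens_closed by blast+
  have tc: "((\<phi> X \<cdot> f) \<otimes>\<^sub>A \<i>\<d> ?X) \<cdot> coev (D X) \<in> Arr C \<I> (?P \<otimes>\<^sub>O ?X)"
    "((\<phi> X \<cdot> g) \<otimes>\<^sub>A \<i>\<d> ?X) \<cdot> coev (D X) \<in> Arr C \<I> (?P \<otimes>\<^sub>O ?X)"
    using t coev_closed comp_closed by blast+
  have "ev (D ?X) \<cdot> ((\<phi> X \<cdot> (f \<oplus>\<^bsub>Hom C X X\<^esub> g)) \<otimes>\<^sub>A \<i>\<d> ?X) \<cdot> coev (D X) =
    (ev (D ?X) \<cdot> ((\<phi> X \<cdot> f) \<otimes>\<^sub>A \<i>\<d> ?X) \<cdot> coev (D X)) \<oplus>\<^bsub>Hom C \<I> \<I>\<^esub>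
    (ev (D ?X) \<cdot> ((\<phi> X \<cdot> g) \<otimes>\<^sub>A \<i>\<d> ?X) \<cdot> coev (D X))"
    using comp_add_right[OF piv_closed f g] tens_add_left[OF c id_closed[of ?X]]
      comp_add_left[OF t coev_closed] comp_add_right[OF ev_closed tc] by simp
  then show ?thesis
    using trace_arrow_closed[OF f] trace_arrow_closed[OF g] by (simp add: trace_def scal_add)
qed

lemma trace_zero: "trace X \<zero>\<^bsub>Hom C X X\<^esub> = 0"
  using trace_additive[of "\<zero>\<^bsub>Hom C X X\<^esub>" X "\<zero>\<^bsub>Hom C X X\<^esub>"] by simp

text \<open>
  Factor \<open>f\<close> through its image as a monomorphism \<open>i\<close> after an epimorphism \<open>g\<close>. The endomorphism \<open>g i\<close> of the image
  has the same trace, and \<open>f\<^sup>k\<^sup>+\<^sup>1 = i (g i)\<^sup>k g\<close> shows that it is nilpotent of smaller order.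
\<close>

lemma trace_nilpotent:
  assumes "f \<in> Arr C X X" "f [^]\<^bsub>end_algebra X\<^esub> (k::nat) = \<zero>\<^bsub>Hom C X X\<^esub>"
  shows "trace X f = 0"
  using assms
proof (induction k arbitrary: X f)
  case 0
  then have "\<i>\<d> X = \<zero>\<^bsub>Hom C X X\<^esub>" by simp
  then have "f = \<zero>\<^bsub>Hom C X X\<^esub>" using id_left[OF 0(1)] zero_comp[OF 0(1)] by metis
  then show ?case using trace_zero by simp
next
  case (Suc k)
  interpret E: finite_dim_algebra "end_algebra Z" for Z by (rule end_algebra_finite_dim)
  obtain Y i g where ig: "monic C Y X i" "epic C X Y g" "i \<cdot> g = f"
    using image_factorization[OF Suc.prems(1)] by blast
  have i: "i \<in> Arr C Y X" and g: "g \<in> Arr C X Y" using ig by (auto simp: monic_def epic_def)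
  let ?h = "g \<cdot> i"
  have h: "?h \<in> Arr C Y Y" using comp_closed[OF g i] .
  have hk: "?h [^]\<^bsub>end_algebra Y\<^esub> k \<in> Arr C Y Y" for k :: nat
    using E.nat_pow_closed[of ?h Y k] h by simp
  have pow: "f [^]\<^bsub>end_algebra X\<^esub> Suc k = i \<cdot> (?h [^]\<^bsub>end_algebra Y\<^esub> k) \<cdot> g" for k :: nat
  proof (induction k)
    case 0
    show ?case using ig(3) id_left[OF g] id_left[OF Suc.prems(1)] by simp
  next
    case (Suc k)
    have hg: "?h [^]\<^bsub>end_algebra Y\<^esub> k \<cdot> g \<in> Arr C X Y" using comp_closed[OF hk g] .
    have "f [^]\<^bsub>end_algebra X\<^esub> Suc (Suc k) = (i \<cdot> (?h [^]\<^bsub>end_algebra Y\<^esub> k) \<cdot> g) \<cdot> f"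
      using Suc.IH by simp
    also have "\<dots> = (i \<cdot> (?h [^]\<^bsub>end_algebra Y\<^esub> k) \<cdot> g) \<cdot> (i \<cdot> g)" by (simp only: ig(3))
    also have "\<dots> = i \<cdot> (?h [^]\<^bsub>end_algebra Y\<^esub> k) \<cdot> (g \<cdot> (i \<cdot> g))"
      using comp_assoc[OF i hg comp_closed[OF i g]] comp_assoc[OF hk g comp_closed[OF i g]] by simp
    also have "\<dots> = i \<cdot> (?h [^]\<^bsub>end_algebra Y\<^esub> Suc k) \<cdot> g"
      using comp_assoc[OF g i g] comp_assoc[OF hk h g] by simp
    finally show ?case .
  qed
  have "i \<cdot> ((?h [^]\<^bsub>end_algebra Y\<^esub> k) \<cdot> g) = i \<cdot> (\<zero>\<^bsub>Hom C Y Y\<^esub> \<cdot> g)"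
    using pow[of k] Suc.prems(2) zero_comp[OF g] comp_zero[OF i] by simp
  moreover have "\<zero>\<^bsub>Hom C Y Y\<^esub> \<cdot> g \<in> Arr C X Y" using g by (simp add: zero_comp)
  ultimately have "(?h [^]\<^bsub>end_algebra Y\<^esub> k) \<cdot> g = \<zero>\<^bsub>Hom C Y Y\<^esub> \<cdot> g"
    using ig(1) comp_closed[OF hk g, of k] unfolding monic_def by blast
  moreover have "\<zero>\<^bsub>Hom C Y Y\<^esub> \<in> Arr C Y Y" by simp
  ultimately have "?h [^]\<^bsub>end_algebra Y\<^esub> k = \<zero>\<^bsub>Hom C Y Y\<^esub>"
    using ig(2) hk[of k] unfolding epic_def by blast
  then have "trace Y ?h = 0" by (rule Suc.IH[OF h])
  then show ?case using trace_cyclic[OF i g] ig(3) by simp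
qed

text \<open>
  The trace of \<open>f\<close> is the dimension of the object through which \<open>f\<close> splits.
\<close>

lemma trace_idempotent:
  assumes f: "f \<in> Arr C X X" "f \<cdot> f = f" "f \<noteq> \<zero>\<^bsub>Hom C X X\<^esub>"
  shows "trace X f \<noteq> 0"
proof -
  obtain k K p where k: "k \<in> Arr C K X" "p \<in> Arr C X K" "k \<cdot> p = f" "p \<cdot> k = \<i>\<d> K"
    using split_idempotent[OF f(1,2)] by blast
  have "\<not> zero_ob C K"
  proof
    assume "zero_ob C K"
    then have "k = \<zero>\<^bsub>Hom C K X\<^esub>" using k(1) by (auto simp: zero_ob_def)
    then show False using zero_comp[OF k(2), of X] k(3) f(3) by simp
  qed
  moreover have "trace X f = scal (pivotal_dim C D \<phi> K)"
    using trace_cyclic[OF k(1,2)] k(3,4) piv_closed[of K]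
    by (simp add: trace_def pivotal_dim_def id_right)
  ultimately show ?thesis using dim_nonzero by simp
qed

lemma end_algebra_traced: "traced_algebra (end_algebra X) (trace X)"
proof (rule traced_algebra.intro[OF end_algebra_finite_dim], rule traced_algebra_axioms.intro)
  show "trace X x = 0" if "x \<in> carrier (end_algebra X)" "x [^]\<^bsub>end_algebra X\<^esub> k = \<zero>\<^bsub>end_algebra X\<^esub>"
    for x and k :: nat
    using that by (intro trace_nilpotent) simp_all
  show "trace X (x \<otimes>\<^bsub>end_algebra X\<^esub> y) = trace X (y \<otimes>\<^bsub>end_algebra X\<^esub> x)"
    if "x \<in> carrier (end_algebra X)" "y \<in> carrier (end_algebra X)" for x y
    using trace_cyclic[of x X X y] that by simp
qed (simp_all add: trace_additive trace_idempotent)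

end

section \<open>Frobenius subalgebras of a Frobenius algebra\<close>

context strict_monoidal_category
begin

abbreviation ty_mul :: "('a, 'b) frob \<Rightarrow> ('a, 'b) typed"
  where "ty_mul F \<equiv> (frob_ob F \<otimes>\<^sub>O frob_ob F, mul F, frob_ob F)"
abbreviation ty_comul :: "('a, 'b) frob \<Rightarrow> ('a, 'b) typed"
  where "ty_comul F \<equiv> (frob_ob F, comul F, frob_ob F \<otimes>\<^sub>O frob_ob F)"
abbreviation ty_unit :: "('a, 'b) frob \<Rightarrow> ('a, 'b) typed"
  where "ty_unit F \<equiv> (\<I>, unt F, frob_ob F)"
abbreviation ty_counit :: "('a, 'b) frob \<Rightarrow> ('a, 'b) typed"
  where "ty_counit F \<equiv> (frob_ob F, counit F, \<I>)"

lemma frobenius_typed: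
  assumes "frobenius_algebra C F"
  shows "frobenius_arrows fst tcod (tarr C) (tcmp C) (ttns C) (tidt C) (tens_ob C) (unit_ob C)
    (frob_ob F) (ty_mul F) (ty_comul F) (ty_unit F) (ty_counit F)"
  using assms
  by unfold_locales (simp_all add: frobenius_algebra_def unital_algebra_def counital_coalgebra_def
      typed_defs tens_ob_assoc tens_ob_unit_left tens_ob_unit_right)

lemma frob_star_bend:
  assumes A: "frobenius_algebra C A" and F: "frobenius_algebra C F"
    and f: "f \<in> Arr C (frob_ob A) (frob_ob F)"
  shows "(frob_ob F, frob_star C A F f, frob_ob A) = T.bend (frob_ob F) (frob_ob A)
      (tcmp C (ty_comul A) (ty_unit A))
      (tcmp C (tcmp C (ty_counit F) (ty_mul F)) (ttns C (tidt C (frob_ob F)) (frob_ob A, f, frob_ob F)))"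
    and "frob_star C A F f \<in> Arr C (frob_ob F) (frob_ob A)"
proof -
  interpret A: frobenius_arrows fst tcod "tarr C" "tcmp C" "ttns C" "tidt C" "tens_ob C" "unit_ob C"
    "frob_ob A" "ty_mul A" "ty_comul A" "ty_unit A" "ty_counit A"
    by (rule frobenius_typed[OF A])
  interpret F: frobenius_arrows fst tcod "tarr C" "tcmp C" "ttns C" "tidt C" "tens_ob C" "unit_ob C"
    "frob_ob F" "ty_mul F" "ty_comul F" "ty_unit F" "ty_counit F"
    by (rule frobenius_typed[OF F])
  have A': "coev (frob_dual C A) \<in> Arr C \<I> (frob_ob A \<otimes>\<^sub>O dual_ob (frob_dual C A))"
    using A.hom_pairing(2) by (simp add: A.copairing_def tcmp_def frob_dual_def)
  have F': "ev (frob_dual C F) \<in> Arr C (dual_ob (frob_dual C F) \<otimes>\<^sub>O frob_ob F) \<I>"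
    using F.hom_pairing(1) by (simp add: F.pairing_def tcmp_def frob_dual_def)
  show eq: "(frob_ob F, frob_star C A F f, frob_ob A) = T.bend (frob_ob F) (frob_ob A)
      (tcmp C (ty_comul A) (ty_unit A))
      (tcmp C (tcmp C (ty_counit F) (ty_mul F)) (ttns C (tidt C (frob_ob F)) (frob_ob A, f, frob_ob F)))"
    using dual_arr_bend[OF f F' A'] by (simp add: frob_star_def frob_dual_def tcmp_def)
  have "T.hom (frob_ob F, frob_star C A F f, frob_ob A) (frob_ob F) (frob_ob A)"
    unfolding eq
  proof (rule T.hom_bend[where X = "frob_ob A"])
    show "T.hom (tcmp C (ty_comul A) (ty_unit A)) \<I> (frob_ob A \<otimes>\<^sub>O frob_ob A)"
      using A.hom_pairing(2) by (simp only: A.copairing_def)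
    have "T.hom (tcmp C (ty_counit F) (ty_mul F)) (frob_ob F \<otimes>\<^sub>O frob_ob F) \<I>"
      "T.hom (frob_ob A, f, frob_ob F) (frob_ob A) (frob_ob F)"
      using F.hom_pairing(1) f by (simp_all only: F.pairing_def hom_typed simp_thms)
    then show "T.hom (tcmp C (tcmp C (ty_counit F) (ty_mul F)) (ttns C (tidt C (frob_ob F)) (frob_ob A, f, frob_ob F)))
      (frob_ob F \<otimes>\<^sub>O frob_ob A) \<I>"
      by (simp add: T.hom_def del: hom_typed)
  qed
  then show "frob_star C A F f \<in> Arr C (frob_ob F) (frob_ob A)" by simp
qed

lemma frob_sub_expectation:
  assumes F: "frobenius_algebra C F" and S: "frob_sub C F S"
  shows "frobenius_arrows.expectation fst tcod (tarr C) (tcmp C) (ttns C) (tidt C)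
      (frob_ob F) (ty_mul F) (ty_unit F) (ty_counit F) (frob_ob F, frob_idem C F S, frob_ob F)"
    and "frob_idem C F S \<in> Arr C (frob_ob F) (frob_ob F)"
proof -
  obtain A i where Si: "S = (A, i)" by fastforce
  have A: "frobenius_algebra C A" and i: "i \<in> Arr C (frob_ob A) (frob_ob F)"
    and im: "i \<cdot> mul A = mul F \<cdot> (i \<otimes>\<^sub>A i)" and ie: "i \<cdot> unt A = unt F"
    and ss: "frob_star C F A (frob_star C A F i) = i" and si: "frob_star C A F i \<cdot> i = \<i>\<d> (frob_ob A)"
    using S by (auto simp: Si frob_sub_def algebra_mono_def monic_def)
  interpret A: frobenius_arrows fst tcod "tarr C" "tcmp C" "ttns C" "tidt C" "tens_ob C" "unit_ob C"
    "frob_ob A" "ty_mul A" "ty_comul A" "ty_unit A" "ty_counit A"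
    by (rule frobenius_typed[OF A])
  interpret F: frobenius_arrows fst tcod "tarr C" "tcmp C" "ttns C" "tidt C" "tens_ob C" "unit_ob C"
    "frob_ob F" "ty_mul F" "ty_comul F" "ty_unit F" "ty_counit F"
    by (rule frobenius_typed[OF F])
  let ?i = "(frob_ob A, i, frob_ob F)" and ?p = "(frob_ob F, frob_star C A F i, frob_ob A)"
  note star = frob_star_bend[OF A F i]
  interpret S: frobenius_subalgebra_arrows fst tcod "tarr C" "tcmp C" "ttns C" "tidt C" "tens_ob C" "unit_ob C"
    "frob_ob A" "ty_mul A" "ty_comul A" "ty_unit A" "ty_counit A"
    "frob_ob F" "ty_mul F" "ty_comul F" "ty_unit F" "ty_counit F" ?i ?p
  proof
    show "T.hom ?i (frob_ob A) (frob_ob F)" using i by simp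
    show "tcmp C ?i (ty_mul A) = tcmp C (ty_mul F) (ttns C ?i ?i)" using im by (simp add: typed_defs)
    show "tcmp C ?i (ty_unit A) = ty_unit F" using ie by (simp add: typed_defs)
    show "?p = T.bend (frob_ob F) (frob_ob A) A.copairing (tcmp C F.pairing (ttns C (tidt C (frob_ob F)) ?i))"
      unfolding A.copairing_def F.pairing_def by (rule star(1))
    show "T.bend (frob_ob A) (frob_ob F) F.copairing (tcmp C A.pairing (ttns C (tidt C (frob_ob A)) ?p)) = ?i"
      unfolding F.copairing_def A.pairing_def using frob_star_bend(1)[OF F A star(2)] ss by simp
    show "tcmp C ?p ?i = tidt C (frob_ob A)" using si by (simp add: typed_defs)
  qed
  have eq: "tcmp C ?i ?p = (frob_ob F, frob_idem C F S, frob_ob F)"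
    by (simp add: tcmp_def frob_idem_def Si)
  show e: "F.expectation (frob_ob F, frob_idem C F S, frob_ob F)"
    using S.expectation unfolding eq .
  show "frob_idem C F S \<in> Arr C (frob_ob F) (frob_ob F)"
    using F.expectationD(1)[OF e] by simp
qed

end

lemma (in vectorspace) dim_trivial:
  assumes "carrier V \<subseteq> {\<zero>\<^bsub>V\<^esub>}"
  shows "dim = 0"
proof -
  have "\<zero>\<^bsub>V\<^esub> \<in> span {}" by (simp add: span_def lincomb_def)
  moreover have "span {} \<subseteq> carrier V" by (rule span_is_subset2) simp
  ultimately have "gen_set {}" using assms by auto
  then show ?thesis using gen_ge_dim[of "{}"] by simp
qed

lemma (in vectorspace) dim_one_multiple:
  assumes fd: fin_dim and dim: "dim = 1"
    and u: "u \<in> carrier V" "u \<noteq> \<zero>\<^bsub>V\<^esub>" and h: "h \<in> carrier V"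
  shows "\<exists>c\<in>carrier K. h = c \<odot>\<^bsub>V\<^esub> u"
proof -
  have single: "lincomb a {u} = a u \<odot>\<^bsub>V\<^esub> u" if "a \<in> {u} \<rightarrow> carrier K" for a
    using that u(1) by (simp add: lincomb_def)
  have "lin_indpt {u}"
  proof
    assume "lin_dep {u}"
    then obtain a where a: "a \<in> {u} \<rightarrow> carrier K" "lincomb a {u} = \<zero>\<^bsub>V\<^esub>" "a u \<noteq> \<zero>\<^bsub>K\<^esub>"
      using finite_lin_dep[of "{u}"] u(1) by auto
    then have au: "a u \<in> carrier K" "a u \<odot>\<^bsub>V\<^esub> u = \<zero>\<^bsub>V\<^esub>" using single by auto
    then have "u = inv\<^bsub>K\<^esub> (a u) \<odot>\<^bsub>V\<^esub> \<zero>\<^bsub>V\<^esub>" using mult_inverse u(1) a(3) by blast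
    also have "\<dots> = \<zero>\<^bsub>V\<^esub>" using au(1) a(3) by (intro smult_r_null) (simp add: field_Units)
    finally show False using u(2) by simp
  qed
  then have "basis {u}" using dim u(1) by (intro dim_li_is_basis[OF fd]) auto
  then have "h \<in> span {u}" using h by (simp add: basis_def)
  then obtain a where "a \<in> {u} \<rightarrow> carrier K" "lincomb a {u} = h"
    using finite_in_span[of "{u}" h] u(1) by auto
  then show ?thesis using single by auto
qed

context tensor_category
begin

text \<open>
  If the unit vanished, so would the identity of \<open>X\<close>, and \<open>Hom(1, X)\<close> would be zero.
\<close>

lemma connected_scalar:
  assumes F: "frobenius_algebra C F" and conn: "frob_connected C F"
  shows "unt F \<noteq> \<zero>\<^bsub>Hom C \<I> (frob_ob F)\<^esub>"
    and "\<And>h. h \<in> Arr C \<I> (frob_ob F) \<Longrightarrow> \<exists>c. h = c \<odot>\<^bsub>Hom C \<I> (frob_ob F)\<^esub> unt F"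
proof -
  let ?X = "frob_ob F" and ?H = "Hom C \<I> (frob_ob F)"
  have u: "unt F \<in> Arr C \<I> ?X" and m: "mul F \<in> Arr C (?X \<otimes>\<^sub>O ?X) ?X"
    and mu: "mul F \<cdot> (unt F \<otimes>\<^sub>A \<i>\<d> ?X) = \<i>\<d> ?X"
    using F by (auto simp: frobenius_algebra_def unital_algebra_def)
  have dim: "vectorspace.dim class_ring ?H = 1" using conn by (simp add: frob_connected_def)
  show nz: "unt F \<noteq> \<zero>\<^bsub>?H\<^esub>"
  proof
    assume z: "unt F = \<zero>\<^bsub>?H\<^esub>"
    have "unt F \<otimes>\<^sub>A \<i>\<d> ?X = 0 \<odot>\<^bsub>Hom C ?X (?X \<otimes>\<^sub>O ?X)\<^esub> (unt F \<otimes>\<^sub>A \<i>\<d> ?X)"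
      using tens_smult_left[OF u id_closed[of ?X], of 0] z smult_zero_left[OF u]
      by (simp add: tens_ob_unit_left)
    moreover have "unt F \<otimes>\<^sub>A \<i>\<d> ?X \<in> Arr C ?X (?X \<otimes>\<^sub>O ?X)"
      using tens_closed[OF u id_closed[of ?X]] by (simp add: tens_ob_unit_left)
    ultimately have "unt F \<otimes>\<^sub>A \<i>\<d> ?X = \<zero>\<^bsub>Hom C ?X (?X \<otimes>\<^sub>O ?X)\<^esub>"
      using smult_zero_left by metis
    then have id0: "\<i>\<d> ?X = \<zero>\<^bsub>Hom C ?X ?X\<^esub>" using mu comp_zero[OF m] by simp
    have "h = \<zero>\<^bsub>?H\<^esub>" if "h \<in> carrier ?H" for h
      using id_left[OF that] zero_comp[OF that] id0 by metis
    then have "vectorspace.dim class_ring ?H = 0"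
      by (intro vectorspace.dim_trivial[OF hom_vectorspace]) auto
    then show False using dim by simp
  qed
  show "\<exists>c. h = c \<odot>\<^bsub>?H\<^esub> unt F" if "h \<in> Arr C \<I> ?X" for h
    using vectorspace.dim_one_multiple[OF hom_vectorspace hom_fin_dim dim u nz that] by auto
qed

lemma connected_typed:
  assumes F: "frobenius_algebra C F" and conn: "frob_connected C F"
  shows "connected_frobenius_arrows fst tcod (tarr C) (tcmp C) (ttns C) (tidt C) (tens_ob C) (unit_ob C)
    (frob_ob F) (ty_mul F) (ty_comul F) (ty_unit F) (ty_counit F)"
proof (rule connected_frobenius_arrows.intro[OF frobenius_typed[OF F]], rule connected_frobenius_arrows_axioms.intro)
  have u: "unt F \<in> Arr C \<I> (frob_ob F)"
    using F by (auto simp: frobenius_algebra_def unital_algebra_def)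
  fix s h f :: "('a, 'b) typed"
  show "ttns C s f = ttns C f s" if s: "T.hom s \<I> \<I>" and f: "tarr C f"
  proof -
    obtain s' where s': "s = (\<I>, s', \<I>)" "s' \<in> Arr C \<I> \<I>" using s by (cases s) auto
    obtain Y f' Z where f': "f = (Y, f', Z)" "f' \<in> Arr C Y Z" using f by (cases f) (auto simp: tarr_def)
    show ?thesis
      using scalar_tens[OF s'(2) f'(2)] by (simp add: s' f' ttns_def tens_ob_unit_left tens_ob_unit_right)
  qed
  show "\<exists>s. T.hom s \<I> \<I> \<and> h = tcmp C (ty_unit F) s" if h: "T.hom h \<I> (frob_ob F)"
  proof -
    obtain h' where h': "h = (\<I>, h', frob_ob F)" "h' \<in> Arr C \<I> (frob_ob F)" using h by (cases h) auto
    obtain c where c: "h' = c \<odot>\<^bsub>Hom C \<I> (frob_ob F)\<^esub> unt F"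
      using connected_scalar(2)[OF F conn h'(2)] by blast
    have "unt F \<cdot> (c \<odot>\<^bsub>Hom C \<I> \<I>\<^esub> \<i>\<d> \<I>) = h'"
      using comp_smult_right[OF u id_closed, of c] id_right[OF u] c by simp
    then show ?thesis
      using smult_closed[OF id_closed[of \<I>], of c]
      by (intro exI[of _ "(\<I>, c \<odot>\<^bsub>Hom C \<I> \<I>\<^esub> \<i>\<d> \<I>, \<I>)"]) (simp add: h' tcmp_def)
  qed
qed

end

context positive_tensor_category
begin

text \<open>
  This is \<open>pivotal_pairing_mult\<close> for the chosen duals. The identifications that make the double dual monoidal are
  composed of dual arrows, which \<open>dual_arr_bend\<close> presents as transposes.
\<close>

lemma pivotal_form:
  assumes F: "frobenius_algebra C F"
  defines "X \<equiv> frob_ob F"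
  obtains w p where "T.hom w (X \<otimes>\<^sub>O X) \<I>" "T.hom p X X"
    "tcmp C (tcmp C (ty_counit F) (ty_mul F)) (ttns C p (tidt C X)) = w"
    "tcmp C w (ttns C (ty_mul F) (tidt C X)) =
      tcmp C w (ttns C (tidt C X) (tcmp C (ty_mul F) (ttns C p (tidt C X))))"
    "\<And>f. f \<in> Arr C X X \<Longrightarrow> trace X f = scal (fst (snd
      (tcmp C w (tcmp C (ttns C (X, f, X) (tidt C X)) (tcmp C (ty_comul F) (ty_unit F))))))"
proof -
  interpret F: frobenius_arrows fst tcod "tarr C" "tcmp C" "ttns C" "tidt C" "tens_ob C" "unit_ob C"
    X "ty_mul F" "ty_comul F" "ty_unit F" "ty_counit F"
    unfolding X_def by (rule frobenius_typed[OF F])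
  let ?XX = "X \<otimes>\<^sub>O X" and ?X' = "dual_of X"
  let ?X'' = "dual_of ?X'" and ?Z' = "dual_of ?XX"
  let ?Z'' = "dual_of ?Z'"
  have m: "mul F \<in> Arr C ?XX X" using F.homs(1) by (simp add: X_def)
  have e2: "T.hom (ev_of ?X') (?X'' \<otimes>\<^sub>O ?X') \<I>" by (simp add: ev_closed)
  have e2Z: "T.hom (ev_of ?Z') (?Z'' \<otimes>\<^sub>O ?Z') \<I>" by (simp add: ev_closed)
  have piv: "T.hom (piv X) X ?X''" "T.hom (piv ?XX) ?XX ?Z''" by (simp_all add: piv_closed)
  let ?cT = "tcmp C (ttns C (tidt C X) (ttns C (coev_of X) (tidt C ?X'))) (coev_of X)"
  let ?eT = "tcmp C (ev_of ?X') (ttns C (tidt C ?X'') (ttns C (ev_of ?X') (tidt C ?X')))"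
  let ?th = "T.bend ?Z' (?X' \<otimes>\<^sub>O ?X') ?cT (ev_of ?XX)"
  let ?E = "tens_dual C X X (D X) (D X)" and ?G = "tens_dual C ?X' ?X' (D ?X') (D ?X')"
  let ?th' = "dual_arr C ?E (D ?XX) (\<i>\<d> ?XX)"
  have cT: "?cT = (\<I>, coev ?E, ?XX \<otimes>\<^sub>O dual_ob ?E)"
    by (simp add: typed_defs tens_dual_def tens_ob_assoc tens_ob_unit_left tens_ob_unit_right)
  have cT_hom: "T.hom ?cT \<I> (?XX \<otimes>\<^sub>O (?X' \<otimes>\<^sub>O ?X'))"
  proof -
    have "T.hom (coev_of X) \<I> (X \<otimes>\<^sub>O ?X')" by (simp add: coev_closed)
    then show ?thesis by (simp add: T.hom_def del: hom_typed)
  qed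
  have eT: "?eT = (dual_ob ?G \<otimes>\<^sub>O (?X' \<otimes>\<^sub>O ?X'), ev ?G, \<I>)"
    by (simp add: typed_defs tens_dual_def tens_ob_assoc tens_ob_unit_left tens_ob_unit_right)
  have eT_hom: "T.hom ?eT ((?X'' \<otimes>\<^sub>O ?X'') \<otimes>\<^sub>O (?X' \<otimes>\<^sub>O ?X')) \<I>"
    using e2 by (simp add: T.hom_def del: hom_typed)
  have coevE: "coev ?E \<in> Arr C \<I> (?XX \<otimes>\<^sub>O dual_ob ?E)"
    using cT_hom unfolding cT by (simp add: tens_dual_def)
  have evG: "ev ?G \<in> Arr C (dual_ob ?G \<otimes>\<^sub>O (?X' \<otimes>\<^sub>O ?X')) \<I>"
    using eT_hom unfolding eT by (simp add: tens_dual_def)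
  have th: "?th = (?Z', ?th', ?X' \<otimes>\<^sub>O ?X')"
  proof -
    have "T.hom (ev_of ?XX) (?Z' \<otimes>\<^sub>O ?XX) \<I>" by (simp add: ev_closed)
    then have "tcmp C (ev_of ?XX) (ttns C (tidt C ?Z') (tidt C ?XX)) = ev_of ?XX"
      by (simp add: T.hom_def T.idt_tob[symmetric] del: hom_typed)
    then show ?thesis
      unfolding cT using dual_arr_bend[OF id_closed ev_closed[of ?XX] coevE]
      by (simp add: tens_dual_def tidt_def)
  qed
  have th_hom: "T.hom ?th ?Z' (?X' \<otimes>\<^sub>O ?X')"
    by (rule T.hom_bend[OF cT_hom]) (simp add: ev_closed)
  let ?J = "T.bend (?X'' \<otimes>\<^sub>O ?X'') ?Z'' (coev_of ?Z') (tcmp C ?eT (ttns C (tidt C (?X'' \<otimes>\<^sub>O ?X'')) ?th))"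
  have G: "dual_ob ?G = ?X'' \<otimes>\<^sub>O ?X''" by (simp add: tens_dual_def)
  have th'_hom: "?th' \<in> Arr C ?Z' (?X' \<otimes>\<^sub>O ?X')" using th_hom unfolding th by simp
  have J: "(?X'' \<otimes>\<^sub>O ?X'', bidual_tens C D X X, ?Z'') = ?J"
    unfolding th eT bidual_tens_def
    using dual_arr_bend[OF th'_hom evG coev_closed[of ?Z']] by (simp only: G)
  have "\<phi> ?XX = bidual_tens C D X X \<cdot> (\<phi> X \<otimes>\<^sub>A \<phi> X)"
    using pivotal by (simp add: pivotal_structure_def)
  then have "piv ?XX = tcmp C (?X'' \<otimes>\<^sub>O ?X'', bidual_tens C D X X, ?Z'') (ttns C (piv X) (piv X))"
    by (simp add: tcmp_def ttns_def)
  then have mon: "piv ?XX = tcmp C ?J (ttns C (piv X) (piv X))" by (simp only: J)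
  have nat: "tcmp C (T.bend ?Z'' ?X'' (coev_of ?X') (tcmp C (ev_of ?Z') (ttns C (tidt C ?Z'')
      (T.bend ?X' ?Z' (coev_of ?XX) (tcmp C (ev_of X) (ttns C (tidt C ?X') (?XX, mul F, X)))))))
      (piv ?XX) = tcmp C (piv X) (?XX, mul F, X)"
    by (rule piv_natural[OF m])
  have mulX: "(?XX, mul F, X) = ty_mul F" by (simp add: X_def)
  note P = F.pivotal_pairing_mult[OF dual_of_pair e2 dual_of_pair dual_of_pair dual_of_pair e2Z piv
    mon nat[unfolded mulX]]
  show thesis
  proof (rule that[OF P(1,2,3,4)[unfolded F.pairing_def]])
    fix f assume f: "f \<in> Arr C X X"
    have "T.hom (X, f, X) X X" using f by simp
    note tr = F.trace_pairing[OF dual_of_pair e2 piv(1) this, unfolded typed_trace F.pairing_def F.copairing_def]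
    show "trace X f = scal (fst (snd (tcmp C (tcmp C (ev_of ?X') (ttns C (piv X)
        (T.bend X ?X' (coev_of X) (tcmp C (ty_counit F) (ty_mul F)))))
        (tcmp C (ttns C (X, f, X) (tidt C X)) (tcmp C (ty_comul F) (ty_unit F))))))"
      unfolding tr[symmetric] by (simp add: trace_def)
  qed
qed

end

section \<open>Finiteness\<close>

context positive_tensor_category
begin

lemma trace_smult:
  assumes f: "f \<in> Arr C X X"
  shows "trace X (c \<odot>\<^bsub>Hom C X X\<^esub> f) = c * trace X f"
proof -
  let ?X = "dual_of X" and ?P = "dual_of (dual_of X)"
  have a: "\<phi> X \<cdot> f \<in> Arr C X ?P" by (rule comp_closed[OF piv_closed f])
  have t: "(\<phi> X \<cdot> f) \<otimes>\<^sub>A \<i>\<d> ?X \<in> Arr C (X \<otimes>\<^sub>O ?X) (?P \<otimes>\<^sub>O ?X)"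
    by (rule tens_closed[OF a id_closed])
  have tc: "((\<phi> X \<cdot> f) \<otimes>\<^sub>A \<i>\<d> ?X) \<cdot> coev (D X) \<in> Arr C \<I> (?P \<otimes>\<^sub>O ?X)"
    by (rule comp_closed[OF t coev_closed])
  have "ev (D ?X) \<cdot> ((\<phi> X \<cdot> (c \<odot>\<^bsub>Hom C X X\<^esub> f)) \<otimes>\<^sub>A \<i>\<d> ?X) \<cdot> coev (D X) =
    c \<odot>\<^bsub>Hom C \<I> \<I>\<^esub> (ev (D ?X) \<cdot> ((\<phi> X \<cdot> f) \<otimes>\<^sub>A \<i>\<d> ?X) \<cdot> coev (D X))"
    using comp_smult_right[OF piv_closed f, of c] tens_smult_left[OF a id_closed[of ?X], of c]
      comp_smult_left[OF t coev_closed, of c] comp_smult_right[OF ev_closed tc, of c] by simp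
  then show ?thesis using scal_smult[OF trace_arrow_closed[OF f]] by (simp add: trace_def)
qed

text \<open>
  On the projections of a group algebra onto the spans of two subgroups, the value of this form is the order
  of their intersection, up to normalisation.
\<close>

definition form :: "('a, 'b) frob \<Rightarrow> 'b \<Rightarrow> 'b \<Rightarrow> complex"
  where "form F a b = scal ((counit F \<cdot> mul F) \<cdot> (a \<otimes>\<^sub>A b) \<cdot> (comul F \<cdot> unt F))"

text \<open>
  Connectedness provides two scalars for expectations \<open>a\<close> and \<open>b\<close> with convolution \<open>q\<close>: the factor \<open>\<kappa>\<close> by which
  \<open>q\<close> acts on products, and \<open>\<sigma>\<close>, which is the trace of \<open>b\<close> up to the factor \<open>\<epsilon> = counit (unit)\<close>. The form is
  \<open>\<epsilon> \<kappa>\<close>, and \<open>\<tau> q = \<sigma> \<tau> a\<close>. So \<open>g = q / \<kappa>\<close> has the properties required by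
  \<open>finite_idempotents_of_product_form\<close>, provided that \<open>\<kappa> \<noteq> 0\<close>; and \<open>\<kappa> = 0\<close> would make \<open>q\<close> nilpotent with
  nonzero trace.
\<close>

theorem finite_expectations:
  assumes F: "frobenius_algebra C F" and conn: "frob_connected C F"
  defines "X \<equiv> frob_ob F"
  shows "finite {b. frobenius_arrows.expectation fst tcod (tarr C) (tcmp C) (ttns C) (tidt C)
    X (ty_mul F) (ty_unit F) (ty_counit F) (X, b, X)}"
proof -
  interpret F: connected_frobenius_arrows fst tcod "tarr C" "tcmp C" "ttns C" "tidt C" "tens_ob C" "unit_ob C"
    X "ty_mul F" "ty_comul F" "ty_unit F" "ty_counit F"
    unfolding X_def by (rule connected_typed[OF F conn])
  interpret E: traced_algebra "end_algebra X" "trace X" by (rule end_algebra_traced)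
  have mul: "mul F \<in> Arr C (X \<otimes>\<^sub>O X) X" and comul: "comul F \<in> Arr C X (X \<otimes>\<^sub>O X)"
    and unt: "unt F \<in> Arr C \<I> X" and counit: "counit F \<in> Arr C X \<I>"
    using F.homs by (simp_all add: X_def)
  have pair: "counit F \<cdot> mul F \<in> Arr C (X \<otimes>\<^sub>O X) \<I>" and copair: "comul F \<cdot> unt F \<in> Arr C \<I> (X \<otimes>\<^sub>O X)"
    using comp_closed[OF counit mul] comp_closed[OF comul unt] by simp_all
  have ne: "counit F \<cdot> unt F \<in> Arr C \<I> \<I>" by (rule comp_closed[OF counit unt])
  obtain w p where w: "T.hom w (X \<otimes>\<^sub>O X) \<I>" and p: "T.hom p X X"
    and wp: "tcmp C F.pairing (ttns C p (tidt C X)) = w"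
    and wm: "tcmp C w (ttns C (ty_mul F) (tidt C X)) =
      tcmp C w (ttns C (tidt C X) (tcmp C (ty_mul F) (ttns C p (tidt C X))))"
    and tr: "\<And>f. f \<in> Arr C X X \<Longrightarrow> trace X f = scal (fst (snd
      (tcmp C w (tcmp C (ttns C (X, f, X) (tidt C X)) F.copairing))))"
    unfolding F.pairing_def F.copairing_def unfolding X_def using pivotal_form[OF F] by blast
  let ?S = "{b. F.expectation (X, b, X)}"
  have S: "b \<in> Arr C X X" "b \<cdot> b = b" "b \<cdot> unt F = unt F" if "b \<in> ?S" for b
    using F.expectationD(1,2,3)[of "(X, b, X)"] that by (simp_all add: tcmp_def X_def)
  have nz: "b \<noteq> \<zero>\<^bsub>Hom C X X\<^esub>" if "b \<in> ?S" for b
    using S(3)[OF that] zero_comp[OF unt] connected_scalar(1)[OF F conn] by (auto simp: X_def)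
  have scalar_act: "ttns C s (X, f, X) = (X, scal (fst (snd s)) \<odot>\<^bsub>Hom C X X\<^esub> f, X)"
    "fst (snd s) \<in> Arr C \<I> \<I>" if "T.hom s \<I> \<I>" "f \<in> Arr C X X" for s f
  proof -
    obtain s' where s': "s = (\<I>, s', \<I>)" "s' \<in> Arr C \<I> \<I>" using \<open>T.hom s \<I> \<I>\<close> by (cases s) auto
    show "ttns C s (X, f, X) = (X, scal (fst (snd s)) \<odot>\<^bsub>Hom C X X\<^esub> f, X)" "fst (snd s) \<in> Arr C \<I> \<I>"
      using scalar_tens(1)[OF s'(2) that(2)] s' by (simp_all add: ttns_def tens_ob_unit_left)
  qed
  show ?thesis
  proof (rule E.finite_idempotents_of_product_form[where \<beta> = "form F"])
    fix a assume a: "a \<in> ?S"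
    show "a \<in> carrier (end_algebra X) \<and> a \<otimes>\<^bsub>end_algebra X\<^esub> a = a \<and> a \<noteq> \<zero>\<^bsub>end_algebra X\<^esub>"
      using S[OF a] nz[OF a] by simp
    note aX = S(1)[OF a]
    fix v assume "v \<in> carrier (end_algebra X)"
    then have v: "v \<in> Arr C X X" by simp
    have av: "a \<otimes>\<^sub>A v \<in> Arr C (X \<otimes>\<^sub>O X) (X \<otimes>\<^sub>O X)" by (rule tens_closed[OF aX v])
    have avc: "(a \<otimes>\<^sub>A v) \<cdot> (comul F \<cdot> unt F) \<in> Arr C \<I> (X \<otimes>\<^sub>O X)" by (rule comp_closed[OF av copair])
    have avp: "(counit F \<cdot> mul F) \<cdot> (a \<otimes>\<^sub>A v) \<cdot> (comul F \<cdot> unt F) \<in> Arr C \<I> \<I>" by (rule comp_closed[OF pair avc])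
    {
      fix u assume "u \<in> carrier (end_algebra X)"
      then have u: "u \<in> Arr C X X" by simp
      have au: "a \<otimes>\<^sub>A u \<in> Arr C (X \<otimes>\<^sub>O X) (X \<otimes>\<^sub>O X)" by (rule tens_closed[OF aX u])
      have auc: "(a \<otimes>\<^sub>A u) \<cdot> (comul F \<cdot> unt F) \<in> Arr C \<I> (X \<otimes>\<^sub>O X)" by (rule comp_closed[OF au copair])
      have aup: "(counit F \<cdot> mul F) \<cdot> (a \<otimes>\<^sub>A u) \<cdot> (comul F \<cdot> unt F) \<in> Arr C \<I> \<I>" by (rule comp_closed[OF pair auc])
      show "form F a (v \<oplus>\<^bsub>end_algebra X\<^esub> u) = form F a v + form F a u"
        using tens_add_right[OF aX v u] comp_add_left[OF av au copair] comp_add_right[OF pair avc auc]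
          scal_add[OF avp aup] by (simp add: form_def)
    }
    show "form F a (c \<odot>\<^bsub>end_algebra X\<^esub> v) = c * form F a v" for c
      using tens_smult_right[OF aX v, of c] comp_smult_left[OF av copair, of c] comp_smult_right[OF pair avc, of c]
        scal_smult[OF avp, of c] by (simp add: form_def)
  next
    fix a b assume a: "a \<in> ?S" and b: "b \<in> ?S"
    have eA: "F.expectation (X, a, X)" and eB: "F.expectation (X, b, X)" using a b by simp_all
    note hA = F.expectationD(1)[OF eA] and hB = F.expectationD(1)[OF eB]
    show "b \<otimes>\<^bsub>end_algebra X\<^esub> a = b" if "a \<otimes>\<^bsub>end_algebra X\<^esub> b = b"
      using F.expectation_selfadjoint_cmp[OF eA eB] that by (simp add: tcmp_def)
    have hc: "T.hom (tcmp C (ty_mul F) (tcmp C f F.copairing)) \<I> X" if "T.hom f (X \<otimes>\<^sub>O X) (X \<otimes>\<^sub>O X)" for f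
      using that F.homs(1) F.hom_pairing(2) by (simp add: T.hom_def X_def del: hom_typed)
    have "T.hom (ttns C (X, a, X) (X, b, X)) (X \<otimes>\<^sub>O X) (X \<otimes>\<^sub>O X)"
      using hA hB by (simp add: T.hom_def del: hom_typed)
    then obtain k where k: "T.hom k \<I> \<I>"
      and keq: "tcmp C (ty_mul F) (tcmp C (ttns C (X, a, X) (X, b, X)) F.copairing) = tcmp C (ty_unit F) k"
      using F.connected[OF hc] by blast
    have "T.hom (ttns C (tcmp C p (X, b, X)) (tidt C X)) (X \<otimes>\<^sub>O X) (X \<otimes>\<^sub>O X)"
      using p hB by (simp add: T.hom_def del: hom_typed)
    then obtain s where s: "T.hom s \<I> \<I>"
      and seq: "tcmp C (ty_mul F) (tcmp C (ttns C (tcmp C p (X, b, X)) (tidt C X)) F.copairing) = tcmp C (ty_unit F) s"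
      using F.connected[OF hc] by blast
    obtain k' where k': "k = (\<I>, k', \<I>)" "k' \<in> Arr C \<I> \<I>" using k by (cases k) auto
    obtain s' where s': "s = (\<I>, s', \<I>)" "s' \<in> Arr C \<I> \<I>" using s by (cases s) auto
    let ?\<kappa> = "scal k'" and ?\<sigma> = "scal s'" and ?\<epsilon> = "scal (counit F \<cdot> unt F)"
    obtain q where q: "F.convolution (X, a, X) (X, b, X) = (X, q, X)" "q \<in> Arr C X X"
      using F.hom_convolution[OF hA hB] by (cases "F.convolution (X, a, X) (X, b, X)") auto
    note range = F.convolution_range[OF eA eB k keq, unfolded q(1)]
    have qa: "q \<cdot> a = ?\<kappa> \<odot>\<^bsub>Hom C X X\<^esub> a" and qb: "q \<cdot> b = ?\<kappa> \<odot>\<^bsub>Hom C X X\<^esub> b"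
      and qq: "q \<cdot> q = ?\<kappa> \<odot>\<^bsub>Hom C X X\<^esub> q"
      using range scalar_act(1)[OF k S(1)[OF a]] scalar_act(1)[OF k S(1)[OF b]] scalar_act(1)[OF k q(2)]
      by (simp_all add: tcmp_def k')
    note ct = F.convolution_trace[OF w p wp wm hA hB s seq]
    have tra: "trace X q = ?\<sigma> * trace X a"
    proof -
      let ?t = "tcmp C w (tcmp C (ttns C (X, a, X) (tidt C X)) F.copairing)"
      have t: "T.hom ?t \<I> \<I>" using w hA F.hom_pairing(2) by (simp add: T.hom_def del: hom_typed)
      obtain t' where t': "?t = (\<I>, t', \<I>)" "t' \<in> Arr C \<I> \<I>" using t by (cases ?t) auto
      have "trace X q = scal (fst (snd (ttns C s ?t)))"
        using tr[OF q(2)] ct(1) unfolding q(1) by simp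
      also have "\<dots> = scal (?\<sigma> \<odot>\<^bsub>Hom C \<I> \<I>\<^esub> t')"
        unfolding t'(1) s'(1) using scalar_tens(1)[OF s'(2) t'(2)] by (simp add: ttns_def)
      also have "\<dots> = ?\<sigma> * trace X a"
        using scal_smult[OF t'(2)] tr[OF S(1)[OF a]] by (simp add: t'(1))
      finally show ?thesis .
    qed
    have trb: "trace X b = ?\<epsilon> * ?\<sigma>"
    proof -
      have "trace X b = scal (counit F \<cdot> (unt F \<cdot> s'))"
        using tr[OF S(1)[OF b]] ct(2) by (simp add: s' tcmp_def)
      also have "\<dots> = ?\<epsilon> * ?\<sigma>"
        using comp_assoc[OF counit unt s'(2)] scal_comp[OF ne s'(2)] by simp
      finally show ?thesis .
    qed
    have form: "form F a b = ?\<epsilon> * ?\<kappa>"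
    proof -
      have ab: "(a \<otimes>\<^sub>A b) \<cdot> (comul F \<cdot> unt F) \<in> Arr C \<I> (X \<otimes>\<^sub>O X)"
        by (rule comp_closed[OF tens_closed[OF S(1)[OF a] S(1)[OF b]] copair])
      have "mul F \<cdot> ((a \<otimes>\<^sub>A b) \<cdot> (comul F \<cdot> unt F)) = unt F \<cdot> k'"
        using keq by (simp add: F.copairing_def tcmp_def ttns_def k')
      then have "form F a b = scal (counit F \<cdot> (unt F \<cdot> k'))"
        using comp_assoc[OF counit mul ab] by (simp add: form_def)
      then show ?thesis using comp_assoc[OF counit unt k'(2)] scal_comp[OF ne k'(2)] by simp
    qed
    have tra0: "trace X a \<noteq> 0" and trb0: "trace X b \<noteq> 0"
      using trace_idempotent S nz a b by blast+
    have trq0: "trace X q \<noteq> 0" using tra tra0 trb trb0 by auto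
    have \<kappa>0: "?\<kappa> \<noteq> 0"
    proof
      assume "?\<kappa> = 0"
      then have "q \<cdot> q = \<zero>\<^bsub>Hom C X X\<^esub>" using qq smult_zero_left[OF q(2)] by simp
      then have "trace X q = 0"
        using q(2) id_left[OF q(2)] by (intro trace_nilpotent[of q X 2]) (simp_all add: numeral_2_eq_2)
      then show False using trq0 by simp
    qed
    let ?g = "inverse ?\<kappa> \<odot>\<^bsub>Hom C X X\<^esub> q"
    have g: "?g \<in> Arr C X X" by (rule smult_closed[OF q(2)])
    have cancel: "inverse ?\<kappa> \<odot>\<^bsub>Hom C X X\<^esub> (?\<kappa> \<odot>\<^bsub>Hom C X X\<^esub> f) = f" if "f \<in> Arr C X X" for f
      using smult_smult[OF that, of "inverse ?\<kappa>" ?\<kappa>] smult_one[OF that] \<kappa>0 by simp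
    have ga: "?g \<cdot> a = a" and gb: "?g \<cdot> b = b" and gq: "?g \<cdot> q = q"
      using comp_smult_left[OF q(2) S(1)[OF a], of "inverse ?\<kappa>"] comp_smult_left[OF q(2) S(1)[OF b], of "inverse ?\<kappa>"]
        comp_smult_left[OF q(2) q(2), of "inverse ?\<kappa>"] qa qb qq cancel S(1)[OF a] S(1)[OF b] q(2) by simp_all
    have gg: "?g \<cdot> ?g = ?g" using comp_smult_right[OF g q(2), of "inverse ?\<kappa>"] gq by simp
    have ag: "a = b \<longrightarrow> a \<cdot> ?g = ?g"
    proof
      assume "a = b"
      then have "a \<cdot> q = q" using F.expectation_absorb[OF eA] q(1) by (simp add: tcmp_def)
      then show "a \<cdot> ?g = ?g" using comp_smult_right[OF S(1)[OF a] q(2), of "inverse ?\<kappa>"] by simp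
    qed
    have "form F a b * trace X ?g = trace X a * trace X b"
      using form tra trb trace_smult[OF q(2), of "inverse ?\<kappa>"] \<kappa>0 by (simp add: field_simps)
    then show "\<exists>g\<in>carrier (end_algebra X). g \<otimes>\<^bsub>end_algebra X\<^esub> g = g \<and> g \<otimes>\<^bsub>end_algebra X\<^esub> a = a \<and>
        g \<otimes>\<^bsub>end_algebra X\<^esub> b = b \<and> (a = b \<longrightarrow> a \<otimes>\<^bsub>end_algebra X\<^esub> g = g) \<and>
        form F a b * trace X g = trace X a * trace X b"
      using g gg ga gb ag by (intro bexI[of _ ?g]) simp_all
  qed
qed

text \<open>
  A class of the poset is determined by the common idempotent of its members.
\<close>

lemma finite_frob_sub_poset:
  assumes F: "frobenius_algebra C F" and conn: "frob_connected C F"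
  shows "finite (carrier (frob_sub_poset C F))"
proof -
  let ?S = "{S. frob_sub C F S}" and ?class = "\<lambda>b. {T. frob_sub C F T \<and> b = frob_idem C F T}"
  have "frob_idem C F ` ?S \<subseteq> {b. frobenius_arrows.expectation fst tcod (tarr C) (tcmp C) (ttns C) (tidt C)
    (frob_ob F) (ty_mul F) (ty_unit F) (ty_counit F) (frob_ob F, b, frob_ob F)}"
    using frob_sub_expectation(1)[OF F] by auto
  from finite_subset[OF this finite_expectations[OF F conn]]
  have "finite (?class ` frob_idem C F ` ?S)" by (rule finite_imageI)
  moreover have "carrier (frob_sub_poset C F) \<subseteq> ?class ` frob_idem C F ` ?S"
    by (auto simp: frob_sub_poset_def frob_sub_equiv_def quotient_def)
  ultimately show ?thesis by (rule rev_finite_subset)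
qed

end

theorem corollary9p16:
  fixes C :: "('o, 'm) tcat" and X :: "('o, 'm) frob"
    and L :: "(('o, 'm) frob \<times> 'm) set set"
  assumes "tensor_category C" and "positive C"
    and "frobenius_algebra C X" and "frob_connected C X"
    and "coherent_sublattice C X L"
  shows "finite L"
proof -
  interpret tensor_category C by fact
  obtain D \<phi> where D: "\<And>X. left_dual C X (D X)" and piv: "pivotal_structure C D \<phi>"
    and pos: "\<And>Y. \<not> zero_ob C Y \<Longrightarrow> \<exists>r::real. r > 0 \<and>
      pivotal_dim C D \<phi> Y = complex_of_real r \<odot>\<^bsub>Hom C \<I>\<^bsub>C\<^esub> \<I>\<^bsub>C\<^esub>\<^esub> \<i>\<d>\<^bsub>C\<^esub> \<I>\<^bsub>C\<^esub>"
    using assms(2) unfolding positive_def by blast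
  interpret positive_tensor_category C D \<phi>
  proof
    show "scal (pivotal_dim C D \<phi> Y) \<noteq> 0" if "\<not> zero_ob C Y" for Y
      using pos[OF that] by auto
  qed (use D piv in auto)
  have "L \<subseteq> carrier (frob_sub_poset C X)"
    using assms(5) by (simp add: coherent_sublattice_def Let_def)
  then show ?thesis
    using finite_frob_sub_poset[OF assms(3,4)] by (rule finite_subset)
qed

end
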